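(* For every integer $n\geq 2$, the groups $\mathrm{SL}(n,\mathbb{Z})$, $\mathrm{PSL}(n,\mathbb{Z})$, $\mathrm{GL}(n,\mathbb{Z})$ and $\mathrm{PGL}(n,\mathbb{Z})$ have the $R_\infty$-property.
   Context: For a group $G$ and an endomorphism $\phi:G\to G$, the group $G$ acts on itself by $g.x=gx\phi(g^{-1})$; the orbits are called the $\phi$-twisted conjugacy classes. The Reidemeister number $R(\phi)$ is the cardinality of the set of $\phi$-twisted conjugacy classes. A group $G$ has the $R_\infty$-property if $R(\phi)=\infty$, i.e. there are infinitely many $\phi$-twisted conjugacy classes, for every automorphism $\phi$ of $G$. $\mathrm{PSL}(n,\mathbb{Z})$ and $\mathrm{PGL}(n,\mathbb{Z})$ denote the quotients of $\mathrm{SL}(n,\mathbb{Z})$ and $\mathrm{GL}(n,\mathbb{Z})$ by their centres. *)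

theory Defs
  imports
    "HOL-Algebra.Algebra"
    "HOL-Library.Extended_Nat"
    "Jordan_Normal_Form.Determinant"
begin

text \<open>The action is restricted to \<open>carrier G\<close> only because \<^const>\<open>group_action\<close> is formulated for
  extensional bijections; the orbits of elements of \<open>carrier G\<close> are unaffected.\<close>

definition twisted_action ::
  "('a, 'b) monoid_scheme \<Rightarrow> ('a \<Rightarrow> 'a) \<Rightarrow> 'a \<Rightarrow> 'a \<Rightarrow> 'a" where
  "twisted_action G \<phi> =
     (\<lambda>g. \<lambda>x \<in> carrier G. g \<otimes>\<^bsub>G\<^esub> x \<otimes>\<^bsub>G\<^esub> \<phi> (inv\<^bsub>G\<^esub> g))"

lemma group_action_twisted_action:
  fixes G (structure)
  assumes G: "group G" and \<phi>: "\<phi> \<in> hom G G"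
  shows "group_action G (carrier G) (twisted_action G \<phi>)"
proof -
  interpret group G by fact
  interpret \<phi>: group_hom G G \<phi> using G \<phi> by (simp add: group_hom_def group_hom_axioms_def)
  let ?t = "twisted_action G \<phi>"
  have closed: "?t g x \<in> carrier G" if "g \<in> carrier G" "x \<in> carrier G" for g x
    using that by (simp add: twisted_action_def)
  have comp: "?t (g \<otimes> h) x = ?t g (?t h x)"
    if "g \<in> carrier G" "h \<in> carrier G" "x \<in> carrier G" for g h x
    using that by (simp add: twisted_action_def inv_mult_group m_assoc)
  have one: "?t \<one> x = x" if "x \<in> carrier G" for x
    using that by (simp add: twisted_action_def)
  have bij: "?t g \<in> Bij (carrier G)" if g: "g \<in> carrier G" for g
  proof -
    have "bij_betw (?t g) (carrier G) (carrier G)"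
      by (rule bij_betw_byWitness[where f' = "?t (inv g)"])
        (use g closed one comp[OF g inv_closed[OF g]] comp[OF inv_closed[OF g] g] in auto)
    then show ?thesis
      by (simp add: Bij_def twisted_action_def)
  qed
  show ?thesis
    unfolding group_action_def group_hom_def group_hom_axioms_def
  proof (intro conjI G group_BijGroup homI)
    fix g h assume gh: "g \<in> carrier G" "h \<in> carrier G"
    have "?t (g \<otimes> h) = compose (carrier G) (?t g) (?t h)"
      using gh comp by (auto simp: compose_def fun_eq_iff twisted_action_def)
    then show "?t (g \<otimes> h) = ?t g \<otimes>\<^bsub>BijGroup (carrier G)\<^esub> ?t h"
      using gh bij by (simp add: BijGroup_def)
  qed (simp add: BijGroup_def bij)
qed

definition twisted_conjugacy_classes ::
  "('a, 'b) monoid_scheme \<Rightarrow> ('a \<Rightarrow> 'a) \<Rightarrow> 'a set set" where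
  "twisted_conjugacy_classes G \<phi> = orbits G (carrier G) (twisted_action G \<phi>)"

text \<open>Infinite cardinalities are not distinguished from each other.\<close>

definition reidemeister_number ::
  "('a, 'b) monoid_scheme \<Rightarrow> ('a \<Rightarrow> 'a) \<Rightarrow> enat" where
  "reidemeister_number G \<phi> =
     (if finite (twisted_conjugacy_classes G \<phi>)
      then enat (card (twisted_conjugacy_classes G \<phi>)) else \<infinity>)"

lemma reidemeister_number_eq_infinity_iff:
  "reidemeister_number G \<phi> = \<infinity> \<longleftrightarrow> infinite (twisted_conjugacy_classes G \<phi>)"
  by (simp add: reidemeister_number_def)

definition R_infinity_property :: "('a, 'b) monoid_scheme \<Rightarrow> bool" where
  "R_infinity_property G \<longleftrightarrow> (\<forall>\<phi> \<in> iso G G. reidemeister_number G \<phi> = \<infinity>)"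

definition group_centre :: "('a, 'b) monoid_scheme \<Rightarrow> 'a set" where
  "group_centre G =
     {z \<in> carrier G. \<forall>g \<in> carrier G. z \<otimes>\<^bsub>G\<^esub> g = g \<otimes>\<^bsub>G\<^esub> z}"

lemma group_centre_normal:
  fixes G (structure)
  assumes "group G"
  shows "group_centre G \<lhd> G"
proof -
  interpret group G by fact
  have sub: "subgroup (group_centre G) G"
  proof (rule subgroupI)
    show "inv a \<in> group_centre G" if "a \<in> group_centre G" for a
    proof -
      have a: "a \<in> carrier G" "\<And>g. g \<in> carrier G \<Longrightarrow> a \<otimes> g = g \<otimes> a"
        using that by (auto simp: group_centre_def)
      have "inv a \<otimes> g = g \<otimes> inv a" if g: "g \<in> carrier G" for g
        by (metis a g inv_closed inv_inv inv_mult_group)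
      with a(1) show ?thesis by (simp add: group_centre_def)
    qed
    show "a \<otimes> b \<in> group_centre G" if "a \<in> group_centre G" "b \<in> group_centre G" for a b
      proof -
      have ab: "a \<in> carrier G" "b \<in> carrier G"
        "\<And>g. g \<in> carrier G \<Longrightarrow> a \<otimes> g = g \<otimes> a"
        "\<And>g. g \<in> carrier G \<Longrightarrow> b \<otimes> g = g \<otimes> b"
        using that by (auto simp: group_centre_def)
      have "(a \<otimes> b) \<otimes> g = g \<otimes> (a \<otimes> b)" if g: "g \<in> carrier G" for g
      proof -
        have "(a \<otimes> b) \<otimes> g = a \<otimes> (g \<otimes> b)" using ab(1,2) ab(4)[OF g] g by (simp add: m_assoc)
        also have "\<dots> = (g \<otimes> a) \<otimes> b" using ab(1,2) ab(3)[OF g, symmetric] g by (simp only: m_assoc)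
        finally show ?thesis using ab(1,2) g by (simp add: m_assoc)
      qed
      with ab(1,2) show ?thesis by (simp add: group_centre_def)
    qed
  qed (auto simp: group_centre_def)
  show ?thesis
  proof (rule normal_invI[OF sub])
    show "x \<otimes> h \<otimes> inv x \<in> group_centre G"
      if "x \<in> carrier G" "h \<in> group_centre G" for x h
    proof -
      have h: "h \<in> carrier G" and "x \<otimes> h = h \<otimes> x"
        using that by (auto simp: group_centre_def)
      then have "x \<otimes> h \<otimes> inv x = h"
        using that(1) by (simp only: m_assoc inv_closed r_inv r_one)
      with that(2) show ?thesis by simp
    qed
  qed
qed

definition GL_int :: "nat \<Rightarrow> int mat monoid" where
  "GL_int n = units_of (ring_mat TYPE(int) n ())"

definition SL_int :: "nat \<Rightarrow> int mat monoid" where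
  "SL_int n = (GL_int n)\<lparr>carrier := {A \<in> carrier (GL_int n). det A = 1}\<rparr>"

definition PGL_int :: "nat \<Rightarrow> int mat set monoid" where
  "PGL_int n = GL_int n Mod group_centre (GL_int n)"

definition PSL_int :: "nat \<Rightarrow> int mat set monoid" where
  "PSL_int n = SL_int n Mod group_centre (SL_int n)"

lemma group_GL_int: "group (GL_int n)"
proof -
  interpret ring "ring_mat TYPE(int) n ()" by (rule ring_mat)
  show ?thesis unfolding GL_int_def by (rule units_group)
qed

lemma carrier_GL_int:
  "carrier (GL_int n) =
     {A \<in> carrier_mat n n. \<exists>B \<in> carrier_mat n n. B * A = 1\<^sub>m n \<and> A * B = 1\<^sub>m n}"
  by (auto simp: GL_int_def units_of_def Units_def ring_mat_def)

lemma mult_GL_int [simp]: "A \<otimes>\<^bsub>GL_int n\<^esub> B = A * B"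
  by (simp add: GL_int_def units_of_def ring_mat_def)

lemma one_GL_int [simp]: "\<one>\<^bsub>GL_int n\<^esub> = 1\<^sub>m n"
  by (simp add: GL_int_def units_of_def ring_mat_def)

lemma subgroup_SL_GL_int: "subgroup {A \<in> carrier (GL_int n). det A = 1} (GL_int n)"
proof -
  interpret group "GL_int n" by (rule group_GL_int)
  have det_mult': "det (A * B) = det A * det B"
    if "A \<in> carrier (GL_int n)" "B \<in> carrier (GL_int n)" for A B
    using that det_mult by (auto simp: carrier_GL_int)
  show ?thesis
  proof (rule subgroupI)
    show "inv\<^bsub>GL_int n\<^esub> A \<in> {A \<in> carrier (GL_int n). det A = 1}"
      if "A \<in> {A \<in> carrier (GL_int n). det A = 1}" for A
    proof -
      have A: "A \<in> carrier (GL_int n)" "det A = 1" using that by auto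
      have "A * inv\<^bsub>GL_int n\<^esub> A = 1\<^sub>m n" using r_inv[OF A(1)] by simp
      then have "det A * det (inv\<^bsub>GL_int n\<^esub> A) = 1"
        using det_mult'[OF A(1) inv_closed[OF A(1)]] by simp
      with A show ?thesis by simp
    qed
    have "1\<^sub>m n \<in> {A \<in> carrier (GL_int n). det A = 1}" using one_closed by simp
    then show "{A \<in> carrier (GL_int n). det A = 1} \<noteq> {}" by blast
    show "A \<otimes>\<^bsub>GL_int n\<^esub> B \<in> {A \<in> carrier (GL_int n). det A = 1}"
      if "A \<in> {A \<in> carrier (GL_int n). det A = 1}"
         "B \<in> {A \<in> carrier (GL_int n). det A = 1}" for A B
      using that m_closed[of A B] by (simp add: det_mult')
  qed auto
qed

lemma group_SL_int: "group (SL_int n)"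
  unfolding SL_int_def by (rule subgroup.subgroup_is_group[OF subgroup_SL_GL_int group_GL_int])

lemma group_PGL_int: "group (PGL_int n)"
  unfolding PGL_int_def
  by (rule normal.factorgroup_is_group[OF group_centre_normal[OF group_GL_int]])

lemma group_PSL_int: "group (PSL_int n)"
  unfolding PSL_int_def
  by (rule normal.factorgroup_is_group[OF group_centre_normal[OF group_SL_int]])

end

theory Submission
  imports Defs "HOL-Library.Function_Algebras"
begin

text \<open>
  For a finitely generated residually finite group, an automorphism \<open>\<phi>\<close> has infinitely many twisted
  conjugacy classes as soon as some \<open>\<iota>\<^sub>g \<circ> \<phi>\<close> fixes an element of infinite order: in a finite
  characteristic quotient the class of \<open>1\<close> has the index of a stabiliser, which grows with the
  order of that element, whereas finitely many closed classes would have to be open. Since infinitude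
  lifts along the quotient by the centre, it remains to find such an element for every automorphism of
  \<open>PSL(n, \<int>)\<close> and \<open>PGL(n, \<int>)\<close>.

  For \<open>n \<ge> 3\<close> no classification of the automorphisms is needed. Every elementary matrix is a central
  commutator, so its image is quasi-unipotent. Suitable powers of the images of the upper
  unitriangular matrices are thus unipotent and generate a nilpotent group, which some element of
  \<open>SL(n, \<int>)\<close> conjugates into the unitriangular group. There the corner elementary matrix, an
  \<open>(n - 1)\<close>-fold commutator, can only go to a corner elementary matrix. Its cyclic group is the centre of
  its centraliser, so up to conjugation \<open>\<phi>\<close> maps the generator to itself or to its inverse, and a
  diagonal matrix repairs the sign.

  For \<open>n = 2\<close> an element of order 3 can be normalised by reduction theory. In \<open>PGL(2, \<int>)\<close> centralisers
  of finite subgroups then leave two possibilities for \<open>\<phi>\<close>. In \<open>PSL(2, \<int>)\<close> the images of the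
  generators of order 2 and 3 are determined by the trace of their product, which must be \<open>\<plusminus>2\<close>.
\<close>

section \<open>Reidemeister numbers of finitely generated residually finite groups\<close>

text \<open>Working modulo the centre has a price: a homomorphism of the quotient lifts to matrices
  only up to sign. The exponents in the lifted relations are therefore even, because squaring
  removes a central involution. In the other direction nothing is lost: a transvection never
  anticommutes with an invertible matrix, so its centraliser can be computed with matrices.
  Dimension two is separate for two reasons. Writing the elementary matrix at (i, j) as a commutator
  with which both factors commute takes an index different from i and j; and the determinant 1
  matrix that negates the corner entry is diag(-1, -1, 1, ..., 1), which is central for n = 2. In
  dimension two the normalising conjugation is found only in GL(2, \<int>). For PSL(2, \<int>) a
  conjugator of determinant -1 is repaired by replacing the parabolic element with a hyperbolic one
  that commutes with a matrix of determinant -1. For PGL(2, \<int>) one of the two possibilities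
  interchanges two elements x and x'; then x x' goes to its conjugate x' x.\<close>

lemma decreasing_sets_stabilise:
  fixes f :: "nat \<Rightarrow> 'a set"
  assumes "finite (f 0)" and dec: "\<And>m m'. m \<le> m' \<Longrightarrow> f m' \<subseteq> f m"
  shows "\<exists>m0. \<forall>m\<ge>m0. f m = f m0"
proof -
  obtain m0 where m0: "\<And>m. card (f m0) \<le> card (f m)"
    using ex_has_least_nat[of "\<lambda>_. True" 0 "\<lambda>m. card (f m)"] by auto
  have "f m = f m0" if "m \<ge> m0" for m
    using card_seteq[of "f m0" "f m"] dec[OF that] m0 finite_subset[OF dec[of 0 m0] assms(1)] by auto
  then show ?thesis by blast
qed

text \<open>Orbits of points of the carrier do not see the restriction in
  \<open>twisted_action\<close>, so classes can be handled as plain images.\<close>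

lemma twisted_conjugacy_classes_alt:
  fixes G (structure)
  assumes "group G" "\<phi> \<in> hom G G"
  shows "twisted_conjugacy_classes G \<phi> =
    (\<lambda>x. (\<lambda>g. g \<otimes> x \<otimes> \<phi> (inv g)) ` carrier G) ` carrier G"
  by (force simp: twisted_conjugacy_classes_def orbits_def orbit_def twisted_action_def image_def)

text \<open>Serves to count homomorphisms out of a finitely generated group: each is determined by
  finitely many values.\<close>

lemma (in group) hom_eq_on_generate:
  assumes "group H" "\<alpha> \<in> hom G H" "\<beta> \<in> hom G H" "S \<subseteq> carrier G"
    and eq: "\<And>x. x \<in> S \<Longrightarrow> \<alpha> x = \<beta> x" and "x \<in> generate G S"
  shows "\<alpha> x = \<beta> x"
proof -
  interpret a: group_hom G H \<alpha> using assms by (simp add: group_hom_def group_hom_axioms_def is_group)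
  interpret b: group_hom G H \<beta> using assms by (simp add: group_hom_def group_hom_axioms_def is_group)
  show ?thesis using assms(6)
  proof (induction rule: generate.induct)
    case (inv h) then show ?case using assms(4) eq by (metis a.hom_inv b.hom_inv subsetD)
  next
    case (eng h1 h2)
    then show ?case using generate_in_carrier[OF assms(4)] by simp
  qed (auto simp: eq)
qed

text \<open>In a finite \<open>\<psi>\<close>-invariant quotient \<open>G/K\<close> the twisted class of \<open>1\<close> has index \<open>|Stab(1)|\<close>, and the
  stabiliser contains the image of \<open>e\<close>. If there are only finitely many classes, the preimage
  of that class is eventually constant along a chain of such \<open>K\<close>'s, so the index stays bounded while
  the order of \<open>e\<close> grows.\<close>

lemma infinite_classes_of_fixed_element:
  fixes G (structure) and H :: "nat \<Rightarrow> 'c monoid"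
  assumes G: "group G" and \<psi>: "\<psi> \<in> hom G G"
    and S: "finite S" "S \<subseteq> carrier G" "carrier G = generate G S"
    and H: "\<And>k. k > 0 \<Longrightarrow> group (H k)" "\<And>k. k > 0 \<Longrightarrow> finite (carrier (H k))"
    and \<alpha>: "\<And>k. k > 0 \<Longrightarrow> \<alpha> k \<in> hom G (H k)"
    and e: "e \<in> carrier G" "\<psi> e = e" 
    and \<alpha>e: "\<And>k. k > 0 \<Longrightarrow> \<alpha> k (e [^] (k::nat)) \<noteq> \<one>\<^bsub>H k\<^esub>"
  shows "infinite (twisted_conjugacy_classes G \<psi>)"
proof
  assume fin: "finite (twisted_conjugacy_classes G \<psi>)"
  interpret group G by fact
  interpret \<psi>: group_hom G G \<psi> using \<psi> by (simp add: group_hom_def group_hom_axioms_def is_group)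
  \<comment> \<open>All homomorphisms into \<open>H k\<close> are used, not only
    \<open>\<alpha> k\<close>. Precomposition with \<open>\<psi>\<close> maps this family into
    itself, which makes \<open>K m\<close> invariant under \<open>\<psi>\<close>.\<close>
  define K where "K m = {x \<in> carrier G. \<forall>k\<in>{1..m}. \<forall>\<beta>\<in>hom G (H k). \<beta> x = \<one>\<^bsub>H k\<^esub>}" for m
  have Ksub: "K m \<subseteq> carrier G" for m by (auto simp: K_def)
  have Kmono: "K m' \<subseteq> K m" if "m \<le> m'" for m m' using that by (auto simp: K_def)
  have Knorm: "K m \<lhd> G" for m
  proof (rule normal_invI)
    show "subgroup (K m) G"
    proof (rule subgroupI)
      show "K m \<noteq> {}"
        using H(1) by (auto simp: K_def intro!: exI[of _ \<one>] hom_one[OF _ is_group])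
      fix a b assume a: "a \<in> K m" and b: "b \<in> K m"
      have *: "\<beta> (a \<otimes> b) = \<one>\<^bsub>H k\<^esub> \<and> \<beta> (inv a) = \<one>\<^bsub>H k\<^esub>" if k: "k \<in> {1..m}" and \<beta>: "\<beta> \<in> hom G (H k)" for k \<beta>
      proof -
        interpret b: group_hom G "H k" \<beta>
          using k \<beta> H(1) by (simp add: group_hom_def group_hom_axioms_def is_group)
        have "a \<in> carrier G" "b \<in> carrier G" using a b by (auto simp: K_def)
        moreover have "\<beta> a = \<one>\<^bsub>H k\<^esub>" using a k \<beta> by (auto simp: K_def)
        moreover have "\<beta> b = \<one>\<^bsub>H k\<^esub>" using b k \<beta> by (auto simp: K_def)
        ultimately show ?thesis by simp
      qed
      have ab: "a \<in> carrier G" "b \<in> carrier G" using a b Ksub by auto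
      show "a \<otimes> b \<in> K m" "inv a \<in> K m"
        unfolding K_def using * m_closed[OF ab] inv_closed[OF ab(1)] by blast+
    qed (rule Ksub)
    fix x h assume x: "x \<in> carrier G" and h: "h \<in> K m"
    show "x \<otimes> h \<otimes> inv x \<in> K m"
    proof -
      have "\<beta> (x \<otimes> h \<otimes> inv x) = \<one>\<^bsub>H k\<^esub>" if k: "k \<in> {1..m}" and b: "\<beta> \<in> hom G (H k)" for k \<beta>
      proof -
        interpret b: group_hom G "H k" \<beta>
          using k b H(1) by (simp add: group_hom_def group_hom_axioms_def is_group)
        have "\<beta> h = \<one>\<^bsub>H k\<^esub>" "h \<in> carrier G" using h k b by (auto simp: K_def)
        then show ?thesis using x by simp
      qed
      then show ?thesis using x h by (auto simp: K_def)
    qed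
  qed
  have K\<psi>: "\<psi> x \<in> K m" if "x \<in> K m" for x m
  proof -
    have "\<beta> (\<psi> x) = \<one>\<^bsub>H k\<^esub>" if "k \<in> {1..m}" "\<beta> \<in> hom G (H k)" for k \<beta>
    proof -
      have "\<beta> \<circ> \<psi> \<in> hom G (H k)" using \<psi> that(2) by (auto simp: hom_def)
      then show ?thesis using \<open>x \<in> K m\<close> that(1) by (auto simp: K_def)
    qed
    then show ?thesis using that by (auto simp: K_def)
  qed
  have eK: "e [^] k \<notin> K m" if "k \<in> {1..m}" for k m
    using \<alpha>[of k] \<alpha>e[of k] that by (auto simp: K_def)
  have finQ: "finite (rcosets (K m))" for m
  proof -
    interpret K: normal "K m" G by (rule Knorm)
    \<comment> \<open>A homomorphism is coded by its restriction to the finite set \<open>S\<close>,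
      so \<open>I\<close> is finite. \<open>\<Phi> x\<close> collects the values at x of one
      homomorphism per code, and equal collections mean equal cosets of \<open>K m\<close>.\<close>
    define I where "I = Sigma {1..m} (\<lambda>k. (\<lambda>\<beta>. restrict \<beta> S) ` hom G (H k))"
    define hm where "hm = (\<lambda>(k,r). SOME \<beta>. \<beta> \<in> hom G (H k) \<and> restrict \<beta> S = r)"
    have hm: "hm (k, restrict \<beta> S) \<in> hom G (H k) \<and> (\<forall>x\<in>carrier G. hm (k, restrict \<beta> S) x = \<beta> x)"
      if "k \<in> {1..m}" "\<beta> \<in> hom G (H k)" for k \<beta>
    proof -
      have *: "hm (k, restrict \<beta> S) \<in> hom G (H k) \<and> restrict (hm (k, restrict \<beta> S)) S = restrict \<beta> S"
        unfolding hm_def split_conv by (rule someI[of _ \<beta>]) (use that in auto)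
      have "hm (k, restrict \<beta> S) x = \<beta> x" if "x \<in> S" for x
        using * that by (metis restrict_apply')
      then show ?thesis using * that hom_eq_on_generate[of "H k" "hm (k, restrict \<beta> S)" \<beta> S] H(1) S by auto
    qed
    have finI: "finite I" unfolding I_def
    proof (rule finite_SigmaI)
      fix k assume "k \<in> {1..m}"
      then have "finite (S \<rightarrow>\<^sub>E carrier (H k))" using H(2) S(1) by (auto intro: finite_PiE)
      moreover have "(\<lambda>\<beta>. restrict \<beta> S) ` hom G (H k) \<subseteq> S \<rightarrow>\<^sub>E carrier (H k)"
        using S(2) by (auto simp: hom_def)
      ultimately show "finite ((\<lambda>\<beta>. restrict \<beta> S) ` hom G (H k))" by (rule finite_subset[rotated])
    qed simp
    define \<Phi> where "\<Phi> x = (\<lambda>i\<in>I. hm i x)" for x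
    have "\<Phi> ` carrier G \<subseteq> (\<Pi>\<^sub>E i\<in>I. carrier (H (fst i)))"
    proof
      fix y assume "y \<in> \<Phi> ` carrier G"
      then obtain x where x: "x \<in> carrier G" "y = \<Phi> x" by blast
      have "hm i x \<in> carrier (H (fst i))" if "i \<in> I" for i
      proof -
        from that obtain k \<beta> where "i = (k, restrict \<beta> S)" "k \<in> {1..m}" "\<beta> \<in> hom G (H k)"
          by (auto simp: I_def)
        then show ?thesis using hm[of k \<beta>] x by (auto intro: hom_in_carrier)
      qed
      then show "y \<in> (\<Pi>\<^sub>E i\<in>I. carrier (H (fst i)))" by (auto simp: \<Phi>_def x(2))
    qed
    moreover have "finite (\<Pi>\<^sub>E i\<in>I. carrier (H (fst i)))"
      using finI H(2) by (intro finite_PiE) (auto simp: I_def)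
    ultimately have fin\<Phi>: "finite (\<Phi> ` carrier G)" by (rule finite_subset)
    have eq: "K m #> x = K m #> y" if xy: "x \<in> carrier G" "y \<in> carrier G" and "\<Phi> x = \<Phi> y" for x y
    proof -
      have "\<beta> (x \<otimes> inv y) = \<one>\<^bsub>H k\<^esub>" if k: "k \<in> {1..m}" "\<beta> \<in> hom G (H k)" for k \<beta>
      proof -
        interpret b: group_hom G "H k" \<beta>
          using k H(1) by (simp add: group_hom_def group_hom_axioms_def is_group)
        have "(k, restrict \<beta> S) \<in> I" using k by (auto simp: I_def)
        then have "hm (k, restrict \<beta> S) x = hm (k, restrict \<beta> S) y"
          using fun_cong[OF \<open>\<Phi> x = \<Phi> y\<close>, of "(k, restrict \<beta> S)"] by (simp add: \<Phi>_def)
        then have "\<beta> x = \<beta> y" using hm[OF k] xy by auto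
        then show ?thesis using xy by simp
      qed
      moreover have "x \<otimes> inv y \<in> carrier G" using xy by simp
      ultimately have "x \<otimes> inv y \<in> K m" unfolding K_def by blast
      moreover have "x = (x \<otimes> inv y) \<otimes> y" using xy by (simp add: m_assoc)
      ultimately have "x \<in> K m #> y" unfolding r_coset_def by blast
      then show ?thesis using repr_independence[OF _ xy(2) K.is_subgroup] by simp
    qed
    have "rcosets (K m) = (\<lambda>c. K m #> (SOME x. x \<in> carrier G \<and> \<Phi> x = c)) ` \<Phi> ` carrier G"
    proof -
      have "K m #> (SOME x'. x' \<in> carrier G \<and> \<Phi> x' = \<Phi> x) = K m #> x" if "x \<in> carrier G" for x
      proof -
        have "(SOME x'. x' \<in> carrier G \<and> \<Phi> x' = \<Phi> x) \<in> carrier G \<and>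
          \<Phi> (SOME x'. x' \<in> carrier G \<and> \<Phi> x' = \<Phi> x) = \<Phi> x"
          by (rule someI[of _ x]) (use that in auto)
        then show ?thesis using eq[OF _ that] by blast
      qed
      moreover have "rcosets (K m) = (\<lambda>x. K m #> x) ` carrier G" by (auto simp: RCOSETS_def)
      ultimately show ?thesis unfolding image_image by (metis (no_types, lifting) image_cong)
    qed
    then show ?thesis using fin\<Phi> by auto
  qed
  \<comment> \<open>The preimage in G of the twisted class of 1 in G/K(m). It is a union of twisted
    classes of \<open>\<psi>\<close> and shrinks as m grows.\<close>
  define T where "T m = {k \<otimes> (h \<otimes> \<psi> (inv h)) | k h. k \<in> K m \<and> h \<in> carrier G}" for m
  let ?cl = "\<lambda>x. (\<lambda>g. g \<otimes> x \<otimes> \<psi> (inv g)) ` carrier G"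
  have Tcl: "?cl x \<subseteq> T m" if xT: "x \<in> T m" for x m
  proof
    fix y assume "y \<in> ?cl x"
    then obtain g where g: "g \<in> carrier G" "y = g \<otimes> x \<otimes> \<psi> (inv g)" by auto
    obtain k h where kh: "k \<in> K m" "h \<in> carrier G" "x = k \<otimes> (h \<otimes> \<psi> (inv h))"
      using xT unfolding T_def by blast
    have kc: "k \<in> carrier G" using kh Ksub by auto
    have "inv g \<otimes> (g \<otimes> z) = z" if "z \<in> carrier G" for z
      using g that by (simp add: m_assoc[symmetric])
    then have "y = (g \<otimes> k \<otimes> inv g) \<otimes> ((g \<otimes> h) \<otimes> \<psi> (inv (g \<otimes> h)))"
      using g kh kc by (simp add: inv_mult_group m_assoc)
    moreover have "g \<otimes> k \<otimes> inv g \<in> K m" using Knorm[of m] g kh by (simp add: normal.inv_op_closed2)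
    ultimately show "y \<in> T m" using g kh unfolding T_def by blast
  qed
  define f where "f m = {c \<in> twisted_conjugacy_classes G \<psi>. c \<subseteq> T m}" for m
  have "\<exists>m0. \<forall>m\<ge>m0. f m = f m0"
  proof (rule decreasing_sets_stabilise)
    show "finite (f 0)" using fin by (simp add: f_def)
    fix m m' :: nat assume "m \<le> m'"
    then have "T m' \<subseteq> T m" using Kmono unfolding T_def by blast
    then show "f m' \<subseteq> f m" by (auto simp: f_def)
  qed
  then obtain m0 where m0: "\<And>m. m \<ge> m0 \<Longrightarrow> f m = f m0" by blast
  \<comment> \<open>Here the finiteness of the number of classes acts: the class of an element of
    \<open>K m0\<close> lies in \<open>T m0\<close>, so it is one of the stable ones and lies in
    every later \<open>T m\<close>.\<close>
  have KT: "K m0 \<subseteq> T m" if "m \<ge> m0" for m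
  proof
    fix x assume x: "x \<in> K m0"
    have xG: "x \<in> carrier G" using x Ksub by auto
    have "x = x \<otimes> (\<one> \<otimes> \<psi> (inv \<one>))" using xG by simp
    then have "x \<in> T m0" unfolding T_def using x one_closed by blast
    then have "?cl x \<in> f m0"
      using Tcl xG by (auto simp: f_def twisted_conjugacy_classes_alt[OF G \<psi>])
    then have "?cl x \<in> f m" using m0[OF that] by simp
    then have "?cl x \<subseteq> T m" unfolding f_def mem_Collect_eq by (rule conjunct2)
    moreover have "x = \<one> \<otimes> x \<otimes> \<psi> (inv \<one>)" using xG by simp
    ultimately show "x \<in> T m" using one_closed by blast
  qed
  define r where "r = card (rcosets (K m0))"
  \<comment> \<open>The stabiliser of 1 will have at least m and at most r elements, so any m above
    r gives the contradiction.\<close>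
  define m where "m = max m0 (Suc r)"
  interpret K: normal "K m" G by (rule Knorm)
  interpret K0: normal "K m0" G by (rule Knorm)
  define Q where "Q = G Mod K m"
  have Q: "group Q" unfolding Q_def by (rule K.factorgroup_is_group)
  interpret Q: group Q by (rule Q)
  have carrQ: "carrier Q = (\<lambda>x. K m #> x) ` carrier G" by (auto simp: Q_def FactGroup_def RCOSETS_def)
  have multQ: "(K m #> x) \<otimes>\<^bsub>Q\<^esub> (K m #> y) = K m #> (x \<otimes> y)" if "x \<in> carrier G" "y \<in> carrier G" for x y
    using that by (simp add: Q_def FactGroup_def K.rcos_sum)
  have oneQ: "\<one>\<^bsub>Q\<^esub> = K m" by (simp add: Q_def FactGroup_def)
  \<comment> \<open>The map induced on the quotient through an arbitrary representative; invariance
    of \<open>K m\<close> makes it independent of the choice.\<close>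
  define \<chi> where "\<chi> Z = K m #> \<psi> (SOME x. x \<in> carrier G \<and> Z = K m #> x)" for Z
  have \<chi>: "\<chi> (K m #> x) = K m #> \<psi> x" if x: "x \<in> carrier G" for x
  proof -
    define y where "y = (SOME y. y \<in> carrier G \<and> K m #> x = K m #> y)"
    have y: "y \<in> carrier G \<and> K m #> x = K m #> y"
      unfolding y_def by (rule someI[of _ x]) (use x in auto)
    then have "y \<in> K m #> x" using rcos_self[OF _ K.is_subgroup] by auto
    then obtain k where k: "k \<in> K m" "y = k \<otimes> x" by (auto simp: r_coset_def)
    then have "\<psi> y = \<psi> k \<otimes> \<psi> x" using x by auto
    then have "\<psi> y \<in> K m #> \<psi> x" using K\<psi>[OF k(1)] by (auto simp: r_coset_def)
    then show ?thesis
      using repr_independence[OF _ _ K.is_subgroup] x unfolding \<chi>_def y_def by auto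
  qed
  have \<chi>hom: "\<chi> \<in> hom Q Q"
    by (rule homI) (auto simp: carrQ \<chi> multQ)
  interpret act: group_action Q "carrier Q" "twisted_action Q \<chi>"
    by (rule group_action_twisted_action[OF Q \<chi>hom])
  have invQ: "inv\<^bsub>Q\<^esub> (K m #> x) = K m #> inv x" if "x \<in> carrier G" for x
    by (rule Q.inv_equality) (use that in \<open>auto simp: multQ oneQ carrQ coset_mult_one Ksub\<close>)
  have act: "twisted_action Q \<chi> (K m #> g) (K m #> x) = K m #> (g \<otimes> x \<otimes> \<psi> (inv g))"
    if "g \<in> carrier G" "x \<in> carrier G" for g x
    using that by (simp add: twisted_action_def carrQ \<chi> multQ invQ)
  have Kone: "K m = K m #> \<one>" using Ksub coset_mult_one by simp
  have finQ': "finite (carrier Q)" using finQ by (simp add: Q_def FactGroup_def)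
  let ?O = "orbit Q (twisted_action Q \<chi>) \<one>\<^bsub>Q\<^esub>" and ?St = "stabilizer Q (twisted_action Q \<chi>) \<one>\<^bsub>Q\<^esub>"
  have Osub: "?O \<subseteq> carrier Q" using act.element_image by (auto simp: orbit_def)
  have O: "K m #> x \<in> ?O" if "x \<in> K m0" for x
  proof -
    have "x \<in> T m" using KT[of m] that by (auto simp: m_def)
    then obtain k h where kh: "k \<in> K m" "h \<in> carrier G" "x = k \<otimes> (h \<otimes> \<psi> (inv h))" unfolding T_def by blast
    then have "x \<in> K m #> (h \<otimes> \<psi> (inv h))" by (auto simp: r_coset_def)
    then have "K m #> x = K m #> (h \<otimes> \<psi> (inv h))"
      using repr_independence[OF _ _ K.is_subgroup] kh by auto
    also have "\<dots> = twisted_action Q \<chi> (K m #> h) \<one>\<^bsub>Q\<^esub>"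
      using act[of h \<one>] kh by (simp add: oneQ Kone[symmetric])
    finally show ?thesis using kh by (auto simp: orbit_def carrQ)
  qed
  \<comment> \<open>A power of e is fixed by \<open>\<psi>\<close>, so it moves 1 to itself under
    the twisted action. The powers with exponents in \<open>{1..m}\<close> are distinct in
    \<open>Q\<close>, since the differences of exponents stay in the range where \<open>eK\<close>
    applies.\<close>
  have St: "(\<lambda>k. K m #> (e [^] k)) ` {1..m} \<subseteq> ?St"
  proof -
    have "twisted_action Q \<chi> (K m #> (e [^] k)) \<one>\<^bsub>Q\<^esub> = \<one>\<^bsub>Q\<^esub>" for k :: nat
    proof -
      have "\<psi> (e [^] k) = e [^] k" using e by (simp add: \<psi>.hom_nat_pow)
      then show ?thesis using act[of "e [^] k" \<one>] e by (simp add: oneQ Kone[symmetric])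
    qed
    then show ?thesis using e by (auto simp: stabilizer_def carrQ)
  qed
  have inj: "inj_on (\<lambda>k. K m #> (e [^] k)) {1..m}"
  proof (rule linorder_inj_onI)
    fix i j assume ij: "i < j" "i \<in> {1..m}" "j \<in> {1..m}"
    show "K m #> (e [^] i) \<noteq> K m #> (e [^] j)"
    proof
      assume "K m #> (e [^] i) = K m #> (e [^] j)"
      then have "e [^] j \<in> K m #> (e [^] i)" using rcos_self[OF _ K.is_subgroup] e by auto
      then obtain k where k: "k \<in> K m" "e [^] j = k \<otimes> e [^] i" by (auto simp: r_coset_def)
      have kG: "k \<in> carrier G" using k Ksub by auto
      have "e [^] j = e [^] (j - i) \<otimes> e [^] i" using ij e by (simp add: nat_pow_mult)
      then have "k \<otimes> e [^] i = e [^] (j - i) \<otimes> e [^] i" using k by simp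
      then have "k = e [^] (j - i)" by (rule r_cancel[OF _ kG nat_pow_closed[OF e(1)] nat_pow_closed[OF e(1)]])
      moreover have "j - i \<in> {1..m}" using ij by auto
      ultimately show False using eK[of "j - i" m] k by auto
    qed
  qed auto
  have finSt: "finite ?St" using finQ' by (simp add: stabilizer_def)
  have "m \<le> card ?St" using card_mono[OF finSt St] card_image[OF inj] by simp
  moreover have "card ?O * card ?St = card (carrier Q)"
    using act.orbit_stabilizer_theorem[OF Q.one_closed] by (simp add: Coset.order_def mult.commute)
  moreover have "card (carrier Q) \<le> card ?O * r"
  proof -
    \<comment> \<open>The orbit of 1 contains the image of \<open>K m0\<close>, so multiplying it by
      r coset representatives covers \<open>Q\<close>. Orbit-stabiliser then bounds the stabiliser
      by r.\<close>
    have "carrier Q \<subseteq> (\<lambda>(Z, Y). Z \<otimes>\<^bsub>Q\<^esub> (K m #> (SOME y. y \<in> Y))) ` (?O \<times> rcosets (K m0))"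
    proof
      fix Z assume "Z \<in> carrier Q"
      then obtain x where x: "x \<in> carrier G" "Z = K m #> x" by (auto simp: carrQ)
      define Y where "Y = K m0 #> x"
      define y where "y = (SOME y. y \<in> Y)"
      have "y \<in> Y" unfolding y_def by (rule someI[of _ x]) (use x rcos_self[OF _ K0.is_subgroup] in \<open>auto simp: Y_def\<close>)
      then obtain k where k: "k \<in> K m0" "y = k \<otimes> x" by (auto simp: Y_def r_coset_def)
      have kG: "k \<in> carrier G" using k Ksub by auto
      have "Z = (K m #> inv k) \<otimes>\<^bsub>Q\<^esub> (K m #> y)" using k kG x by (simp add: multQ m_assoc[symmetric])
      moreover have "K m #> inv k \<in> ?O" using O[of "inv k"] k K0.m_inv_closed by auto
      moreover have "Y \<in> rcosets (K m0)" using x by (auto simp: Y_def RCOSETS_def)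
      ultimately show "Z \<in> (\<lambda>(Z, Y). Z \<otimes>\<^bsub>Q\<^esub> (K m #> (SOME y. y \<in> Y))) ` (?O \<times> rcosets (K m0))"
        unfolding y_def by (intro image_eqI[of _ _ "(K m #> inv k, Y)"]) (auto simp: y_def)
    qed
    moreover have "finite (?O \<times> rcosets (K m0))" using finQ finite_subset[OF Osub finQ'] by auto
    ultimately have "card (carrier Q) \<le> card (?O \<times> rcosets (K m0))" by (rule surj_card_le[rotated])
    then show ?thesis by (simp add: r_def card_cartesian_product)
  qed
  moreover have "card ?O > 0"
    using finite_subset[OF Osub finQ'] act.orbit_refl[OF Q.one_closed] by (auto simp: card_gt_0_iff)
  ultimately have "card ?O * m \<le> card ?O * r" "card ?O > 0"
    using mult_le_mono2[of m "card ?St" "card ?O"] by linarith+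
  then have "m \<le> r" by simp
  then show False by (simp add: m_def)
qed

text \<open>For \<psi> = \<iota>_g \<circ> \<phi> one has h x \<psi>(h^-1) = (h (x g) \<phi>(h^-1))
  g^-1, so right translation by g^-1 carries the \<phi>-classes to the \<psi>-classes. It is thus
  enough that e is fixed up to conjugation.\<close>

lemma infinite_classes_criterion:
  fixes G (structure)
  assumes G: "group G" and \<phi>: "\<phi> \<in> hom G G"
    and S: "finite S" "S \<subseteq> carrier G" "carrier G = generate G S"
    and RF: "\<And>x. x \<in> carrier G \<Longrightarrow> x \<noteq> \<one> \<Longrightarrow>
      \<exists>(H :: 'c monoid) \<alpha>. group H \<and> finite (carrier H) \<and> \<alpha> \<in> hom G H \<and> \<alpha> x \<noteq> \<one>\<^bsub>H\<^esub>"
    and g: "g \<in> carrier G" and e: "e \<in> carrier G" "g \<otimes> \<phi> e \<otimes> inv g = e"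
    and ord: "\<And>k::nat. k > 0 \<Longrightarrow> e [^] k \<noteq> \<one>"
  shows "infinite (twisted_conjugacy_classes G \<phi>)"
proof
  interpret group G by fact
  interpret \<phi>: group_hom G G \<phi> using \<phi> by (simp add: group_hom_def group_hom_axioms_def is_group)
  define \<psi> where "\<psi> x = g \<otimes> \<phi> x \<otimes> inv g" for x
  have canc: "inv g \<otimes> (g \<otimes> z) = z" if "z \<in> carrier G" for z
    using g that by (simp add: m_assoc[symmetric])
  have \<psi>: "\<psi> \<in> hom G G"
    using g by (intro homI) (auto simp: \<psi>_def m_assoc canc)
  \<comment> \<open>Residual finiteness, applied to each positive power of e separately, supplies
    the family of finite groups.\<close>
  have "\<exists>H \<alpha>. \<forall>k::nat>0. group (H k :: 'c monoid) \<and> finite (carrier (H k)) \<and> \<alpha> k \<in> hom G (H k) \<and>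
      \<alpha> k (e [^] k) \<noteq> \<one>\<^bsub>H k\<^esub>"
    using RF[OF nat_pow_closed[OF e(1)] ord] by metis
  then obtain H :: "nat \<Rightarrow> 'c monoid" and \<alpha> where "\<And>k. k > 0 \<Longrightarrow> group (H k)" "\<And>k. k > 0 \<Longrightarrow> finite (carrier (H k))"
    "\<And>k. k > 0 \<Longrightarrow> \<alpha> k \<in> hom G (H k)" "\<And>k. k > 0 \<Longrightarrow> \<alpha> k (e [^] k) \<noteq> \<one>\<^bsub>H k\<^esub>"
    by blast
  moreover have "\<psi> e = e" using e by (simp add: \<psi>_def)
  ultimately have inf: "infinite (twisted_conjugacy_classes G \<psi>)"
    using infinite_classes_of_fixed_element[OF G \<psi> S, of H \<alpha> e] e(1) by blast
  assume fin: "finite (twisted_conjugacy_classes G \<phi>)"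
  have "twisted_conjugacy_classes G \<psi> \<subseteq> (\<lambda>C. (\<lambda>x. x \<otimes> inv g) ` C) ` twisted_conjugacy_classes G \<phi>"
  proof
    fix C assume "C \<in> twisted_conjugacy_classes G \<psi>"
    then obtain x where x: "x \<in> carrier G" "C = (\<lambda>h. h \<otimes> x \<otimes> \<psi> (inv h)) ` carrier G"
      by (auto simp: twisted_conjugacy_classes_alt[OF G \<psi>])
    have "C = (\<lambda>x. x \<otimes> inv g) ` (\<lambda>h. h \<otimes> (x \<otimes> g) \<otimes> \<phi> (inv h)) ` carrier G"
      unfolding x(2) image_image using x(1) g by (intro image_cong refl) (simp add: \<psi>_def m_assoc)
    moreover have "(\<lambda>h. h \<otimes> (x \<otimes> g) \<otimes> \<phi> (inv h)) ` carrier G \<in> twisted_conjugacy_classes G \<phi>"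
      unfolding twisted_conjugacy_classes_alt[OF G \<phi>] using x(1) g by (intro imageI) simp
    ultimately show "C \<in> (\<lambda>C. (\<lambda>x. x \<otimes> inv g) ` C) ` twisted_conjugacy_classes G \<phi>" by blast
  qed
  then show False using inf fin by (meson finite_imageI finite_subset)
qed

text \<open>The centre is characteristic, so an automorphism induces one on the quotient, whose
  twisted classes are images of twisted classes upstairs.\<close>

lemma R_infinity_property_if_central_quotient:
  fixes G (structure)
  assumes G: "group G" and R: "R_infinity_property (G Mod group_centre G)"
  shows "R_infinity_property G"
  unfolding R_infinity_property_def reidemeister_number_eq_infinity_iff
proof (intro ballI notI)
  fix \<phi> assume \<phi>: "\<phi> \<in> iso G G" and fin: "finite (twisted_conjugacy_classes G \<phi>)"
  interpret group G by fact
  have \<phi>hom: "\<phi> \<in> hom G G" and bij: "bij_betw \<phi> (carrier G) (carrier G)"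
    using \<phi> by (auto simp: iso_def)
  interpret \<phi>: group_hom G G \<phi> using \<phi>hom by (simp add: group_hom_def group_hom_axioms_def is_group)
  define C where "C = group_centre G"
  interpret C: normal C G unfolding C_def by (rule group_centre_normal[OF G])
  define Q where "Q = G Mod C"
  have Q: "group Q" unfolding Q_def by (rule C.factorgroup_is_group)
  interpret Q: group Q by (rule Q)
  have carrQ: "carrier Q = (\<lambda>x. C #> x) ` carrier G" by (auto simp: Q_def FactGroup_def RCOSETS_def)
  have multQ: "(C #> x) \<otimes>\<^bsub>Q\<^esub> (C #> y) = C #> (x \<otimes> y)" if "x \<in> carrier G" "y \<in> carrier G" for x y
    using that by (simp add: Q_def FactGroup_def C.rcos_sum)
  have oneQ: "\<one>\<^bsub>Q\<^esub> = C" by (simp add: Q_def FactGroup_def)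
  have surj: "\<phi> ` carrier G = carrier G" and inj: "inj_on \<phi> (carrier G)"
    using bij by (auto simp: bij_betw_def)
  have \<phi>C: "\<phi> z \<in> C \<longleftrightarrow> z \<in> C" if z: "z \<in> carrier G" for z
  proof -
    have "(\<forall>g\<in>carrier G. \<phi> z \<otimes> g = g \<otimes> \<phi> z) \<longleftrightarrow> (\<forall>g\<in>\<phi> ` carrier G. \<phi> z \<otimes> g = g \<otimes> \<phi> z)"
      by (simp only: surj)
    also have "\<dots> \<longleftrightarrow> (\<forall>g\<in>carrier G. \<phi> (z \<otimes> g) = \<phi> (g \<otimes> z))" using z by simp
    also have "\<dots> \<longleftrightarrow> (\<forall>g\<in>carrier G. z \<otimes> g = g \<otimes> z)"
      using inj_on_eq_iff[OF inj] z by (intro ball_cong refl) (metis m_closed)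
    finally show ?thesis using z unfolding C_def group_centre_def by simp
  qed
  have Csub: "C \<subseteq> carrier G" by (rule C.subset)
  have \<phi>Cim: "\<phi> ` C = C"
  proof
    show "\<phi> ` C \<subseteq> C" using \<phi>C Csub by blast
    show "C \<subseteq> \<phi> ` C"
    proof
      fix c assume "c \<in> C"
      then obtain z where "z \<in> carrier G" "c = \<phi> z" using surj Csub by blast
      then show "c \<in> \<phi> ` C" using \<phi>C \<open>c \<in> C\<close> by blast
    qed
  qed
  have im: "\<phi> ` (C #> a) = C #> \<phi> a" if a: "a \<in> carrier G" for a
  proof -
    have "C #> a = (\<lambda>c. c \<otimes> a) ` C" "C #> \<phi> a = (\<lambda>c. c \<otimes> \<phi> a) ` \<phi> ` C"
      unfolding \<phi>Cim by (auto simp: r_coset_def)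
    then show ?thesis using a Csub by (auto simp: image_image intro!: image_cong)
  qed
  \<comment> \<open>Cosets are sets, so the induced automorphism is simply the image map; it is well
    defined without choosing representatives.\<close>
  define \<chi> where "\<chi> = image \<phi>"
  have \<chi>: "\<chi> (C #> x) = C #> \<phi> x" if "x \<in> carrier G" for x
    using im[OF that] by (simp add: \<chi>_def)
  have \<chi>hom: "\<chi> \<in> hom Q Q"
    by (rule homI) (auto simp: carrQ multQ \<chi>)
  have "inj_on \<chi> (carrier Q)"
  proof (rule inj_onI)
    fix U V assume UV: "U \<in> carrier Q" "V \<in> carrier Q" "\<chi> U = \<chi> V"
    then have "U \<subseteq> carrier G" "V \<subseteq> carrier G" using Csub by (auto simp: carrQ r_coset_def)
    then show "U = V" using UV(3) inj by (simp add: \<chi>_def inj_on_image_eq_iff)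
  qed
  moreover have "\<chi> ` carrier Q = carrier Q"
  proof -
    have "\<chi> ` carrier Q = (\<lambda>x. C #> \<phi> x) ` carrier G" 
      unfolding carrQ image_image by (intro image_cong refl \<chi>)
    also have "\<dots> = (\<lambda>x. C #> x) ` \<phi> ` carrier G" by (simp add: image_image)
    finally show ?thesis by (simp add: surj carrQ)
  qed
  ultimately have "\<chi> \<in> iso Q Q" using \<chi>hom by (simp add: iso_def bij_betw_def)
  then have inf: "infinite (twisted_conjugacy_classes Q \<chi>)"
    using R unfolding R_infinity_property_def reidemeister_number_eq_infinity_iff Q_def C_def by blast
  have invQ: "inv\<^bsub>Q\<^esub> (C #> x) = C #> inv x" if "x \<in> carrier G" for x
    by (rule Q.inv_equality) (use that in \<open>auto simp: multQ oneQ carrQ coset_mult_one Csub\<close>)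
  have "twisted_conjugacy_classes Q \<chi> \<subseteq> (\<lambda>c. (\<lambda>y. C #> y) ` c) ` twisted_conjugacy_classes G \<phi>"
  proof
    fix c assume "c \<in> twisted_conjugacy_classes Q \<chi>"
    then obtain x where x: "x \<in> carrier G" 
      "c = (\<lambda>h. h \<otimes>\<^bsub>Q\<^esub> (C #> x) \<otimes>\<^bsub>Q\<^esub> \<chi> (inv\<^bsub>Q\<^esub> h)) ` carrier Q"
      unfolding twisted_conjugacy_classes_alt[OF Q \<chi>hom] carrQ by blast
    have "c = (\<lambda>y. C #> y) ` (\<lambda>h. h \<otimes> x \<otimes> \<phi> (inv h)) ` carrier G"
      unfolding x(2) carrQ image_image using x(1) by (intro image_cong refl) (simp add: multQ invQ \<chi>)
    then show "c \<in> (\<lambda>c. (\<lambda>y. C #> y) ` c) ` twisted_conjugacy_classes G \<phi>"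
      using x(1) unfolding twisted_conjugacy_classes_alt[OF G \<phi>hom] by blast
  qed
  then show False using inf fin by (meson finite_imageI finite_subset)
qed

section \<open>Integer row operations\<close>

declare index_mult_mat(1) [simp del]

lemma mult_carrier_mat_square [simp]:
  "A \<in> carrier_mat n n \<Longrightarrow> B \<in> carrier_mat n m \<Longrightarrow> A * B \<in> carrier_mat n m"
  by (rule mult_carrier_mat)

lemma index_mult_mat_sum:
  "\<lbrakk>A \<in> carrier_mat n m; B \<in> carrier_mat m p; i < n; j < p\<rbrakk> \<Longrightarrow>
    (A * B) $$ (i, j) = (\<Sum>l<m. A $$ (i, l) * B $$ (l, j))"
  by (auto simp: index_mult_mat(1) scalar_prod_def atLeast0LessThan intro!: sum.cong)

text \<open>The index j records that only rows from j on are combined. Such products fix every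
  vector supported on the first j coordinates, so a reduction keeps what was achieved in earlier
  columns.\<close>

inductive_set row_ops :: "nat \<Rightarrow> nat \<Rightarrow> int mat set" for n j where
  one: "1\<^sub>m n \<in> row_ops n j"
| step: "\<lbrakk>M \<in> row_ops n j; j \<le> k; k < n; j \<le> l; l < n; k \<noteq> l\<rbrakk> \<Longrightarrow> addrow_mat n a k l * M \<in> row_ops n j"

lemma row_ops_carrier [simp]: "M \<in> row_ops n j \<Longrightarrow> M \<in> carrier_mat n n"
  by (induction rule: row_ops.induct) simp_all

lemma row_ops_mult:
  assumes "M \<in> row_ops n j" "M' \<in> row_ops n j" shows "M * M' \<in> row_ops n j"
  using assms
proof (induction rule: row_ops.induct)
  case one
  then show ?case by (metis row_ops_carrier left_mult_one_mat)
next
  case (step M k l a)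
  have "addrow_mat n a k l * M * M' = addrow_mat n a k l * (M * M')"
    using step.hyps(1) step.prems by (intro assoc_mult_mat) (auto intro: row_ops_carrier)
  then show ?case using step by (auto intro: row_ops.step)
qed

lemma row_ops_mono:
  assumes "M \<in> row_ops n j" "j' \<le> j" shows "M \<in> row_ops n j'"
  using assms by (induction rule: row_ops.induct) (auto intro: row_ops.intros)

lemma row_ops_addrow:
  "\<lbrakk>j \<le> k; k < n; j \<le> l; l < n; k \<noteq> l\<rbrakk> \<Longrightarrow> addrow_mat n a k l \<in> row_ops n j"
  using row_ops.step[OF row_ops.one, of j k n l a] by simp

lemma index_addrow_mat_mult:
  fixes A :: "int mat"
  assumes "A \<in> carrier_mat n nc" "l < n" "i < n" "c < nc"
  shows "(addrow_mat n a k l * A) $$ (i, c) = (if i = k then a * A $$ (l, c) + A $$ (k, c) else A $$ (i, c))"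
  using addrow_mat[OF assms(1,2), of a k, symmetric] assms by auto

lemma index_mult_addrow_mat:
  fixes A :: "int mat"
  assumes "A \<in> carrier_mat nr n" "k < n" "i < nr" "c < n"
  shows "(A * addrow_mat n a k l) $$ (i, c) = (if c = l then a * A $$ (i, k) + A $$ (i, l) else A $$ (i, c))"
  using addcol_mat[OF assms(1,2), of a l, symmetric] assms by (auto simp: mat_addcol_def)

text \<open>Only rows from j on are ever added to others, and these are zero in this column.\<close>

lemma row_ops_col_unchanged:
  assumes "M \<in> row_ops n j" "A \<in> carrier_mat n nc" "c < nc" "\<And>i. j \<le> i \<Longrightarrow> i < n \<Longrightarrow> A $$ (i, c) = 0" "i < n"
  shows "(M * A) $$ (i, c) = A $$ (i, c)"
  using assms
proof (induction arbitrary: i rule: row_ops.induct)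
  case (step M k l a)
  have "addrow_mat n a k l * M * A = addrow_mat n a k l * (M * A)"
    using step.hyps(1) step.prems by (intro assoc_mult_mat) (auto intro: row_ops_carrier)
  moreover have "M * A \<in> carrier_mat n nc" using step.hyps(1) step.prems by simp
  ultimately show ?case using step by (simp add: index_addrow_mat_mult[where nc = nc])
qed auto

text \<open>Subtractive Euclidean algorithm on the part of the column from row j on, with the sum of
  the absolute values as measure.\<close>

lemma row_ops_euclid:
  assumes A: "A \<in> carrier_mat n nc" "c < nc" "j < n"
  shows "\<exists>M\<in>row_ops n j. \<forall>i. j < i \<longrightarrow> i < n \<longrightarrow> (M * A) $$ (i, c) = 0"
  using A(1)
proof (induction "\<Sum>i = j..<n. nat \<bar>A $$ (i, c)\<bar>" arbitrary: A rule: less_induct)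
  case less
  have step: "\<exists>M\<in>row_ops n j. \<forall>i. j < i \<longrightarrow> i < n \<longrightarrow> (M * A) $$ (i, c) = 0"
    if ik: "j \<le> i" "i < n" "j \<le> k" "k < n" "i \<noteq> k" and nz: "A $$ (k, c) \<noteq> 0" and
      le: "\<bar>A $$ (k, c)\<bar> \<le> \<bar>A $$ (i, c)\<bar>" for i k
  proof -
    \<comment> \<open>The sign for which the entry of larger absolute value shrinks.\<close>
    define a :: int where "a = (if (A $$ (k, c) > 0) = (A $$ (i, c) > 0) then -1 else 1)"
    define A' where "A' = addrow_mat n a i k * A"
    have A': "A' \<in> carrier_mat n nc" using less.prems by (simp add: A'_def)
    have ent: "A' $$ (r, c) = (if r = i then a * A $$ (k, c) + A $$ (i, c) else A $$ (r, c))" if "r < n" for r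
      using that less.prems A ik by (simp add: A'_def index_addrow_mat_mult)
    have "(\<Sum>r = j..<n. nat \<bar>A' $$ (r, c)\<bar>) < (\<Sum>r = j..<n. nat \<bar>A $$ (r, c)\<bar>)"
    proof (rule sum_strict_mono_ex1)
      have lt: "\<bar>A' $$ (i, c)\<bar> < \<bar>A $$ (i, c)\<bar>"
        using nz le ik by (auto simp: ent a_def)
      then show "\<exists>r\<in>{j..<n}. nat \<bar>A' $$ (r, c)\<bar> < nat \<bar>A $$ (r, c)\<bar>" using ik by (intro bexI[of _ i]) auto
      show "\<forall>r\<in>{j..<n}. nat \<bar>A' $$ (r, c)\<bar> \<le> nat \<bar>A $$ (r, c)\<bar>"
        using lt ent by (metis atLeastLessThan_iff le_less nat_mono)
    qed simp
    from less.hyps[OF this A'] obtain M where M: "M \<in> row_ops n j"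
      "\<And>i. j < i \<Longrightarrow> i < n \<Longrightarrow> (M * A') $$ (i, c) = 0" by blast
    have "M * A' = (M * addrow_mat n a i k) * A"
      unfolding A'_def using M(1) less.prems by (intro assoc_mult_mat[symmetric]) (auto intro: row_ops_carrier)
    moreover have "M * addrow_mat n a i k \<in> row_ops n j" using M(1) ik by (intro row_ops_mult row_ops_addrow) auto
    ultimately show ?thesis using M(2) by auto
  qed
  show ?case
  proof (cases "\<forall>i. j < i \<longrightarrow> i < n \<longrightarrow> A $$ (i, c) = 0")
    case True
    then show ?thesis using less.prems row_ops.one[of n j] A by (intro bexI[of _ "1\<^sub>m n"]) auto
  next
    case False
    then obtain i where i: "j < i" "i < n" "A $$ (i, c) \<noteq> 0" by blast
    show ?thesis
    proof (cases "A $$ (j, c) = 0")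
      case False
      show ?thesis
      proof (cases "\<bar>A $$ (i, c)\<bar> \<le> \<bar>A $$ (j, c)\<bar>")
        case True
        then show ?thesis using step[of j i] i A by simp
      next
        case False
        then show ?thesis using step[of i j] i A \<open>A $$ (j, c) \<noteq> 0\<close> by simp
      qed
    next
      case True
      show ?thesis
      proof (cases "\<exists>k. j < k \<and> k < n \<and> k \<noteq> i \<and> A $$ (k, c) \<noteq> 0")
        case True
        then obtain k where k: "j < k" "k < n" "k \<noteq> i" "A $$ (k, c) \<noteq> 0" by blast
        show ?thesis
        proof (cases "\<bar>A $$ (i, c)\<bar> \<le> \<bar>A $$ (k, c)\<bar>")
          case True
          then show ?thesis using step[of k i] i k by simp
        next
          case False
          then show ?thesis using step[of i k] i k by simp
        qed
      next
        case only: False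
        \<comment> \<open>The only nonzero entry from row j on sits in row i: it is copied to row j
          and then cancelled in row i. A swap is avoided, so the determinant stays 1.\<close>
        define M :: "int mat" where "M = addrow_mat n (-1) i j * addrow_mat n 1 j i"
        have M: "M \<in> row_ops n j" unfolding M_def using i A by (intro row_ops_mult row_ops_addrow) auto
        have "M * A = addrow_mat n (-1) i j * (addrow_mat n 1 j i * A)"
          unfolding M_def using less.prems by (intro assoc_mult_mat) auto
        moreover have "addrow_mat n 1 j i * A \<in> carrier_mat n nc" using less.prems by auto
        ultimately have "(M * A) $$ (r, c) = 0" if "j < r" "r < n" for r
          using that less.prems A i only True by (auto simp: index_addrow_mat_mult[where nc = nc])
        then show ?thesis using M by blast
      qed
    qed
  qed
qed

section \<open>Reduction of invertible integer matrices to sign diagonals\<close>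

lemma det_GL_int:
  assumes "A \<in> carrier (GL_int n)" shows "det A = 1 \<or> det A = -1"
proof -
  obtain B where B: "A \<in> carrier_mat n n" "B \<in> carrier_mat n n" "A * B = 1\<^sub>m n"
    using assms by (auto simp: carrier_GL_int)
  then have "det A * det B = 1" using det_mult[OF B(1,2)] by simp
  then show ?thesis using zmult_eq_1_iff by auto
qed

text \<open>A determinant 1 or -1 is its own inverse, so \<open>det A\<close> times the adjugate is
  an integral inverse.\<close>

lemma GL_int_iff_det:
  "A \<in> carrier (GL_int n) \<longleftrightarrow> A \<in> carrier_mat n n \<and> (det A = 1 \<or> det A = -1)"
proof
  assume "A \<in> carrier (GL_int n)"
  then show "A \<in> carrier_mat n n \<and> (det A = 1 \<or> det A = -1)"
    using det_GL_int by (auto simp: carrier_GL_int)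
next
  assume A: "A \<in> carrier_mat n n \<and> (det A = 1 \<or> det A = -1)"
  have "det A * det A = 1" using A by auto
  moreover have "A * (det A \<cdot>\<^sub>m adj_mat A) = (det A * det A) \<cdot>\<^sub>m 1\<^sub>m n" "(det A \<cdot>\<^sub>m adj_mat A) * A = (det A * det A) \<cdot>\<^sub>m 1\<^sub>m n"
    using adj_mat[of A n] A by (auto simp: mult_smult_distrib mult_smult_assoc_mat[of _ n n _ n])
  ultimately show "A \<in> carrier (GL_int n)"
    using A adj_mat(1)[of A n] by (auto simp: carrier_GL_int intro!: bexI[of _ "det A \<cdot>\<^sub>m adj_mat A"])
qed

lemma carrier_SL_int: "carrier (SL_int n) = {A \<in> carrier_mat n n. det A = 1}"
  by (auto simp: SL_int_def GL_int_iff_det)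

lemma mult_SL_int [simp]: "A \<otimes>\<^bsub>SL_int n\<^esub> B = A * B"
  and one_SL_int [simp]: "\<one>\<^bsub>SL_int n\<^esub> = 1\<^sub>m n"
  by (simp_all add: SL_int_def)

lemma row_ops_SL: "M \<in> row_ops n j \<Longrightarrow> M \<in> carrier (SL_int n)"
proof (induction rule: row_ops.induct)
  case (step M k l a)
  then show ?case by (auto simp: carrier_SL_int det_mult[of _ n] det_addrow_mat)
qed (simp add: carrier_SL_int)


lemma sq_assoc:
  fixes A :: "'a :: semiring_0 mat"
  assumes "A \<in> carrier_mat n n" "B \<in> carrier_mat n n" "C \<in> carrier_mat n m"
  shows "A * B * C = A * (B * C)"
  using assms by (rule assoc_mult_mat)

text \<open>The gcd that the Euclidean algorithm leaves on the diagonal is a unit because \<open>A\<close> is invertible.\<close>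

lemma row_ops_diagonalise_aux:
  assumes A: "A \<in> carrier (GL_int n)" and "j \<le> n"
  shows "\<exists>M\<in>row_ops n 0. \<forall>c<j. \<forall>i<n.
    if i = c then (M * A) $$ (i, c) \<in> {1, -1} else (M * A) $$ (i, c) = 0"
  using assms(2)
proof (induction j)
  case 0
  show ?case using row_ops.one by blast
next
  case (Suc j)
  have An: "A \<in> carrier_mat n n" using A by (simp add: GL_int_iff_det)
  obtain M where M: "M \<in> row_ops n 0" and
    red: "\<And>c i. c < j \<Longrightarrow> i < n \<Longrightarrow> if i = c then (M * A) $$ (i, c) \<in> {1, -1} else (M * A) $$ (i, c) = 0"
    using Suc by (metis Suc_leD)
  have j: "j < n" using Suc.prems by simp
  obtain E where E: "E \<in> row_ops n j" and Ez: "\<And>i. j < i \<Longrightarrow> i < n \<Longrightarrow> (E * (M * A)) $$ (i, j) = 0"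
    using row_ops_euclid[of "M * A" n n j j] j M An by auto
  have E0: "E \<in> row_ops n 0" using row_ops_mono[OF E] by simp
  have Bc: "E * (M * A) \<in> carrier_mat n n" using E0 M An by simp
  \<comment> \<open>The first j columns already vanish from row j on, so the reduction of column j
    below the diagonal leaves them alone.\<close>
  have redE: "if i = c then (E * (M * A)) $$ (i, c) \<in> {1, -1} else (E * (M * A)) $$ (i, c) = 0"
    if "c < j" "i < n" for c i
  proof -
    have "(E * (M * A)) $$ (i, c) = (M * A) $$ (i, c)"
    proof (rule row_ops_col_unchanged[OF E _ _ _ that(2)])
      show "M * A \<in> carrier_mat n n" using M An by simp
      show "c < n" using that j by simp
      show "(M * A) $$ (i, c) = 0" if "j \<le> i" "i < n" for i using red[OF \<open>c < j\<close> \<open>i < n\<close>] that \<open>c < j\<close> by auto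
    qed
    then show ?thesis using red[OF that] by (simp only:)
  qed
  define g where "g = (E * (M * A)) $$ (j, j)"
  have g: "g \<in> {1, -1}"
  proof -
    have "E * (M * A) = E * M * A" using E0 M An by (intro sq_assoc[symmetric]) auto
    moreover have "det (E * M * A) = det E * det M * det A"
      using E0 M An by (simp add: det_mult[of _ n])
    moreover have "det E = 1" "det M = 1" using row_ops_SL E0 M by (auto simp: carrier_SL_int)
    ultimately have "E * (M * A) \<in> carrier (GL_int n)"
      using A Bc by (auto simp: GL_int_iff_det)
    then obtain D where D: "D \<in> carrier_mat n n" "D * (E * (M * A)) = 1\<^sub>m n"
      by (auto simp: carrier_GL_int)
    have ent: "(\<Sum>i<n. D $$ (j, i) * (E * (M * A)) $$ (i, c)) = (if j = c then 1 else 0)" if "c < n" for c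
    proof -
      have "(D * (E * (M * A))) $$ (j, c) = (\<Sum>i<n. D $$ (j, i) * (E * (M * A)) $$ (i, c))"
        using D(1) Bc j that by (rule index_mult_mat_sum)
      then show ?thesis using D(2) j that by simp
    qed
    \<comment> \<open>Row j of the inverse D annihilates each column c < j, whose only nonzero entry
      is a unit at (c, c). So D vanishes there, and pairing row j with column j leaves D_jj g =
      1.\<close>
    have Dz: "D $$ (j, c) = 0" if "c < j" for c
    proof -
      have "(\<Sum>i<n. D $$ (j, i) * (E * (M * A)) $$ (i, c)) = D $$ (j, c) * (E * (M * A)) $$ (c, c)"
        using that j redE[OF that] by (subst sum.remove[of _ c]) (auto intro!: sum.neutral)
      then show ?thesis using ent[of c] that j redE[OF that, of c] by auto
    qed
    have "(\<Sum>i<n. D $$ (j, i) * (E * (M * A)) $$ (i, j)) = D $$ (j, j) * g"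
    proof -
      have "D $$ (j, i) * (E * (M * A)) $$ (i, j) = 0" if "i < n" "i \<noteq> j" for i
        using that Ez[of i] Dz[of i] by (cases "i < j") auto
      then show ?thesis
        unfolding g_def using j by (subst sum.remove[of _ j]) (auto intro!: sum.neutral)
    qed
    then have "D $$ (j, j) * g = 1" using ent[OF j] by simp
    then show ?thesis using zmult_eq_1_iff by auto
  qed
  have "\<exists>N\<in>row_ops n 0. (\<forall>c<j. \<forall>i<n. (N * (E * (M * A))) $$ (i, c) = (E * (M * A)) $$ (i, c)) \<and>
      (N * (E * (M * A))) $$ (j, j) = g \<and> (\<forall>i<n. (i < k \<or> j < i) \<longrightarrow> (N * (E * (M * A))) $$ (i, j) = 0)"
    if "k \<le> j" for k
    using that
  proof (induction k)
    case 0
    show ?case using Ez Bc by (intro bexI[of _ "1\<^sub>m n"] row_ops.one) (auto simp: g_def)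
  next
    case (Suc k)
    then obtain N where N: "N \<in> row_ops n 0"
      "\<forall>c<j. \<forall>i<n. (N * (E * (M * A))) $$ (i, c) = (E * (M * A)) $$ (i, c)"
      "(N * (E * (M * A))) $$ (j, j) = g"
      "\<forall>i<n. (i < k \<or> j < i) \<longrightarrow> (N * (E * (M * A))) $$ (i, j) = 0" by auto
    define B where "B = N * (E * (M * A))"
    \<comment> \<open>Since g g = 1, adding this multiple of row j cancels the entry (k, j). Row j
      is zero in the earlier columns, so these stay diagonal.\<close>
    define a where "a = - g * B $$ (k, j)"
    have B: "B \<in> carrier_mat n n" using N(1) Bc by (simp add: B_def)
    have id: "addrow_mat n a k j * N * (E * (M * A)) = addrow_mat n a k j * B"
      unfolding B_def using N(1) Bc by (intro sq_assoc) auto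
    have k: "k < j" "k < n" using Suc.prems j by auto
    have ent: "(addrow_mat n a k j * B) $$ (i, c) = (if i = k then a * B $$ (j, c) + B $$ (k, c) else B $$ (i, c))"
      if "i < n" "c < n" for i c using index_addrow_mat_mult[OF B j that] .
    have "addrow_mat n a k j * N \<in> row_ops n 0" using N(1) k j by (intro row_ops.step) auto
    moreover have "B $$ (j, c) = 0" if "c < j" for c using redE[OF that j] N(2) that j by (auto simp: B_def)
    moreover have "a * g + B $$ (k, j) = 0" using g by (auto simp: a_def)
    ultimately show ?case
      using N(2,3,4) k j unfolding B_def[symmetric] by (intro bexI[of _ "addrow_mat n a k j * N"]) (auto simp: id ent less_Suc_eq)
  qed
  from this[OF order_refl] obtain N where N: "N \<in> row_ops n 0"
      "\<And>c i. c < j \<Longrightarrow> i < n \<Longrightarrow> (N * (E * (M * A))) $$ (i, c) = (E * (M * A)) $$ (i, c)"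
      "(N * (E * (M * A))) $$ (j, j) = g"
      "\<And>i. i < n \<Longrightarrow> i \<noteq> j \<Longrightarrow> (N * (E * (M * A))) $$ (i, j) = 0" by (auto simp: neq_iff)
  have "N * E * M * A = N * (E * (M * A))" using N(1) E0 M An by (simp add: sq_assoc[of _ n _ _ n])
  moreover have "N * E * M \<in> row_ops n 0" using N(1) E0 M by (intro row_ops_mult)
  moreover have "if i = c then (N * (E * (M * A))) $$ (i, c) \<in> {1, -1} else (N * (E * (M * A))) $$ (i, c) = 0"
    if c: "c < Suc j" and i: "i < n" for c i
  proof (cases "c = j")
    case True
    then show ?thesis using N(3,4) g i by auto
  next
    case False
    then have cj: "c < j" using c by simp
    show ?thesis using redE[OF cj i] N(2)[OF cj i] by (simp only:)
  qed
  ultimately show ?case by (intro bexI[of _ "N * E * M"]) (simp_all only:, blast)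
qed

definition sign_diagonals :: "nat \<Rightarrow> int mat set" where
  "sign_diagonals n = {A \<in> carrier_mat n n. \<forall>i<n. \<forall>j<n. if i = j then A $$ (i, j) \<in> {1, -1} else A $$ (i, j) = 0}"

lemma row_ops_diagonalise:
  assumes "A \<in> carrier (GL_int n)"
  shows "\<exists>M\<in>row_ops n 0. M * A \<in> sign_diagonals n"
proof -
  have "A \<in> carrier_mat n n" using assms by (simp add: GL_int_iff_det)
  then show ?thesis
    using row_ops_diagonalise_aux[OF assms order_refl] row_ops_carrier mult_carrier_mat
    unfolding sign_diagonals_def mem_Collect_eq by meson
qed

lemma finite_bounded_mats:
  assumes "finite D" shows "finite {A \<in> carrier_mat n m. \<forall>i<n. \<forall>j<m. A $$ (i, j) \<in> D}" (is "finite ?S")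
proof (rule finite_imageD)
  let ?f = "\<lambda>A. \<lambda>p\<in>{..<n} \<times> {..<m}. A $$ p"
  have "?f ` ?S \<subseteq> ({..<n} \<times> {..<m}) \<rightarrow>\<^sub>E D" by (auto simp: PiE_iff extensional_def split: if_splits)
  then show "finite (?f ` ?S)" using assms by (meson finite_PiE finite_SigmaI finite_lessThan finite_subset)
  show "inj_on ?f ?S"
  proof (rule inj_onI)
    fix A B assume A: "A \<in> ?S" and B: "B \<in> ?S" and eq: "?f A = ?f B"
    have "A $$ (i, j) = B $$ (i, j)" if "i < n" "j < m" for i j
      using fun_cong[OF eq, of "(i, j)"] that by simp
    then show "A = B" using A B by (intro eq_matI) auto
  qed
qed

lemma finite_sign_diagonals: "finite (sign_diagonals n)"
proof -
  have "sign_diagonals n \<subseteq> {A \<in> carrier_mat n n. \<forall>i<n. \<forall>j<n. A $$ (i, j) \<in> {0, 1, -1}}"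
    unfolding sign_diagonals_def by (auto split: if_splits)
  then show ?thesis by (rule finite_subset) (rule finite_bounded_mats, simp)
qed

text \<open>Cancelling A on both sides leaves a A E_kl = a E_kl A, where E_kl is the matrix unit,
  and a nonzero integer cancels. The right side does not mention a: all nontrivial powers of a
  transvection have the same centraliser.\<close>

lemma commute_addrow_mat:
  fixes A :: "int mat"
  assumes A: "A \<in> carrier_mat n n" and kl: "k < n" "l < n" "k \<noteq> l" and "a \<noteq> 0"
  shows "A * addrow_mat n a k l = addrow_mat n a k l * A \<longleftrightarrow>
    (\<forall>i<n. i \<noteq> k \<longrightarrow> A $$ (i, k) = 0) \<and> (\<forall>c<n. c \<noteq> l \<longrightarrow> A $$ (l, c) = 0) \<and> A $$ (k, k) = A $$ (l, l)"
proof -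
  have "A * addrow_mat n a k l = addrow_mat n a k l * A \<longleftrightarrow>
    (\<forall>i<n. \<forall>c<n. (A * addrow_mat n a k l) $$ (i, c) = (addrow_mat n a k l * A) $$ (i, c))"
    using A by (auto intro!: eq_matI)
  also have "\<dots> \<longleftrightarrow> (\<forall>i<n. \<forall>c<n. (if c = l then a * A $$ (i, k) else 0) = (if i = k then a * A $$ (l, c) else 0))"
    using A kl by (intro all_cong1 imp_cong refl) (auto simp: index_addrow_mat_mult index_mult_addrow_mat)
  also have "\<dots> \<longleftrightarrow> (\<forall>i<n. i \<noteq> k \<longrightarrow> A $$ (i, k) = 0) \<and> (\<forall>c<n. c \<noteq> l \<longrightarrow> A $$ (l, c) = 0) \<and> A $$ (k, k) = A $$ (l, l)"
    using kl \<open>a \<noteq> 0\<close> by (auto split: if_splits)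
  finally show ?thesis .
qed

section \<open>The groups modulo their centres\<close>

definition mat_cong :: "int \<Rightarrow> int mat \<Rightarrow> int mat \<Rightarrow> bool" where
  "mat_cong m A B \<longleftrightarrow> (\<forall>i<dim_row A. \<forall>j<dim_col A. m dvd A $$ (i, j) - B $$ (i, j))"

lemma mat_cong_refl: "mat_cong m A A"
  by (simp add: mat_cong_def)

lemma mat_cong_mult:
  assumes "A \<in> carrier_mat n n" "A' \<in> carrier_mat n n" "B \<in> carrier_mat n n" "B' \<in> carrier_mat n n"
    and "mat_cong m A A'" "mat_cong m B B'"
  shows "mat_cong m (A * B) (A' * B')"
proof -
  have "m dvd (A * B) $$ (i, j) - (A' * B') $$ (i, j)" if ij: "i < n" "j < n" for i j
  proof -
    have "(A * B) $$ (i, j) - (A' * B') $$ (i, j) = (\<Sum>l<n. A $$ (i, l) * B $$ (l, j) - A' $$ (i, l) * B' $$ (l, j))"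
      using assms ij by (simp add: index_mult_mat_sum[of _ n n _ n] sum_subtractf)
    also have "\<dots> = (\<Sum>l<n. A $$ (i, l) * (B $$ (l, j) - B' $$ (l, j)) + (A $$ (i, l) - A' $$ (i, l)) * B' $$ (l, j))"
      by (simp add: algebra_simps)
    also have "m dvd \<dots>"
      using assms ij by (intro dvd_sum dvd_add dvd_mult dvd_mult2) (auto simp: mat_cong_def)
    finally show ?thesis .
  qed
  then show ?thesis using assms(1,3) by (auto simp: mat_cong_def)
qed

lemma mat_cong_sym: "mat_cong m A B \<Longrightarrow> A \<in> carrier_mat n k \<Longrightarrow> B \<in> carrier_mat n k \<Longrightarrow> mat_cong m B A"
  by (auto simp: mat_cong_def dvd_diff_commute)

lemma mat_cong_uminus: 
  "mat_cong m A B \<Longrightarrow> A \<in> carrier_mat n k \<Longrightarrow> B \<in> carrier_mat n k \<Longrightarrow> mat_cong m (- A) (- B)"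
  by (auto simp: mat_cong_def dvd_diff_commute)

text \<open>GL and SL are treated together: both contain the transvections, and central elements of
  either are 1 or -1.\<close>

locale int_matrix_group =
  fixes n :: nat and \<Gamma> :: "int mat monoid"
  assumes n2: "n \<ge> 2" and \<Gamma>: "\<Gamma> = GL_int n \<or> \<Gamma> = SL_int n"
begin

sublocale group \<Gamma>
  using \<Gamma> group_GL_int group_SL_int by auto

lemma mult_eq [simp]: "A \<otimes>\<^bsub>\<Gamma>\<^esub> B = A * B"
  and one_eq [simp]: "\<one>\<^bsub>\<Gamma>\<^esub> = 1\<^sub>m n"
  using \<Gamma> by auto

lemma carrier_GL: "A \<in> carrier \<Gamma> \<Longrightarrow> A \<in> carrier (GL_int n)"
  using \<Gamma> by (auto simp: carrier_SL_int GL_int_iff_det)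

lemma SL_carrier: "A \<in> carrier (SL_int n) \<Longrightarrow> A \<in> carrier \<Gamma>"
  using \<Gamma> by (auto simp: carrier_SL_int GL_int_iff_det)

lemma carrier_mat [simp]: "A \<in> carrier \<Gamma> \<Longrightarrow> A \<in> carrier_mat n n"
  using carrier_GL by (auto simp: GL_int_iff_det)

lemma addrow_carrier [simp]: "k < n \<Longrightarrow> l < n \<Longrightarrow> k \<noteq> l \<Longrightarrow> addrow_mat n a k l \<in> carrier \<Gamma>"
  by (rule SL_carrier) (simp add: carrier_SL_int det_addrow_mat)

lemma row_ops_carrier': "M \<in> row_ops n j \<Longrightarrow> M \<in> carrier \<Gamma>"
  by (rule SL_carrier) (rule row_ops_SL)

definition "centre = group_centre \<Gamma>"
definition "proj A = centre #>\<^bsub>\<Gamma>\<^esub> A"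
definition "PG = \<Gamma> Mod centre"

sublocale centre: normal centre \<Gamma>
  unfolding centre_def by (rule group_centre_normal) (rule is_group)

sublocale PG: group PG
  unfolding PG_def by (rule centre.factorgroup_is_group)

lemma carrier_PG: "carrier PG = proj ` carrier \<Gamma>"
  by (auto simp: PG_def FactGroup_def RCOSETS_def proj_def)

lemma proj_carrier [simp]: "A \<in> carrier \<Gamma> \<Longrightarrow> proj A \<in> carrier PG"
  by (simp add: carrier_PG)

lemma proj_mult: "A \<in> carrier \<Gamma> \<Longrightarrow> B \<in> carrier \<Gamma> \<Longrightarrow> proj A \<otimes>\<^bsub>PG\<^esub> proj B = proj (A * B)"
  using centre.rcos_sum[of A B] by (simp add: PG_def FactGroup_def proj_def)

lemma proj_hom: "proj \<in> hom \<Gamma> PG"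
  by (rule homI) (simp_all add: proj_mult)

lemma proj_group_hom: "group_hom \<Gamma> PG proj"
  by (simp add: group_hom_def group_hom_axioms_def proj_hom is_group PG.is_group)

text \<open>Commuting with all transvections forces a scalar matrix, and an invertible integer
  scalar is a sign. Membership in the carrier stays on the right because -1 has determinant -1 when
  n is odd.\<close>

lemma centre_iff: "A \<in> centre \<longleftrightarrow> A \<in> carrier \<Gamma> \<and> (A = 1\<^sub>m n \<or> A = - 1\<^sub>m n)"
proof
  assume A: "A \<in> centre"
  have AG: "A \<in> carrier \<Gamma>" and com: "\<And>g. g \<in> carrier \<Gamma> \<Longrightarrow> A * g = g * A"
    using A unfolding centre_def group_centre_def by simp_all
  have *: "(\<forall>i<n. i \<noteq> k \<longrightarrow> A $$ (i, k) = 0) \<and> (\<forall>c<n. c \<noteq> l \<longrightarrow> A $$ (l, c) = 0) \<and> A $$ (k, k) = A $$ (l, l)"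
    if "k < n" "l < n" "k \<noteq> l" for k l
    using commute_addrow_mat[OF carrier_mat[OF AG] that, of 1] com[OF addrow_carrier[OF that, of 1]] by simp
  have dg: "A $$ (i, i) = A $$ (0, 0)" if "i < n" for i
    using *[of i 0] that n2 by (cases "i = 0") auto
  have od: "A $$ (i, k) = 0" if "i < n" "k < n" "i \<noteq> k" for i k
    using *[of k i] that by auto
  obtain B where B: "B \<in> carrier_mat n n" "B * A = 1\<^sub>m n"
    using carrier_GL[OF AG] by (auto simp: carrier_GL_int)
  have "(B * A) $$ (0, 0) = B $$ (0, 0) * A $$ (0, 0)"
    using B(1) AG n2 od by (subst index_mult_mat_sum[of _ n n _ n]) (auto simp: sum.remove[of _ 0])
  then have "A $$ (0, 0) = 1 \<or> A $$ (0, 0) = -1"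
    using B(2) n2 zmult_eq_1_iff[of "B $$ (0, 0)" "A $$ (0, 0)"] by auto
  moreover have "A = A $$ (0, 0) \<cdot>\<^sub>m 1\<^sub>m n"
  proof (rule eq_matI)
    show "A $$ (i, k) = (A $$ (0, 0) \<cdot>\<^sub>m 1\<^sub>m n) $$ (i, k)"
      if "i < dim_row (A $$ (0, 0) \<cdot>\<^sub>m 1\<^sub>m n)" "k < dim_col (A $$ (0, 0) \<cdot>\<^sub>m 1\<^sub>m n)" for i k
    proof (cases "i = k")
      case True
      have "A $$ (k, k) = A $$ (0, 0)" using dg[of k] that by simp
      then show ?thesis using True that by simp
    qed (use od[of i k] that in auto)
  qed (use carrier_mat[OF AG] in auto)
  ultimately have *: "A $$ (0, 0) = 1 \<or> A $$ (0, 0) = -1" "A = A $$ (0, 0) \<cdot>\<^sub>m 1\<^sub>m n" by auto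
  have "A = 1\<^sub>m n \<or> A = - 1\<^sub>m n"
  proof -
    have "1 \<cdot>\<^sub>m 1\<^sub>m n = (1\<^sub>m n :: int mat)" "- 1 \<cdot>\<^sub>m 1\<^sub>m n = (- 1\<^sub>m n :: int mat)" by (auto intro!: eq_matI)
    then show ?thesis using * by metis
  qed
  then show "A \<in> carrier \<Gamma> \<and> (A = 1\<^sub>m n \<or> A = - 1\<^sub>m n)" using AG by simp
next
  assume A: "A \<in> carrier \<Gamma> \<and> (A = 1\<^sub>m n \<or> A = - 1\<^sub>m n)"
  have "A * g = g * A" if "g \<in> carrier \<Gamma>" for g
    using A carrier_mat[OF that] by auto
  then show "A \<in> centre" unfolding centre_def group_centre_def using A by simp
qed

lemma proj_eq_iff:
  assumes A: "A \<in> carrier \<Gamma>" and B: "B \<in> carrier \<Gamma>"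
  shows "proj A = proj B \<longleftrightarrow> A = B \<or> A = - B"
proof -
  have "proj A = proj B \<longleftrightarrow> A \<in> proj B"
    unfolding proj_def
    using repr_independence[OF _ B centre.is_subgroup, of A] rcos_self[OF A centre.is_subgroup] by auto
  also have "\<dots> \<longleftrightarrow> (\<exists>z\<in>centre. A = z * B)" by (auto simp: proj_def r_coset_def)
  also have "\<dots> \<longleftrightarrow> A = B \<or> A = - B"
  proof
    assume "\<exists>z\<in>centre. A = z * B"
    then show "A = B \<or> A = - B" using carrier_mat[OF B] by (auto simp: centre_iff)
  next
    assume *: "A = B \<or> A = - B"
    have "A \<otimes>\<^bsub>\<Gamma>\<^esub> inv\<^bsub>\<Gamma>\<^esub> B = 1\<^sub>m n \<or> A \<otimes>\<^bsub>\<Gamma>\<^esub> inv\<^bsub>\<Gamma>\<^esub> B = - 1\<^sub>m n"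
      using * r_inv[OF B] carrier_mat[OF B] carrier_mat[OF inv_closed[OF B]] by auto
    then have "A \<otimes>\<^bsub>\<Gamma>\<^esub> inv\<^bsub>\<Gamma>\<^esub> B \<in> centre" unfolding centre_iff using A B by (auto simp del: mult_eq)
    moreover have "A = (A \<otimes>\<^bsub>\<Gamma>\<^esub> inv\<^bsub>\<Gamma>\<^esub> B) \<otimes>\<^bsub>\<Gamma>\<^esub> B" 
      using m_assoc[OF A inv_closed[OF B] B] l_inv[OF B] r_one[OF A] by (simp del: mult_eq one_eq)
    ultimately show "\<exists>z\<in>centre. A = z * B" by (metis mult_eq)
  qed
  finally show ?thesis .
qed

section \<open>Finite generation and residual finiteness modulo the centre\<close>

text \<open>Row reduction writes every matrix as a product of transvections and one of finitely many
  sign diagonals; every transvection is a power of one with entry 1.\<close>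

lemma PG_finitely_generated:
  "\<exists>S. finite S \<and> S \<subseteq> carrier PG \<and> carrier PG = generate PG S"
proof -
  define S where "S = (\<lambda>(k, l). addrow_mat n 1 k l) ` {(k, l). k < n \<and> l < n \<and> k \<noteq> l} \<union> (sign_diagonals n \<inter> carrier \<Gamma>)"
  have SG: "S \<subseteq> carrier \<Gamma>" by (auto simp: S_def)
  have "finite {(k, l). k < n \<and> l < n \<and> k \<noteq> l}" by (rule finite_subset[of _ "{..<n} \<times> {..<n}"]) auto
  then have finS: "finite S" unfolding S_def using finite_sign_diagonals by simp
  interpret gen: subgroup "generate \<Gamma> S" \<Gamma> by (rule generate_is_subgroup[OF SG])
  have add: "addrow_mat n a k l * addrow_mat n b k l = addrow_mat n (a + b) k l"
    if "k < n" "l < n" "k \<noteq> l" for a b :: int and k l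
    using that by (intro eq_matI) (auto simp: index_addrow_mat_mult[where nc = n])
  have el: "addrow_mat n a k l \<in> generate \<Gamma> S" if kl: "k < n" "l < n" "k \<noteq> l" for a k l
  proof -
    have one: "addrow_mat n 1 k l \<in> generate \<Gamma> S"
      by (rule generate.incl) (use kl in \<open>auto simp: S_def\<close>)
    have zero: "addrow_mat n 0 k l = (1\<^sub>m n :: int mat)" by (rule eq_matI) auto
    have nat: "addrow_mat n (int m) k l \<in> generate \<Gamma> S" for m
    proof (induction m)
      case 0
      then show ?case using gen.one_closed zero by simp
    next
      case (Suc m)
      then show ?case using gen.m_closed[OF Suc one] add[OF kl, of "int m" 1] by (simp add: add.commute)
    qed
    have neg: "addrow_mat n (- int m) k l \<in> generate \<Gamma> S" for m
    proof -
      have "inv\<^bsub>\<Gamma>\<^esub> (addrow_mat n (int m) k l) = addrow_mat n (- int m) k l"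
        using kl add[OF kl, of "- int m" "int m"] by (intro inv_equality) (auto simp: zero)
      then show ?thesis using gen.m_inv_closed[OF nat[of m]] by simp
    qed
    show ?thesis using nat[of "nat a"] neg[of "nat (- a)"] by (cases "a \<ge> 0") auto
  qed
  have ro: "M \<in> generate \<Gamma> S" if "M \<in> row_ops n j" for M j
    using that
  proof (induction rule: row_ops.induct)
    case one
    then show ?case using gen.one_closed by simp
  next
    case (step M k l a)
    then show ?case using gen.m_closed[OF el[of k l a] step.IH] by simp
  qed
  have "A \<in> generate \<Gamma> S" if A: "A \<in> carrier \<Gamma>" for A
  proof -
    obtain M where M: "M \<in> row_ops n 0" "M * A \<in> sign_diagonals n"
      using row_ops_diagonalise[OF carrier_GL[OF A]] by blast
    have MG: "M \<in> carrier \<Gamma>" using M row_ops_carrier' by simp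
    have "M * A \<in> carrier \<Gamma>" using m_closed[OF MG A] by simp
    then have "M * A \<in> generate \<Gamma> S" using M by (intro generate.incl) (simp add: S_def)
    then have "inv\<^bsub>\<Gamma>\<^esub> M \<otimes>\<^bsub>\<Gamma>\<^esub> (M * A) \<in> generate \<Gamma> S" using ro[OF M(1)] by blast
    moreover have "inv\<^bsub>\<Gamma>\<^esub> M \<otimes>\<^bsub>\<Gamma>\<^esub> (M \<otimes>\<^bsub>\<Gamma>\<^esub> A) = A" 
      using m_assoc[OF inv_closed[OF MG] MG A] l_inv[OF MG] l_one[OF A] by (simp del: mult_eq one_eq)
    ultimately show ?thesis by simp
  qed
  then have "carrier \<Gamma> = generate \<Gamma> S" using generate_incl[OF SG] by auto
  then have "carrier PG = generate PG (proj ` S)"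
    using group_hom.generate_img[OF proj_group_hom SG] by (simp add: carrier_PG)
  moreover have "proj ` S \<subseteq> carrier PG" using SG by auto
  ultimately show ?thesis using finS by blast
qed

lemma lift_ex: "x \<in> carrier PG \<Longrightarrow> \<exists>A\<in>carrier \<Gamma>. x = proj A"
  by (auto simp: carrier_PG)

lemma quotient_hom:
  assumes N: "N \<lhd> \<Gamma>" and sub: "centre \<subseteq> N"
  shows "\<exists>\<alpha>\<in>hom PG (\<Gamma> Mod N). \<forall>M\<in>carrier \<Gamma>. \<alpha> (proj M) = N #>\<^bsub>\<Gamma>\<^esub> M"
proof -
  interpret N: normal N \<Gamma> by (rule N)
  define \<alpha> where "\<alpha> Z = N #>\<^bsub>\<Gamma>\<^esub> inv_into (carrier \<Gamma>) proj Z" for Z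
  have \<alpha>: "\<alpha> (proj B) = N #>\<^bsub>\<Gamma>\<^esub> B" if B: "B \<in> carrier \<Gamma>" for B
  proof -
    define C where "C = inv_into (carrier \<Gamma>) proj (proj B)"
    have C: "C \<in> carrier \<Gamma>" "proj C = proj B"
      unfolding C_def
      using inv_into_into[of "proj B" proj "carrier \<Gamma>"] f_inv_into_f[of "proj B" proj "carrier \<Gamma>"] B by auto
    have "C \<in> proj B" using C(2) rcos_self[OF C(1) centre.is_subgroup] by (simp add: proj_def)
    then have "C \<in> N #>\<^bsub>\<Gamma>\<^esub> B" using sub by (auto simp: proj_def r_coset_def)
    then have "N #>\<^bsub>\<Gamma>\<^esub> B = N #>\<^bsub>\<Gamma>\<^esub> C" using repr_independence[OF _ B N.is_subgroup] by blast
    then show ?thesis by (simp add: \<alpha>_def C_def)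
  qed
  have "\<alpha> \<in> hom PG (\<Gamma> Mod N)"
  proof (rule homI)
    fix x assume "x \<in> carrier PG"
    then obtain A where "A \<in> carrier \<Gamma>" "x = proj A" using lift_ex by blast
    then show "\<alpha> x \<in> carrier (\<Gamma> Mod N)" by (auto simp: \<alpha> FactGroup_def RCOSETS_def)
  next
    fix x y assume "x \<in> carrier PG" "y \<in> carrier PG"
    then obtain A B where AB: "A \<in> carrier \<Gamma>" "x = proj A" "B \<in> carrier \<Gamma>" "y = proj B" using lift_ex by metis
    then show "\<alpha> (x \<otimes>\<^bsub>PG\<^esub> y) = \<alpha> x \<otimes>\<^bsub>\<Gamma> Mod N\<^esub> \<alpha> y"
      using m_closed[OF AB(1,3)] N.rcos_sum[OF AB(1,3)] by (simp add: proj_mult \<alpha> FactGroup_def)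
  qed
  then show ?thesis using \<alpha> by blast
qed

text \<open>Congruence quotients separate points. The subgroup consists of the matrices congruent to
  1 or to -1, so it contains the centre and the quotient map factors through
  \<open>PG\<close>.\<close>

lemma PG_residually_finite:
  assumes x: "x \<in> carrier PG" "x \<noteq> \<one>\<^bsub>PG\<^esub>"
  shows "\<exists>(H :: int mat set monoid) \<alpha>. group H \<and> finite (carrier H) \<and> \<alpha> \<in> hom PG H \<and> \<alpha> x \<noteq> \<one>\<^bsub>H\<^esub>"
proof -
  obtain A where A: "A \<in> carrier \<Gamma>" "x = proj A" using x by (auto simp: carrier_PG)
  have one: "\<one>\<^bsub>PG\<^esub> = proj (1\<^sub>m n)" using group_hom.hom_one[OF proj_group_hom] by simp
  have ne: "A \<noteq> 1\<^sub>m n" "A \<noteq> - 1\<^sub>m n"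
    using x A proj_eq_iff[of A "1\<^sub>m n"] one_closed unfolding one by auto
  \<comment> \<open>So large that an entry of A and an entry of 1 or -1 are congruent modulo m only
    if they are equal.\<close>
  define m where "m = 2 + (\<Sum>i<n. \<Sum>j<n. \<bar>A $$ (i, j)\<bar>)"
  have m: "\<bar>A $$ (i, j)\<bar> + 1 < m" if "i < n" "j < n" for i j
  proof -
    have "\<bar>A $$ (i, j)\<bar> \<le> (\<Sum>j<n. \<bar>A $$ (i, j)\<bar>)" using that by (intro member_le_sum) auto
    also have "\<dots> \<le> (\<Sum>i<n. \<Sum>j<n. \<bar>A $$ (i, j)\<bar>)"
      using that by (intro member_le_sum[of i "{..<n}" "\<lambda>i. \<Sum>j<n. \<bar>A $$ (i, j)\<bar>"]) (auto intro: sum_nonneg)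
    finally show ?thesis by (simp add: m_def)
  qed
  have m0: "m > 0" unfolding m_def by (smt (verit) sum_nonneg abs_ge_zero)
  have far: "\<not> mat_cong m A B" if B: "B = 1\<^sub>m n \<or> B = - 1\<^sub>m n" for B
  proof
    assume c: "mat_cong m A B"
    have Bc: "B \<in> carrier_mat n n" using B by auto
    have "A $$ (i, j) = B $$ (i, j)" if ij: "i < n" "j < n" for i j
    proof -
      have "\<bar>A $$ (i, j) - B $$ (i, j)\<bar> < m"
        using m[OF ij] B ij by (auto simp: abs_if split: if_splits)
      moreover have "m dvd A $$ (i, j) - B $$ (i, j)" using c A ij by (auto simp: mat_cong_def dest: carrier_mat)
      ultimately show ?thesis using dvd_imp_le_int[of "A $$ (i, j) - B $$ (i, j)" m] m0 by force
    qed
    then have "A = B" using A Bc by (intro eq_matI) (auto dest: carrier_mat)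
    then show False using B ne by auto
  qed
  define N where "N = {B \<in> carrier \<Gamma>. mat_cong m B (1\<^sub>m n) \<or> mat_cong m B (- 1\<^sub>m n)}"
  have N: "N \<lhd> \<Gamma>"
  proof (rule normal_invI)
    show "subgroup N \<Gamma>"
    proof (rule subgroupI)
      show "N \<subseteq> carrier \<Gamma>" by (auto simp: N_def)
      have "1\<^sub>m n \<in> N" using one_closed by (simp add: N_def mat_cong_refl)
      then show "N \<noteq> {}" by blast
      fix a b assume a: "a \<in> N" and b: "b \<in> N"
      have ab: "a \<in> carrier_mat n n" "b \<in> carrier_mat n n" "a \<in> carrier \<Gamma>" "b \<in> carrier \<Gamma>"
        using a b by (auto simp: N_def)
      show "a \<otimes>\<^bsub>\<Gamma>\<^esub> b \<in> N"
      proof -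
        have "mat_cong m (a * b) (1\<^sub>m n) \<or> mat_cong m (a * b) (- 1\<^sub>m n)"
          using a b mat_cong_mult[OF ab(1) _ ab(2), of "1\<^sub>m n" "1\<^sub>m n" m] mat_cong_mult[OF ab(1) _ ab(2), of "1\<^sub>m n" "- 1\<^sub>m n" m]
           mat_cong_mult[OF ab(1) _ ab(2), of "- 1\<^sub>m n" "1\<^sub>m n" m] mat_cong_mult[OF ab(1) _ ab(2), of "- 1\<^sub>m n" "- 1\<^sub>m n" m]
          by (auto simp: N_def)
        then show ?thesis using m_closed[OF ab(3,4)] by (simp add: N_def)
      qed
      show "inv\<^bsub>\<Gamma>\<^esub> a \<in> N"
      proof -
        define c where "c = inv\<^bsub>\<Gamma>\<^esub> a"
        have c: "c \<in> carrier \<Gamma>" "c * a = 1\<^sub>m n" using ab l_inv[OF ab(3)] by (auto simp: c_def)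
        have "mat_cong m (1\<^sub>m n) c \<or> mat_cong m (1\<^sub>m n) (- c)"
          using a mat_cong_mult[OF _ _ ab(1), of c c "1\<^sub>m n" m] mat_cong_mult[OF _ _ ab(1), of c c "- 1\<^sub>m n" m]
            mat_cong_refl[of m c] c carrier_mat[OF c(1)] by (auto simp: N_def)
        then have "mat_cong m c (1\<^sub>m n) \<or> mat_cong m c (- 1\<^sub>m n)"
          using mat_cong_sym[of m "1\<^sub>m n" c n n] mat_cong_sym[of m "1\<^sub>m n" "- c" n n]
            mat_cong_uminus[of m "- c" "1\<^sub>m n" n n] carrier_mat[OF c(1)] by auto
        then show ?thesis using c by (simp add: N_def c_def)
      qed
    qed
    fix g h assume g: "g \<in> carrier \<Gamma>" and h: "h \<in> N"
    define g' where "g' = inv\<^bsub>\<Gamma>\<^esub> g"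
    have g': "g' \<in> carrier \<Gamma>" "g * g' = 1\<^sub>m n" using g r_inv[OF g] by (auto simp: g'_def)
    note cm = carrier_mat[OF g] carrier_mat[OF g'(1)]
    have hc: "h \<in> carrier \<Gamma>" "h \<in> carrier_mat n n" using h by (auto simp: N_def)
    have "mat_cong m (g * h * g') (g * s * g')" if "mat_cong m h s" "s \<in> carrier_mat n n" for s
      using that cm hc by (intro mat_cong_mult mat_cong_refl) auto
    from this[of "1\<^sub>m n"] this[of "- 1\<^sub>m n"] 
    have "mat_cong m (g * h * g') (1\<^sub>m n) \<or> mat_cong m (g * h * g') (- 1\<^sub>m n)"
      using h cm g' by (auto simp: N_def)
    then show "g \<otimes>\<^bsub>\<Gamma>\<^esub> h \<otimes>\<^bsub>\<Gamma>\<^esub> inv\<^bsub>\<Gamma>\<^esub> g \<in> N"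
      using m_closed[OF m_closed[OF g hc(1)] g'(1)] by (simp add: N_def g'_def)
  qed
  interpret N: normal N \<Gamma> by (rule N)
  define H where "H = \<Gamma> Mod N"
  have H: "group H" unfolding H_def by (rule N.factorgroup_is_group)
  have carrH: "carrier H = (\<lambda>B. N #>\<^bsub>\<Gamma>\<^esub> B) ` carrier \<Gamma>" by (auto simp: H_def FactGroup_def RCOSETS_def)
  have coset_eq: "N #>\<^bsub>\<Gamma>\<^esub> B = N #>\<^bsub>\<Gamma>\<^esub> C" if BC: "B \<in> carrier \<Gamma>" "C \<in> carrier \<Gamma>" "mat_cong m B C \<or> mat_cong m B (- C)" for B C
  proof -
    define C' where "C' = inv\<^bsub>\<Gamma>\<^esub> C"
    have C': "C' \<in> carrier \<Gamma>" "C * C' = 1\<^sub>m n" "C' * C = 1\<^sub>m n" using BC r_inv[of C] l_inv[of C] by (auto simp: C'_def)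
    note cm = carrier_mat[OF BC(1)] carrier_mat[OF BC(2)] carrier_mat[OF C'(1)]
    have "mat_cong m (B * C') (C * C') \<or> mat_cong m (B * C') (- C * C')"
      using BC(3) cm mat_cong_mult[of B n C C' C' m] mat_cong_mult[of B n "- C" C' C' m] mat_cong_refl[of m C'] by auto
    moreover have "- C * C' = - 1\<^sub>m n" using cm C'(2) by simp
    ultimately have "B * C' \<in> N" using C'(2) m_closed[OF BC(1) C'(1)] unfolding N_def by simp
    moreover have "(B * C') * C = B" using C' cm sq_assoc[OF cm(1,3,2)] by simp
    ultimately have "B \<in> N #>\<^bsub>\<Gamma>\<^esub> C" unfolding r_coset_def mult_eq by (auto intro!: bexI[of _ "B * C'"])
    then show ?thesis using repr_independence[OF _ BC(2) N.is_subgroup] by simp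
  qed
  have finH: "finite (carrier H)"
  proof -
    \<comment> \<open>Reduction modulo m takes finitely many values, and matrices with equal
      reductions lie in the same coset of \<open>N\<close>.\<close>
    define red where "red B = map_mat (\<lambda>a. a mod m) B" for B :: "int mat"
    have "red ` carrier \<Gamma> \<subseteq> {A \<in> carrier_mat n n. \<forall>i<n. \<forall>j<n. A $$ (i, j) \<in> {0..<m}}"
      using m0 by (auto simp: red_def dest!: carrier_mat)
    then have finr: "finite (red ` carrier \<Gamma>)" by (rule finite_subset) (rule finite_bounded_mats, simp)
    have "mat_cong m B C" if "B \<in> carrier \<Gamma>" "C \<in> carrier \<Gamma>" "red B = red C" for B C
    proof -
      have "B $$ (i, j) mod m = C $$ (i, j) mod m" if ij: "i < n" "j < n" for i j
        using arg_cong[OF \<open>red B = red C\<close>, of "\<lambda>M. M $$ (i, j)"] ij carrier_mat[OF \<open>B \<in> carrier \<Gamma>\<close>] carrier_mat[OF \<open>C \<in> carrier \<Gamma>\<close>]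
        by (simp add: red_def)
      then show ?thesis using carrier_mat[OF \<open>B \<in> carrier \<Gamma>\<close>] by (auto simp: mat_cong_def mod_eq_dvd_iff)
    qed
    then have "N #>\<^bsub>\<Gamma>\<^esub> B = N #>\<^bsub>\<Gamma>\<^esub> inv_into (carrier \<Gamma>) red (red B)" if "B \<in> carrier \<Gamma>" for B
      using that coset_eq[OF that, of "inv_into (carrier \<Gamma>) red (red B)"]
      by (metis f_inv_into_f imageI inv_into_into)
    then have "carrier H \<subseteq> (\<lambda>R. N #>\<^bsub>\<Gamma>\<^esub> inv_into (carrier \<Gamma>) red R) ` red ` carrier \<Gamma>"
      unfolding carrH image_image by (intro subsetI) (metis (no_types, lifting) imageE imageI)
    then show ?thesis using finr by (meson finite_imageI finite_subset)
  qed
  have "centre \<subseteq> N"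
  proof
    fix B assume "B \<in> centre"
    then have "B \<in> carrier \<Gamma>" "B = 1\<^sub>m n \<or> B = - 1\<^sub>m n" by (simp_all add: centre_iff)
    then show "B \<in> N" unfolding N_def using mat_cong_refl[of m B] by fastforce
  qed
  then obtain \<alpha> where "\<alpha> \<in> hom PG H" and \<alpha>: "\<And>B. B \<in> carrier \<Gamma> \<Longrightarrow> \<alpha> (proj B) = N #>\<^bsub>\<Gamma>\<^esub> B"
    unfolding H_def using quotient_hom[OF N] by blast
  have "\<alpha> x \<noteq> \<one>\<^bsub>H\<^esub>"
  proof
    assume "\<alpha> x = \<one>\<^bsub>H\<^esub>"
    then have "N #>\<^bsub>\<Gamma>\<^esub> A = N" using A by (simp add: \<alpha> H_def FactGroup_def)
    then have "A \<in> N" using rcos_self[OF A(1) N.is_subgroup] by simp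
    then show False using far unfolding N_def by blast
  qed
  then show ?thesis using H finH \<open>\<alpha> \<in> hom PG H\<close> by blast
qed

lemma R_infinity_PG:
  assumes "\<And>\<phi>. \<phi> \<in> iso PG PG \<Longrightarrow>
    \<exists>g\<in>carrier PG. \<exists>e\<in>carrier PG. g \<otimes>\<^bsub>PG\<^esub> \<phi> e \<otimes>\<^bsub>PG\<^esub> inv\<^bsub>PG\<^esub> g = e \<and> (\<forall>k>0. e [^]\<^bsub>PG\<^esub> (k::nat) \<noteq> \<one>\<^bsub>PG\<^esub>)"
  shows "R_infinity_property PG" "R_infinity_property \<Gamma>"
proof -
  show R: "R_infinity_property PG"
    unfolding R_infinity_property_def reidemeister_number_eq_infinity_iff
  proof
    fix \<phi> assume \<phi>: "\<phi> \<in> iso PG PG"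
    obtain g e where ge: "g \<in> carrier PG" "e \<in> carrier PG" "g \<otimes>\<^bsub>PG\<^esub> \<phi> e \<otimes>\<^bsub>PG\<^esub> inv\<^bsub>PG\<^esub> g = e"
      "\<And>k::nat. k > 0 \<Longrightarrow> e [^]\<^bsub>PG\<^esub> k \<noteq> \<one>\<^bsub>PG\<^esub>" using assms[OF \<phi>] by blast
    obtain S where S: "finite S" "S \<subseteq> carrier PG" "carrier PG = generate PG S" using PG_finitely_generated by blast
    show "infinite (twisted_conjugacy_classes PG \<phi>)"
    proof (rule infinite_classes_criterion[where S = S and g = g and e = e])
      show "\<phi> \<in> hom PG PG" using \<phi> by (simp add: iso_def)
    qed (assumption | rule PG.is_group S ge PG_residually_finite)+
  qed
  then show "R_infinity_property \<Gamma>"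
    unfolding PG_def centre_def by (rule R_infinity_property_if_central_quotient[OF is_group])
qed

end

section \<open>Quasi-unipotent operators\<close>

definition diff_op :: "('a::ab_group_add \<Rightarrow> 'a) \<Rightarrow> nat \<Rightarrow> 'a \<Rightarrow> 'a" where
  "diff_op z j v = (z ^^ j) v - v"

text \<open>The product of all z^j - 1 with 1 \<le> j \<le> d, applied to v. It is the factor that
  Vandermonde elimination leaves in front of the term of index 0.\<close>

fun diff_ops :: "('a::ab_group_add \<Rightarrow> 'a) \<Rightarrow> nat \<Rightarrow> 'a \<Rightarrow> 'a" where
  "diff_ops z 0 v = v"
| "diff_ops z (Suc d) v = diff_ops z d (diff_op z (Suc d) v)"

lemma additive_funpow: "additive z \<Longrightarrow> additive (z ^^ k)" for z :: "'a::ab_group_add \<Rightarrow> 'a"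
  by (induction k) (auto simp: additive_def)

lemma funpow_funpow_commute: "(z ^^ a) ((z ^^ b) v) = (z ^^ b) ((z ^^ a) v)"
  by (metis add.commute comp_apply funpow_add)

lemma additive_diff_op: "additive z \<Longrightarrow> additive (diff_op z j)"
  using additive_funpow[of z j] by (simp add: additive_def diff_op_def)

text \<open>A Vandermonde elimination: the sum vanishes for every \<open>k\<close>, and the nodes are the powers of \<open>z\<close>.\<close>

lemma diff_ops_eq_0:
  fixes z :: "'a::ab_group_add \<Rightarrow> 'a"
  assumes z: "additive z" and S: "\<And>k. (\<Sum>j\<le>d. (z ^^ (k * j)) (y j)) = 0"
  shows "diff_ops z d (y 0) = 0"
  using S
proof (induction d arbitrary: y)
  case 0
  show ?case using 0[of 0] by simp
next
  case (Suc d)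
  \<comment> \<open>z^(d+1) times the relation for k, minus the relation for k + 1: the term of
    index d + 1 drops out, and the term of index 0 acquires the factor z^(d+1) - 1.\<close>
  define y' where "y' j = (z ^^ Suc d) (y j) - (z ^^ j) (y j)" for j
  have "(\<Sum>j\<le>d. (z ^^ (k * j)) (y' j)) = 0" for k
  proof -
    interpret p: additive "z ^^ Suc d" using z by (rule additive_funpow)
    have "(z ^^ (k * j)) (y' j) = (z ^^ Suc d) ((z ^^ (k * j)) (y j)) - (z ^^ (Suc k * j)) (y j)" for j
    proof -
      interpret q: additive "z ^^ (k * j)" using z by (rule additive_funpow)
      have "(z ^^ (Suc k * j)) (y j) = (z ^^ (k * j)) ((z ^^ j) (y j))"
        by (metis add.commute comp_apply funpow_add mult_Suc)
      then show ?thesis unfolding y'_def q.diff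
        using funpow_funpow_commute[where z = z and a = "k * j" and b = "Suc d"] by metis
    qed
    then have "(\<Sum>j\<le>Suc d. (z ^^ (k * j)) (y' j)) =
      (z ^^ Suc d) (\<Sum>j\<le>Suc d. (z ^^ (k * j)) (y j)) - (\<Sum>j\<le>Suc d. (z ^^ (Suc k * j)) (y j))"
      by (simp only: sum_subtractf p.sum)
    also have "\<dots> = 0" unfolding Suc.prems p.zero by simp
    finally have "(\<Sum>j\<le>Suc d. (z ^^ (k * j)) (y' j)) = 0" .
    moreover have "(z ^^ (k * Suc d)) (y' (Suc d)) = 0"
      using additive.zero[OF additive_funpow[OF z]] by (simp only: y'_def diff_self)
    ultimately show ?thesis by simp
  qed
  from Suc.IH[OF this] show ?case by (simp add: y'_def diff_op_def)
qed

text \<open>Geometric series: z^(jq) - 1 = (1 + z^j + ... + z^(j(q-1))) (z^j - 1).\<close>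

lemma diff_op_multiple:
  fixes z :: "'a::ab_group_add \<Rightarrow> 'a"
  assumes z: "additive z"
  shows "diff_op z (j * q) v = (\<Sum>t<q. (z ^^ (j * t)) (diff_op z j v))"
proof (induction q)
  case 0
  then show ?case by (simp add: diff_op_def)
next
  case (Suc q)
  interpret q: additive "z ^^ (j * q)" using z by (rule additive_funpow)
  have "(z ^^ (j * Suc q)) v = (z ^^ (j * q)) ((z ^^ j) v)"
    by (metis add.commute comp_apply funpow_add mult_Suc_right)
  then show ?case using Suc by (simp add: diff_op_def q.diff algebra_simps)
qed

text \<open>Each z^j - 1 with 1 \<le> j \<le> d divides z^m - 1, so the d-th power of z^m - 1 is a
  multiple of the product in \<open>diff_ops\<close>.\<close>

lemma diff_op_nilpotent:
  fixes z :: "'a::ab_group_add \<Rightarrow> 'a"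
  assumes z: "additive z" and dvd: "\<And>j. 1 \<le> j \<Longrightarrow> j \<le> d \<Longrightarrow> j dvd m" and "diff_ops z d v = 0"
  shows "(diff_op z m ^^ d) v = 0"
  using dvd assms(3)
proof (induction d arbitrary: v)
  case (Suc d)
  obtain q where q: "m = Suc d * q" using Suc.prems(1)[of "Suc d"] by auto
  have com: "(diff_op z m ^^ k) ((z ^^ a) u) = (z ^^ a) ((diff_op z m ^^ k) u)" for k a u
  proof (induction k)
    case (Suc k)
    interpret a: additive "z ^^ a" using z by (rule additive_funpow)
    have "diff_op z m ((z ^^ a) w) = (z ^^ a) (diff_op z m w)" for w
      by (simp only: diff_op_def a.diff funpow_funpow_commute[where a = m])
    then show ?case using Suc by simp
  qed simp
  have add: "additive (diff_op z m ^^ d)" by (intro additive_funpow additive_diff_op z)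
  have IH: "(diff_op z m ^^ d) (diff_op z (Suc d) v) = 0" using Suc by simp
  have "(diff_op z m ^^ Suc d) v = (diff_op z m ^^ d) (diff_op z m v)" by (simp only: funpow_Suc_right comp_apply)
  also have "\<dots> = (\<Sum>t<q. (diff_op z m ^^ d) ((z ^^ (Suc d * t)) (diff_op z (Suc d) v)))"
    unfolding q diff_op_multiple[OF z, of "Suc d" q v] additive.sum[OF add, symmetric, unfolded q] ..
  also have "\<dots> = 0" unfolding com IH additive.zero[OF additive_funpow[OF z]] by simp
  finally show ?case .
qed simp

text \<open>The last iterate of w - 1 on v that is still outside Z is such a u. It stays in F
  because F is closed under subtraction and under w.\<close>

lemma kolchin_step:
  fixes w :: "'a::ab_group_add \<Rightarrow> 'a"
  assumes F: "\<And>u v. u \<in> F \<Longrightarrow> v \<in> F \<Longrightarrow> u - v \<in> F" "\<And>u. u \<in> F \<Longrightarrow> w u \<in> F"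
    and v: "v \<in> F" "v \<notin> Z" and nil: "(diff_op w 1 ^^ k) v \<in> Z"
  shows "\<exists>u\<in>F. u \<notin> Z \<and> w u - u \<in> Z"
proof -
  define k0 where "k0 = (LEAST k. (diff_op w 1 ^^ k) v \<in> Z)"
  have k0: "(diff_op w 1 ^^ k0) v \<in> Z" unfolding k0_def using nil by (rule LeastI)
  then obtain k1 where k1: "k0 = Suc k1" using v by (cases k0) auto
  define u where "u = (diff_op w 1 ^^ k1) v"
  have "(diff_op w 1 ^^ j) v \<in> F" for j by (induction j) (auto simp: v F diff_op_def)
  then have "u \<in> F" by (simp add: u_def)
  moreover have "u \<notin> Z" using not_less_Least[of k1 "\<lambda>k. (diff_op w 1 ^^ k) v \<in> Z"] k1 by (simp add: u_def k0_def)
  moreover have "w u - u \<in> Z" using k0 unfolding k1 u_def by (simp add: diff_op_def)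
  ultimately show ?thesis by blast
qed

section \<open>Integer matrices acting on vectors\<close>

text \<open>Coordinates beyond the dimension are left alone, so that products and the identity
  matrix act functorially on all functions. These form an abelian group, to which the results on
  additive maps apply; \<open>vecs\<close> singles out the actual vectors.\<close>

definition mat_op :: "int mat \<Rightarrow> (nat \<Rightarrow> int) \<Rightarrow> nat \<Rightarrow> int" where
  "mat_op A v = (\<lambda>i. if i < dim_row A then \<Sum>l<dim_col A. A $$ (i, l) * v l else v i)"

definition vecs :: "nat \<Rightarrow> (nat \<Rightarrow> int) set" where
  "vecs n = {v. \<forall>i\<ge>n. v i = 0}"

abbreviation scal :: "int \<Rightarrow> (nat \<Rightarrow> int) \<Rightarrow> nat \<Rightarrow> int" where
  "scal c v \<equiv> (\<lambda>i. c * v i)"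

lemma additive_mat_op: "additive (mat_op A)"
  by (auto simp: additive_def mat_op_def fun_eq_iff algebra_simps sum.distrib)

lemma mat_op_mult:
  assumes "A \<in> carrier_mat n n" "B \<in> carrier_mat n n"
  shows "mat_op (A * B) v = mat_op A (mat_op B v)"
proof
  fix i
  show "mat_op (A * B) v i = mat_op A (mat_op B v) i"
  proof (cases "i < n")
    case True
    have "mat_op (A * B) v i = (\<Sum>l<n. (\<Sum>k<n. A $$ (i, k) * B $$ (k, l)) * v l)"
      using assms True by (simp add: mat_op_def index_mult_mat_sum[of _ n n _ n])
    also have "\<dots> = (\<Sum>l<n. \<Sum>k<n. A $$ (i, k) * (B $$ (k, l) * v l))"
      by (simp add: sum_distrib_right mult.assoc)
    also have "\<dots> = (\<Sum>k<n. A $$ (i, k) * (\<Sum>l<n. B $$ (k, l) * v l))"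
      by (subst sum.swap) (simp add: sum_distrib_left)
    also have "\<dots> = mat_op A (mat_op B v) i"
      using assms True by (simp add: mat_op_def)
    finally show ?thesis .
  qed (use assms in \<open>auto simp: mat_op_def\<close>)
qed

lemma mat_op_one [simp]: "mat_op (1\<^sub>m n) v = v"
proof
  fix i
  have "(\<Sum>l<n. (1\<^sub>m n :: int mat) $$ (i, l) * v l) = v i" if "i < n"
    using that by (subst sum.remove[of _ i]) (auto intro!: sum.neutral)
  then show "mat_op (1\<^sub>m n) v i = v i" by (simp add: mat_op_def)
qed

lemma mat_op_scal: "mat_op A (scal c v) = scal c (mat_op A v)"
  by (auto simp: mat_op_def sum_distrib_left algebra_simps)

lemma mat_op_funpow_scal: "(mat_op A ^^ k) (scal c v) = scal c ((mat_op A ^^ k) v)"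
  by (induction k) (simp_all add: mat_op_scal)

lemma mat_op_vecs: "A \<in> carrier_mat n n \<Longrightarrow> v \<in> vecs n \<Longrightarrow> mat_op A v \<in> vecs n"
  by (auto simp: vecs_def mat_op_def)

lemma mat_op_funpow_vecs: "A \<in> carrier_mat n n \<Longrightarrow> v \<in> vecs n \<Longrightarrow> (mat_op A ^^ k) v \<in> vecs n"
  by (induction k) (auto simp: mat_op_vecs)

lemma mat_op_pow_mat:
  assumes "A \<in> carrier_mat n n" shows "mat_op (A ^\<^sub>m k) v = (mat_op A ^^ k) v"
proof (induction k arbitrary: v)
  case (Suc k)
  have "mat_op (A ^\<^sub>m Suc k) v = mat_op (A ^\<^sub>m k) (mat_op A v)"
    using assms by (simp add: mat_op_mult[of _ n] pow_carrier_mat)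
  then show ?case by (simp only: Suc funpow_Suc_right comp_apply)
qed (use assms in simp)

text \<open>The n^2 + 1 powers of Y lie in a space of dimension n^2, and a kernel vector of a
  singular integer matrix provides an integral dependence.\<close>

lemma annihilating_combination:
  assumes Y: "Y \<in> carrier_mat n n"
  shows "\<exists>c :: nat \<Rightarrow> int. (\<exists>j\<le>n * n. c j \<noteq> 0) \<and>
    (\<forall>v\<in>vecs n. (\<Sum>j\<le>n * n. scal (c j) ((mat_op Y ^^ j) v)) = 0)"
proof -
  define d where "d = n * n"
  \<comment> \<open>Column j lists the entries of Y^j row by row; the last row is zero, which makes
    the matrix square and singular.\<close>
  define M where "M = mat (Suc d) (Suc d) (\<lambda>(r, j). if r < d then (Y ^\<^sub>m j) $$ (r div n, r mod n) else 0)"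
  have M: "M \<in> carrier_mat (Suc d) (Suc d)" by (simp add: M_def)
  have "transpose_mat M *\<^sub>v unit_vec (Suc d) d = 0\<^sub>v (Suc d)"
    using M by (intro eq_vecI) (auto simp: M_def)
  moreover have "unit_vec (Suc d) d \<noteq> (0\<^sub>v (Suc d) :: int vec)" by simp
  ultimately have "det (transpose_mat M) = 0"
    using det_0_iff_vec_prod_zero[of "transpose_mat M" "Suc d"] M by (metis transpose_carrier_mat unit_vec_carrier)
  then have "det M = 0" using det_transpose[OF M] by simp
  then obtain w where w: "w \<in> carrier_vec (Suc d)" "w \<noteq> 0\<^sub>v (Suc d)" "M *\<^sub>v w = 0\<^sub>v (Suc d)"
    using det_0_iff_vec_prod_zero[OF M] by blast
  define c where "c j = w $ j" for j
  have "\<exists>j\<le>d. c j \<noteq> 0"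
  proof (rule ccontr)
    assume "\<not> ?thesis"
    then have "w = 0\<^sub>v (Suc d)" using w(1) by (intro eq_vecI) (auto simp: c_def)
    then show False using w by simp
  qed
  moreover have "(\<Sum>j\<le>d. scal (c j) ((mat_op Y ^^ j) v)) = 0" if v: "v \<in> vecs n" for v
  proof
    fix i
    have ap: "(\<Sum>j\<le>d. scal (c j) ((mat_op Y ^^ j) v)) i = (\<Sum>j\<le>d. c j * (mat_op Y ^^ j) v i)"
      by (induction d) auto
    show "(\<Sum>j\<le>d. scal (c j) ((mat_op Y ^^ j) v)) i = 0 i"
    proof (cases "i < n")
      case True
      have ent: "(\<Sum>j\<le>d. c j * (Y ^\<^sub>m j) $$ (i, l)) = 0" if l: "l < n" for l
      proof -
        define r where "r = i * n + l"
        have "i * n + l < n * n" using True l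
          by (metis add_strict_left_mono less_le_trans mult_Suc add.commute mult_le_mono1 Suc_leI)
        then have r: "r < d" "r div n = i" "r mod n = l" using l by (auto simp: r_def d_def)
        have "(M *\<^sub>v w) $ r = (\<Sum>j<Suc d. M $$ (r, j) * w $ j)"
          using M w(1) r by (auto simp: scalar_prod_def atLeast0LessThan intro!: sum.cong)
        also have "\<dots> = (\<Sum>j<Suc d. c j * (Y ^\<^sub>m j) $$ (i, l))"
          using r by (intro sum.cong) (auto simp: M_def c_def)
        finally show ?thesis using w(3) r by (simp add: lessThan_Suc_atMost)
      qed
      have "(\<Sum>j\<le>d. c j * (mat_op Y ^^ j) v i) = (\<Sum>j\<le>d. c j * (\<Sum>l<n. (Y ^\<^sub>m j) $$ (i, l) * v l))"
        using True Y by (intro sum.cong refl) (simp add: mat_op_pow_mat[OF Y, symmetric] mat_op_def pow_mat_dim_square)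
      also have "\<dots> = (\<Sum>l<n. (\<Sum>j\<le>d. c j * (Y ^\<^sub>m j) $$ (i, l)) * v l)"
        by (simp add: sum_distrib_left sum_distrib_right mult.assoc) (rule sum.swap)
      also have "\<dots> = 0" by (intro sum.neutral) (simp add: ent)
      finally show ?thesis by (simp add: ap)
    next
      case False
      then have "(mat_op Y ^^ j) v i = 0" for j using mat_op_funpow_vecs[OF Y v, of j] by (simp add: vecs_def)
      then show ?thesis by (simp add: ap)
    qed
  qed
  ultimately show ?thesis unfolding d_def by blast
qed

text \<open>Conjugating an annihilating polynomial of \<open>Y\<close> by powers of \<open>R\<close> shows that \<open>\<Sum>\<^sub>j c\<^sub>j \<zeta>\<^bsup>kj\<^esup> Y\<^bsup>j\<^esup>\<close> vanishes
  for every \<open>k\<close>. Eliminating all powers of \<open>Y\<close> but the lowest leaves a product of factors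
  \<open>\<zeta>\<^bsup>j\<^esup> - 1\<close>: the commutator \<open>\<zeta>\<close> is quasi-unipotent.\<close>

lemma heisenberg_unipotent:
  assumes R: "R \<in> carrier (GL_int n)" and Y: "Y \<in> carrier (GL_int n)" and Z: "Z \<in> carrier (GL_int n)"
    and rel: "R * Y = Z * (Y * R)" and comm: "Z * R = R * Z" "Z * Y = Y * Z"
    and m: "\<And>j. 1 \<le> j \<Longrightarrow> j \<le> n * n \<Longrightarrow> j dvd m" and v: "v \<in> vecs n"
  shows "(diff_op (mat_op Z) m ^^ (n * n)) v = 0"
proof -
  have carr: "R \<in> carrier_mat n n" "Y \<in> carrier_mat n n" "Z \<in> carrier_mat n n"
    using R Y Z by (auto simp: GL_int_iff_det)
  let ?x = "mat_op R" and ?y = "mat_op Y" and ?z = "mat_op Z"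
  have xy: "?x (?y u) = ?z (?y (?x u))" for u
    using arg_cong[OF rel, of "\<lambda>M. mat_op M u"] carr by (simp add: mat_op_mult[of _ n])
  have zx: "?z (?x u) = ?x (?z u)" for u
    using arg_cong[OF comm(1), of "\<lambda>M. mat_op M u"] carr by (simp add: mat_op_mult[of _ n])
  have zy: "?z (?y u) = ?y (?z u)" for u
    using arg_cong[OF comm(2), of "\<lambda>M. mat_op M u"] carr by (simp add: mat_op_mult[of _ n])
  have zky: "(?z ^^ k) (?y u) = ?y ((?z ^^ k) u)" for k u by (induction k) (simp_all add: zy)
  have zkx: "(?z ^^ k) (?x u) = ?x ((?z ^^ k) u)" for k u by (induction k) (simp_all add: zx)
  have xyj: "?x ((?y ^^ j) u) = (?z ^^ j) ((?y ^^ j) (?x u))" for j u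
    by (induction j) (simp_all add: xy zky)
  \<comment> \<open>The Heisenberg relation x^k y^j = z^(kj) y^j x^k.\<close>
  have xkyj: "(?x ^^ k) ((?y ^^ j) u) = (?z ^^ (k * j)) ((?y ^^ j) ((?x ^^ k) u))" for k j u
  proof (induction k)
    case (Suc k)
    have "?x ((?z ^^ (k * j)) w) = (?z ^^ (k * j)) (?x w)" for w using zkx by simp
    then have "(?x ^^ Suc k) ((?y ^^ j) u) = (?z ^^ (k * j)) ((?z ^^ j) ((?y ^^ j) (?x ((?x ^^ k) u))))"
      using Suc by (simp add: xyj)
    also have "\<dots> = (?z ^^ (Suc k * j)) ((?y ^^ j) ((?x ^^ Suc k) u))"
      by (simp add: funpow_add add.commute[of j])
    finally show ?case .
  qed simp
  have inv: "\<exists>w\<in>vecs n. (mat_op A ^^ k) w = u" if A: "A \<in> carrier (GL_int n)" and u: "u \<in> vecs n" for A k u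
  proof (induction k)
    case (Suc k)
    then obtain w where w: "w \<in> vecs n" "(mat_op A ^^ k) w = u" by blast
    obtain B where B: "B \<in> carrier_mat n n" "A * B = 1\<^sub>m n" "A \<in> carrier_mat n n" using A by (auto simp: carrier_GL_int)
    have "mat_op A (mat_op B w) = w" using B mat_op_mult[OF B(3,1), of w] by simp
    then have "(mat_op A ^^ Suc k) (mat_op B w) = u" using w by (simp only: funpow_Suc_right comp_apply)
    then show ?case using mat_op_vecs[OF B(1) w(1)] by blast
  qed (use u in auto)
  obtain c where c: "\<exists>j\<le>n * n. c j \<noteq> 0"
    and sum0: "\<And>u. u \<in> vecs n \<Longrightarrow> (\<Sum>j\<le>n * n. scal (c j) ((?y ^^ j) u)) = 0"
    using annihilating_combination[OF carr(2)] by blast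
  \<comment> \<open>The lowest power of Y that occurs. As Y is invertible it can be divided out,
    which leaves a relation with nonzero constant coefficient.\<close>
  define t where "t = (LEAST j. c j \<noteq> 0)"
  have t: "c t \<noteq> 0" "t \<le> n * n" unfolding t_def using c by (metis (mono_tags) LeastI, metis (mono_tags) Least_le le_trans)
  have tz: "c j = 0" if "j < t" for j using not_less_Least[of j "\<lambda>j. c j \<noteq> 0"] that by (auto simp: t_def)
  define d where "d = n * n - t"
  have sum1: "(\<Sum>j\<le>d. scal (c (j + t)) ((?y ^^ j) u)) = 0" if u: "u \<in> vecs n" for u
  proof -
    obtain w where w: "w \<in> vecs n" "(?y ^^ t) w = u" using inv[OF Y u] by blast
    have "(\<Sum>j\<le>n * n. scal (c j) ((?y ^^ j) w)) = (\<Sum>j\<in>{t..n * n}. scal (c j) ((?y ^^ j) w))"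
      by (intro sum.mono_neutral_right) (auto simp: tz fun_eq_iff)
    also have "\<dots> = (\<Sum>j\<le>d. scal (c (j + t)) ((?y ^^ (j + t)) w))"
      using t(2) by (intro sum.reindex_bij_witness[of _ "\<lambda>j. j + t" "\<lambda>j. j - t"]) (auto simp: d_def)
    also have "\<dots> = (\<Sum>j\<le>d. scal (c (j + t)) ((?y ^^ j) u))"
      using w(2) by (simp add: funpow_add)
    finally show ?thesis using sum0[OF w(1)] by simp
  qed
  have "(\<Sum>j\<le>d. (?z ^^ (k * j)) (scal (c (j + t)) ((?y ^^ j) v))) = 0" for k
  proof -
    \<comment> \<open>The relation is taken at w with R^k w = v. Applying R^k to it and moving R^k
      past Y^j multiplies the term of index j by z^(kj).\<close>
    obtain w where w: "w \<in> vecs n" "(?x ^^ k) w = v" using inv[OF R v] by blast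
    have "(?z ^^ (k * j)) (scal (c (j + t)) ((?y ^^ j) v)) = (?x ^^ k) (scal (c (j + t)) ((?y ^^ j) w))" for j
      using xkyj[of k j w] w by (simp add: mat_op_funpow_scal)
    then have "(\<Sum>j\<le>d. (?z ^^ (k * j)) (scal (c (j + t)) ((?y ^^ j) v))) = (?x ^^ k) (\<Sum>j\<le>d. scal (c (j + t)) ((?y ^^ j) w))"
      by (simp add: additive.sum[OF additive_funpow[OF additive_mat_op]])
    then show ?thesis using sum1[OF w(1)] additive.zero[OF additive_funpow[OF additive_mat_op]] by simp
  qed
  from diff_ops_eq_0[OF additive_mat_op this]
  have "diff_ops ?z d (scal (c t) v) = 0" by simp
  moreover have "diff_op ?z j (scal a u) = scal a (diff_op ?z j u)" for a u j
    by (rule ext) (simp add: diff_op_def mat_op_funpow_scal right_diff_distrib del: funpow.simps)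
  then have "diff_ops ?z d (scal a u) = scal a (diff_ops ?z d u)" for a u d
    by (induction d arbitrary: u) simp_all
  \<comment> \<open>The operator commutes with scalars, so the nonzero integer \<open>c t\<close>
    cancels coordinatewise.\<close>
  ultimately have "diff_ops ?z d v = 0" using t(1) by (auto simp: fun_eq_iff)
  then have nil: "(diff_op ?z m ^^ d) v = 0"
    using m by (intro diff_op_nilpotent additive_mat_op) (auto simp: d_def)
  \<comment> \<open>Another t applications give an exponent that depends only on n and not on the
    relation found.\<close>
  have "(diff_op ?z m ^^ (n * n)) v = (diff_op ?z m ^^ t) ((diff_op ?z m ^^ d) v)"
    using t(2) by (simp add: d_def flip: funpow_add[THEN fun_cong, unfolded comp_apply])
  also have "\<dots> = 0" unfolding nil 
    by (rule additive.zero[OF additive_funpow[OF additive_diff_op[OF additive_mat_op]]])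
  finally show ?thesis .
qed

section \<open>Simultaneous triangularisation over the integers\<close>

lemma diff_op_one: "diff_op z 1 v = z v - v"
  by (simp add: diff_op_def)

text \<open>Kolchin's fixed vector argument with one generator at a time, in an order in which each
  new operator preserves the vectors fixed modulo Z by those already treated. Z is the part of the
  invariant flag constructed so far.\<close>

lemma kolchin_common_vector:
  fixes w :: "nat \<Rightarrow> nat \<Rightarrow> 'a::ab_group_add \<Rightarrow> 'a"
  assumes add: "\<And>i j. i < j \<Longrightarrow> j < n \<Longrightarrow> additive (w i j)"
    and V: "\<And>u v. u \<in> V \<Longrightarrow> v \<in> V \<Longrightarrow> u - v \<in> V" "\<And>i j u. i < j \<Longrightarrow> j < n \<Longrightarrow> u \<in> V \<Longrightarrow> w i j u \<in> V"
    and Z: "\<And>u v. u \<in> Z \<Longrightarrow> v \<in> Z \<Longrightarrow> u - v \<in> Z" "\<And>i j u. i < j \<Longrightarrow> j < n \<Longrightarrow> u \<in> Z \<Longrightarrow> w i j u \<in> Z"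
    and comm: "\<And>i j k l u. i < j \<Longrightarrow> j < n \<Longrightarrow> k < l \<Longrightarrow> l < n \<Longrightarrow> j \<noteq> k \<Longrightarrow> i \<noteq> l \<Longrightarrow> w i j (w k l u) = w k l (w i j u)"
    and rel: "\<And>i j l u. i < j \<Longrightarrow> j < l \<Longrightarrow> l < n \<Longrightarrow> w i j (w j l u) = (w i l ^^ N) (w j l (w i j u))"
    and nil: "\<And>i j v. i < j \<Longrightarrow> j < n \<Longrightarrow> v \<in> V \<Longrightarrow> \<exists>k. (diff_op (w i j) 1 ^^ k) v \<in> Z"
    and v0: "v0 \<in> V" "v0 \<notin> Z"
  shows "\<exists>v\<in>V. v \<notin> Z \<and> (\<forall>i j. i < j \<longrightarrow> j < n \<longrightarrow> w i j v - v \<in> Z)"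
proof -
  have Z0: "0 \<in> Z" if "u \<in> Z" for u using Z(1)[OF that that] by simp
  have Zadd: "u + v \<in> Z" if "u \<in> Z" "v \<in> Z" for u v
    using Z(1)[OF that(1) Z(1)[OF Z0[OF that(2)] that(2)]] by simp
  have Zsym: "v - u \<in> Z" if "u - v \<in> Z" for u v
    using Z(1)[OF Z0[OF that] that] by simp
  have Ztrans: "u - x \<in> Z" if "u - v \<in> Z" "v - x \<in> Z" for u v x
    using Zadd[OF that] by simp
  have wZ: "w i j u - w i j v \<in> Z" if "i < j" "j < n" "u - v \<in> Z" for i j u v
    using Z(2)[OF that] additive.diff[OF add[OF that(1,2)], of u v] by simp
  define F where "F B = {v \<in> V. \<forall>(k, l)\<in>B. w k l v - v \<in> Z}" for B
  \<comment> \<open>The pairs treated before (i, j): columns are taken from the last one down, and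
    the rows of a column upwards. All pairs with second index above j come earlier.\<close>
  define B where "B j i = {(k, l). k < l \<and> l < n \<and> (j < l \<or> l = j \<and> k < i)}" for j i
  have step: "\<exists>v\<in>F (B j (Suc i)). v \<notin> Z" if ij: "i < j" "j < n" and ex: "\<exists>v\<in>F (B j i). v \<notin> Z" for i j
  proof -
    obtain v where v: "v \<in> F (B j i)" "v \<notin> Z" using ex by blast
    then have vV: "v \<in> V" by (simp add: F_def)
    have "\<exists>u\<in>F (B j i). u \<notin> Z \<and> w i j u - u \<in> Z"
    proof (rule kolchin_step)
      show "v \<in> F (B j i)" "v \<notin> Z" by fact+
      show "(diff_op (w i j) 1 ^^ (SOME k. (diff_op (w i j) 1 ^^ k) v \<in> Z)) v \<in> Z"
        using nil[OF ij vV] by (rule someI_ex)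
      show "u - v \<in> F (B j i)" if uv: "u \<in> F (B j i)" "v \<in> F (B j i)" for u v
      proof -
        have "w k l (u - v) - (u - v) \<in> Z" if kl: "(k, l) \<in> B j i" for k l
        proof -
          have "w k l u - u \<in> Z" "w k l v - v \<in> Z" using uv kl by (auto simp: F_def)
          then have "(w k l u - u) - (w k l v - v) \<in> Z" by (rule Z(1))
          moreover have "w k l (u - v) = w k l u - w k l v"
            using kl by (intro additive.diff add) (auto simp: B_def)
          moreover from this have "w k l (u - v) - (u - v) = (w k l u - u) - (w k l v - v)" by simp
          ultimately show ?thesis by (simp only:)
        qed
        then show ?thesis using uv V(1) by (auto simp: F_def)
      qed
      show "w i j u \<in> F (B j i)" if u: "u \<in> F (B j i)" for u
      proof -
        have "w k l (w i j u) - w i j u \<in> Z" if kl: "(k, l) \<in> B j i" for k l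
        proof (cases "k = j")
          case False
          have kl': "k < l" "l < n" "i \<noteq> l" using kl ij by (auto simp: B_def)
          have "w k l u - u \<in> Z" using u kl by (auto simp: F_def)
          from wZ[OF ij this] show ?thesis using comm[OF ij kl'(1,2) _ kl'(3), of u] False by simp
        next
          case True
          then have kl': "j < l" "l < n" "i < l" using kl ij by (auto simp: B_def)
          \<comment> \<open>\<open>w i j\<close> and \<open>w j l\<close> commute up to a power of
            \<open>w i l\<close>. The pair (i, l) is already treated because l > j, so this power
            acts trivially modulo Z on the vectors concerned.\<close>
          have "(i, l) \<in> B j i" using kl' by (simp add: B_def)
          then have uil: "w i l u - u \<in> Z" and ujl: "w j l u - u \<in> Z" using u kl True by (auto simp: F_def)
          define x where "x = w i j u"
          have xil: "w i l x - x \<in> Z"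
            using wZ[OF ij uil] comm[OF ij kl'(3,2), of u] ij kl' by (simp add: x_def)
          have 1: "w i l (w j l x) - w j l x \<in> Z"
            using wZ[OF kl'(1,2) xil] comm[of i l j l x] kl' ij by simp
          have 2: "(w i l ^^ m) (w j l x) - w j l x \<in> Z" for m
          proof (induction m)
            case 0
            then show ?case using Z0[OF 1] by simp
          next
            case (Suc m)
            show ?case using Ztrans[OF wZ[OF kl'(3,2) Suc] 1] by simp
          qed
          have "w i j (w j l u) - x \<in> Z" using wZ[OF ij ujl] by (simp add: x_def)
          then have "(w i l ^^ N) (w j l x) - x \<in> Z" using rel[OF ij(1) kl'(1,2), of u] by (simp add: x_def)
          then have "w j l x - x \<in> Z" using Ztrans[OF Zsym[OF 2]] by blast
          then show ?thesis using True by (simp add: x_def)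
        qed
        then show ?thesis using u V(2)[OF ij] by (auto simp: F_def)
      qed
    qed
    then obtain u where u: "u \<in> F (B j i)" "u \<notin> Z" "w i j u - u \<in> Z" by blast
    have "(k, l) \<in> B j (Suc i) \<Longrightarrow> (k, l) \<in> B j i \<or> (k, l) = (i, j)" for k l
      by (auto simp: B_def less_Suc_eq)
    then have "u \<in> F (B j (Suc i))" using u by (fastforce simp: F_def)
    then show ?thesis using u by blast
  qed
  have row: "\<exists>v\<in>F (B j i). v \<notin> Z" if "\<exists>v\<in>F (B j 0). v \<notin> Z" "i \<le> j" "j < n" for i j
    using that(2) by (induction i) (use step that in auto)
  have all: "\<exists>v\<in>F {(k, l). k < l \<and> l < n \<and> n - t \<le> l}. v \<notin> Z" if "t \<le> n" for t
    using that
  proof (induction t)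
    case 0
    have "v0 \<in> F {(k, l). k < l \<and> l < n \<and> n - 0 \<le> l}" using v0 by (auto simp: F_def)
    then show ?case using v0 by blast
  next
    case (Suc t)
    have "{(k, l). k < l \<and> l < n \<and> n - t \<le> l} = B (n - Suc t) 0" using Suc.prems by (auto simp: B_def)
    moreover have "{(k, l). k < l \<and> l < n \<and> n - Suc t \<le> l} = B (n - Suc t) (n - Suc t)" by (auto simp: B_def)
    ultimately show ?case using row[of "n - Suc t" "n - Suc t"] Suc by simp
  qed
  show ?thesis using all[of n] by (auto simp: F_def)
qed

section \<open>Families with Steinberg relations and their invariant flags\<close>

text \<open>The relations between N-th powers of upper transvections: if \<open>w i j\<close> is
  e_ij^N, then the commutator of \<open>w i j\<close> and \<open>w j l\<close> is e_il^(N N), which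
  is the N-th power of \<open>w i l\<close>.\<close>

definition steinberg :: "nat \<Rightarrow> nat \<Rightarrow> (nat \<Rightarrow> nat \<Rightarrow> int mat) \<Rightarrow> bool" where
  "steinberg n N w \<longleftrightarrow>
    (\<forall>i j. i < j \<longrightarrow> j < n \<longrightarrow> w i j \<in> carrier (GL_int n)) \<and>
    (\<forall>i j k l. i < j \<longrightarrow> j < n \<longrightarrow> k < l \<longrightarrow> l < n \<longrightarrow> j \<noteq> k \<longrightarrow> i \<noteq> l \<longrightarrow> w i j * w k l = w k l * w i j) \<and>
    (\<forall>i j l. i < j \<longrightarrow> j < l \<longrightarrow> l < n \<longrightarrow> w i j * w j l = (w i l [^]\<^bsub>GL_int n\<^esub> N) * (w j l * w i j))"

definition unipotent :: "nat \<Rightarrow> int mat \<Rightarrow> bool" where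
  "unipotent n A \<longleftrightarrow> (\<forall>v\<in>vecs n. \<exists>k. (diff_op (mat_op A) 1 ^^ k) v = 0)"

lemma GL_carrier_mat: "A \<in> carrier (GL_int n) \<Longrightarrow> A \<in> carrier_mat n n"
  by (simp add: GL_int_iff_det)

lemma SL_GL: "A \<in> carrier (SL_int n) \<Longrightarrow> A \<in> carrier (GL_int n)"
  by (simp add: GL_int_iff_det carrier_SL_int)

lemma mat_op_nat_pow:
  assumes "A \<in> carrier (GL_int n)" shows "mat_op (A [^]\<^bsub>GL_int n\<^esub> (k::nat)) v = (mat_op A ^^ k) v"
proof -
  interpret group "GL_int n" by (rule group_GL_int)
  show ?thesis
  proof (induction k arbitrary: v)
    case (Suc k)
    have "A [^]\<^bsub>GL_int n\<^esub> k \<in> carrier (GL_int n)" using assms by simp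
    then have "mat_op (A [^]\<^bsub>GL_int n\<^esub> Suc k) v = mat_op (A [^]\<^bsub>GL_int n\<^esub> k) (mat_op A v)"
      using assms by (simp add: mat_op_mult[of _ n] GL_carrier_mat)
    then show ?case by (simp only: Suc funpow_Suc_right comp_apply)
  qed simp
qed

lemma (in group) conj_mult:
  assumes "p \<in> carrier G" "a \<in> carrier G" "b \<in> carrier G"
  shows "(p \<otimes> a \<otimes> inv p) \<otimes> (p \<otimes> b \<otimes> inv p) = p \<otimes> (a \<otimes> b) \<otimes> inv p"
proof -
  have "inv p \<otimes> (p \<otimes> z) = z" if "z \<in> carrier G" for z using assms that by (simp add: m_assoc[symmetric])
  then show ?thesis using assms by (simp add: m_assoc)
qed

lemma (in group) conj_pow:
  assumes "p \<in> carrier G" "a \<in> carrier G"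
  shows "(p \<otimes> a \<otimes> inv p) [^] (k::nat) = p \<otimes> (a [^] k) \<otimes> inv p"
  by (induction k) (use assms conj_mult in auto)

text \<open>Each of the a passages of x across y contributes one factor z^N, and these factors can
  be collected on the left because z commutes with x.\<close>

lemma (in group) heisenberg_pow:
  fixes a N :: nat
  assumes c: "x \<in> carrier G" "y \<in> carrier G" "z \<in> carrier G"
    and zx: "z \<otimes> x = x \<otimes> z" and zy: "z \<otimes> y = y \<otimes> z" and xy: "x \<otimes> y = (z [^] N) \<otimes> (y \<otimes> x)"
  shows "(x [^] a) \<otimes> y = (z [^] (N * a)) \<otimes> (y \<otimes> (x [^] a))"
proof (induction a)
  case (Suc a)
  have zxk: "x \<otimes> (z [^] k) = (z [^] k) \<otimes> x" for k :: nat
    by (induction k) (use c zx in \<open>simp_all add: m_assoc\<close>, metis m_assoc nat_pow_closed)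
  have "(x [^] Suc a) \<otimes> y = x \<otimes> ((x [^] a) \<otimes> y)"
    using c nat_pow_Suc2[OF c(1), of a] by (simp add: m_assoc)
  also have "\<dots> = (x \<otimes> (z [^] (N * a))) \<otimes> (y \<otimes> (x [^] a))" using Suc c by (simp add: m_assoc)
  also have "\<dots> = (z [^] (N * a)) \<otimes> ((x \<otimes> y) \<otimes> (x [^] a))" using c by (simp add: zxk m_assoc)
  also have "\<dots> = ((z [^] (N * a)) \<otimes> (z [^] N)) \<otimes> (y \<otimes> (x \<otimes> (x [^] a)))" using c xy by (simp add: m_assoc)
  also have "\<dots> = (z [^] (N * Suc a)) \<otimes> (y \<otimes> (x [^] Suc a))"
    using c nat_pow_Suc2[OF c(1), of a] by (simp add: nat_pow_mult add.commute)
  finally show ?case .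
qed (use c in simp)

lemma steinberg_conj:
  assumes P: "P \<in> carrier (GL_int n)" and w: "steinberg n N w"
  shows "steinberg n N (\<lambda>i j. P * w i j * inv\<^bsub>GL_int n\<^esub> P)"
proof -
  interpret group "GL_int n" by (rule group_GL_int)
  note cm = conj_mult[OF P, simplified] and cp = conj_pow[OF P, simplified]
  have wc: "w i j \<in> carrier (GL_int n)" if "i < j" "j < n" for i j
    using w that unfolding steinberg_def by blast
  have mc: "a * b \<in> carrier (GL_int n)" if "a \<in> carrier (GL_int n)" "b \<in> carrier (GL_int n)" for a b
    using m_closed[OF that] by simp
  have pc: "a [^]\<^bsub>GL_int n\<^esub> (k::nat) \<in> carrier (GL_int n)" if "a \<in> carrier (GL_int n)" for a k
    using that by simp
  show ?thesis
    unfolding steinberg_def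
  proof (intro conjI allI impI)
    fix i j assume "i < j" "j < n"
    then show "P * w i j * inv\<^bsub>GL_int n\<^esub> P \<in> carrier (GL_int n)" by (intro mc P wc inv_closed)
  next
    fix i j k l assume *: "i < j" "j < n" "k < l" "l < n" "j \<noteq> k" "i \<noteq> l"
    then have "w i j * w k l = w k l * w i j" using w unfolding steinberg_def by blast
    then show "P * w i j * inv\<^bsub>GL_int n\<^esub> P * (P * w k l * inv\<^bsub>GL_int n\<^esub> P) =
       P * w k l * inv\<^bsub>GL_int n\<^esub> P * (P * w i j * inv\<^bsub>GL_int n\<^esub> P)"
      using * by (simp add: cm wc)
  next
    fix i j l assume *: "i < j" "j < l" "l < n"
    have c: "w i j \<in> carrier (GL_int n)" "w j l \<in> carrier (GL_int n)" "w i l \<in> carrier (GL_int n)"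
      using * by (auto intro!: wc)
    have "w i j * w j l = (w i l [^]\<^bsub>GL_int n\<^esub> N) * (w j l * w i j)"
      using w * unfolding steinberg_def by blast
    then show "P * w i j * inv\<^bsub>GL_int n\<^esub> P * (P * w j l * inv\<^bsub>GL_int n\<^esub> P) =
       ((P * w i l * inv\<^bsub>GL_int n\<^esub> P) [^]\<^bsub>GL_int n\<^esub> N) *
       (P * w j l * inv\<^bsub>GL_int n\<^esub> P * (P * w i j * inv\<^bsub>GL_int n\<^esub> P))"
      using c by (simp only: cm cp mc pc)
  qed
qed

lemma unipotent_conj:
  assumes P: "P \<in> carrier (GL_int n)" and A: "A \<in> carrier (GL_int n)" and u: "unipotent n A"
  shows "unipotent n (P * A * inv\<^bsub>GL_int n\<^esub> P)"
  unfolding unipotent_def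
proof
  interpret group "GL_int n" by (rule group_GL_int)
  let ?P' = "inv\<^bsub>GL_int n\<^esub> P"
  have c: "P \<in> carrier_mat n n" "A \<in> carrier_mat n n" "?P' \<in> carrier_mat n n"
    using P A by (auto intro: GL_carrier_mat)
  have inv: "P * ?P' = 1\<^sub>m n" "?P' * P = 1\<^sub>m n" using r_inv[OF P] l_inv[OF P] by auto
  have op: "mat_op (P * A * ?P') u = mat_op P (mat_op A (mat_op ?P' u))" for u
    using c by (simp add: mat_op_mult[of _ n])
  have i1: "mat_op ?P' (mat_op P u) = u" "mat_op P (mat_op ?P' u) = u" for u
    using inv mat_op_mult[of ?P' n P u] mat_op_mult[of P n ?P' u] c by auto
  have "diff_op (mat_op (P * A * ?P')) 1 (mat_op P u) = mat_op P (diff_op (mat_op A) 1 u)" for u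
    by (simp only: diff_op_one op i1 additive.diff[OF additive_mat_op])
  then have "(diff_op (mat_op (P * A * ?P')) 1 ^^ k) (mat_op P u) = mat_op P ((diff_op (mat_op A) 1 ^^ k) u)" for k u
    by (induction k) simp_all
  from this[of _ "mat_op ?P' v" for v] have *: "(diff_op (mat_op (P * A * ?P')) 1 ^^ k) v = mat_op P ((diff_op (mat_op A) 1 ^^ k) (mat_op ?P' v))" for k v
    by (simp add: i1)
  fix v assume "v \<in> vecs n"
  then have "mat_op ?P' v \<in> vecs n" using c by (intro mat_op_vecs)
  then obtain k where "(diff_op (mat_op A) 1 ^^ k) (mat_op ?P' v) = 0" using u unfolding unipotent_def by blast
  then show "\<exists>k. (diff_op (mat_op (P * A * ?P')) 1 ^^ k) v = 0"
    using * additive.zero[OF additive_mat_op] by (intro exI[of _ k]) simp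
qed

lemma mat_op_column:
  assumes "M \<in> carrier_mat n n" "i < n"
  shows "(M * mat n 1 (\<lambda>(i, _). v i)) $$ (i, 0) = mat_op M v i"
  using assms by (subst index_mult_mat_sum[of _ n n _ 1]) (auto simp: mat_op_def)

lemma row_ops_fixes_low:
  assumes M: "M \<in> row_ops n t" and u: "u \<in> vecs n" "\<And>i. t \<le> i \<Longrightarrow> u i = 0"
  shows "mat_op M u = u"
proof
  fix i
  show "mat_op M u i = u i"
  proof (cases "i < n")
    case True
    have "(M * mat n 1 (\<lambda>(i, _). u i)) $$ (i, 0) = mat n 1 (\<lambda>(i, _). u i) $$ (i, 0)"
      using row_ops_col_unchanged[OF M, of "mat n 1 (\<lambda>(i, _). u i)" 1 0 i] True u by simp
    then show ?thesis using mat_op_column[OF row_ops_carrier[OF M] True, of u] True by simp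
  next
    case False
    then show ?thesis using row_ops_carrier[OF M] by (auto simp: mat_op_def)
  qed
qed

text \<open>The member of rank t of the standard flag.\<close>

definition low_vecs :: "nat \<Rightarrow> nat \<Rightarrow> (nat \<Rightarrow> int) set" where
  "low_vecs n t = {v \<in> vecs n. \<forall>i\<ge>t. v i = 0}"

text \<open>Only the first t columns are constrained, so that the triangular form can be reached one
  column at a time; t = n is the full condition.\<close>

definition unitriangular :: "nat \<Rightarrow> nat \<Rightarrow> int mat \<Rightarrow> bool" where
  "unitriangular n t A \<longleftrightarrow> (\<forall>c<t. \<forall>r<n. c \<le> r \<longrightarrow> A $$ (r, c) = (if r = c then 1 else 0))"

lemma unitriangular_low_vecs:
  assumes A: "A \<in> carrier_mat n n" "unitriangular n t A" and u: "u \<in> low_vecs n t"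
  shows "mat_op A u \<in> low_vecs n t"
proof -
  have "mat_op A u r = 0" if r: "t \<le> r" "r < n" for r
  proof -
    have "A $$ (r, l) * u l = 0" if "l < n" for l
      using A u r that by (cases "l < t") (auto simp: unitriangular_def low_vecs_def)
    then show ?thesis using A r by (auto simp: mat_op_def intro!: sum.neutral)
  qed
  moreover have "mat_op A u \<in> vecs n" using A u by (auto simp: low_vecs_def intro: mat_op_vecs)
  ultimately show ?thesis by (auto simp: low_vecs_def vecs_def) (metis not_le)
qed

lemma mat_op_unit:
  assumes "A \<in> carrier_mat n n" "c < n" "r < n"
  shows "mat_op A (\<lambda>i. if i = c then 1 else 0) r = A $$ (r, c)"
  using assms by (auto simp: mat_op_def if_distrib cong: if_cong)

text \<open>Induction along the standard flag. A vector outside \<open>low_vecs n t\<close>, fixed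
  by the family modulo it, is moved into the next member of the flag by row operations that fix
  \<open>low_vecs n t\<close> pointwise.\<close>

lemma steinberg_triangular:
  assumes w: "steinberg n N w" and uni: "\<And>i j. i < j \<Longrightarrow> j < n \<Longrightarrow> unipotent n (w i j)" and "t \<le> n"
  shows "\<exists>P\<in>carrier (SL_int n). \<forall>i j. i < j \<longrightarrow> j < n \<longrightarrow> unitriangular n t (P * w i j * inv\<^bsub>GL_int n\<^esub> P)"
  using assms(3)
proof (induction t)
  case 0
  have "1\<^sub>m n \<in> carrier (SL_int n)" by (simp add: carrier_SL_int)
  then show ?case by (intro bexI[of _ "1\<^sub>m n"]) (auto simp: unitriangular_def)
next
  case (Suc t)
  interpret group "GL_int n" by (rule group_GL_int)
  obtain P where P: "P \<in> carrier (SL_int n)"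
    and tri: "\<And>i j. i < j \<Longrightarrow> j < n \<Longrightarrow> unitriangular n t (P * w i j * inv\<^bsub>GL_int n\<^esub> P)" using Suc by auto
  have PG: "P \<in> carrier (GL_int n)" using P by (rule SL_GL)
  define w' where "w' i j = P * w i j * inv\<^bsub>GL_int n\<^esub> P" for i j
  have w': "steinberg n N w'" unfolding w'_def by (rule steinberg_conj[OF PG w])
  have wc: "w' i j \<in> carrier (GL_int n)" if "i < j" "j < n" for i j
    using w' that unfolding steinberg_def by blast
  have wm: "w' i j \<in> carrier_mat n n" if "i < j" "j < n" for i j
    using wc[OF that] by (rule GL_carrier_mat)
  have uni': "unipotent n (w' i j)" if "i < j" "j < n" for i j
    unfolding w'_def using w that by (intro unipotent_conj PG uni) (auto simp: steinberg_def)
  have tn: "t < n" using Suc.prems by simp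
  let ?Z = "low_vecs n t"
  have wZ: "mat_op (w' i j) u \<in> ?Z" if "i < j" "j < n" "u \<in> ?Z" for i j u
    using unitriangular_low_vecs[OF wm tri[folded w'_def]] that by blast
  have "\<exists>v\<in>vecs n. v \<notin> ?Z \<and> (\<forall>i j. i < j \<longrightarrow> j < n \<longrightarrow> mat_op (w' i j) v - v \<in> ?Z)"
  proof (rule kolchin_common_vector[where N = N and w = "\<lambda>i j. mat_op (w' i j)"])
    show "additive (mat_op (w' i j))" for i j by (rule additive_mat_op)
    show "u - v \<in> vecs n" if "u \<in> vecs n" "v \<in> vecs n" for u v using that by (auto simp: vecs_def)
    show "mat_op (w' i j) u \<in> vecs n" if "i < j" "j < n" "u \<in> vecs n" for i j u
      using that wm by (intro mat_op_vecs) auto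
    show "u - v \<in> ?Z" if "u \<in> ?Z" "v \<in> ?Z" for u v using that by (auto simp: low_vecs_def vecs_def)
    show "mat_op (w' i j) u \<in> ?Z" if "i < j" "j < n" "u \<in> ?Z" for i j u using wZ that by blast
    show "mat_op (w' i j) (mat_op (w' k l) u) = mat_op (w' k l) (mat_op (w' i j) u)"
      if "i < j" "j < n" "k < l" "l < n" "j \<noteq> k" "i \<noteq> l" for i j k l u
    proof -
      have "w' i j * w' k l = w' k l * w' i j" using w' that unfolding steinberg_def by blast
      from arg_cong[OF this, of "\<lambda>M. mat_op M u"] show ?thesis
        unfolding mat_op_mult[OF wm[OF that(1,2)] wm[OF that(3,4)]] mat_op_mult[OF wm[OF that(3,4)] wm[OF that(1,2)]] .
    qed
    show "mat_op (w' i j) (mat_op (w' j l) u) = (mat_op (w' i l) ^^ N) (mat_op (w' j l) (mat_op (w' i j) u))"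
      if "i < j" "j < l" "l < n" for i j l u
    proof -
      have il: "i < l" "j < n" using that by auto
      have "w' i j * w' j l = (w' i l [^]\<^bsub>GL_int n\<^esub> N) * (w' j l * w' i j)"
        using w' that unfolding steinberg_def by blast
      from arg_cong[OF this, of "\<lambda>M. mat_op M u"] show ?thesis
        using wm[OF that(1) il(2)] wm[OF that(2,3)] wc[OF il(1) that(3)] nat_pow_closed[OF wc[OF il(1) that(3)], of N]
        by (simp add: mat_op_mult[of _ n] GL_carrier_mat mat_op_nat_pow)
    qed
    show "\<exists>k. (diff_op (mat_op (w' i j)) 1 ^^ k) v \<in> ?Z" if "i < j" "j < n" "v \<in> vecs n" for i j v
    proof -
      have "unipotent n (w' i j)" "v \<in> vecs n" using uni' that by auto
      then obtain k where "(diff_op (mat_op (w' i j)) 1 ^^ k) v = 0" unfolding unipotent_def by blast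
      then show ?thesis by (intro exI[of _ k]) (simp add: low_vecs_def vecs_def)
    qed
    show "(\<lambda>i. if i = t then 1 else 0) \<in> vecs n" using tn by (auto simp: vecs_def)
    show "(\<lambda>i. if i = t then 1 else 0) \<notin> ?Z" by (auto simp: low_vecs_def)
  qed
  then obtain v where v: "v \<in> vecs n" "v \<notin> ?Z"
    and fx: "\<And>i j. i < j \<Longrightarrow> j < n \<Longrightarrow> mat_op (w' i j) v - v \<in> ?Z" by blast
  \<comment> \<open>Only rows from t on are combined, so conjugation by M leaves the first t columns
    in their form, while M v is supported on the first t + 1 coordinates.\<close>
  obtain M where M: "M \<in> row_ops n t" and "\<And>i. t < i \<Longrightarrow> i < n \<Longrightarrow> (M * mat n 1 (\<lambda>(i, _). v i)) $$ (i, 0) = 0"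
    using row_ops_euclid[of "mat n 1 (\<lambda>(i, _). v i)" n 1 0 t] tn by auto
  then have Mv: "mat_op M v i = 0" if "t < i" "i < n" for i
    using that mat_op_column[OF row_ops_carrier[OF M]] by metis
  have MS: "M \<in> carrier (SL_int n)" using M by (rule row_ops_SL)
  then have MG: "M \<in> carrier (GL_int n)" by (rule SL_GL)
  let ?M' = "inv\<^bsub>GL_int n\<^esub> M"
  have Mm: "M \<in> carrier_mat n n" "?M' \<in> carrier_mat n n" using MG by (auto intro: GL_carrier_mat)
  have inv: "M * ?M' = 1\<^sub>m n" "?M' * M = 1\<^sub>m n" using r_inv[OF MG] l_inv[OF MG] by auto
  have i1: "mat_op ?M' (mat_op M u) = u" for u
    using inv mat_op_mult[of ?M' n M u] Mm by auto
  have Mlow: "mat_op M u = u" if "u \<in> ?Z" for u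
    using row_ops_fixes_low[OF M, of u] that by (auto simp: low_vecs_def)
  have M'low: "mat_op ?M' u = u" if "u \<in> ?Z" for u using i1[of u] Mlow[OF that] by simp
  define u where "u = mat_op M v"
  have uV: "u \<in> vecs n" unfolding u_def using Mm v by (intro mat_op_vecs)
  have uhigh: "u i = 0" if "t < i" for i using Mv[of i] that uV by (cases "i < n") (auto simp: u_def vecs_def)
  \<comment> \<open>Otherwise u would be a low vector, hence fixed by the inverse of M, and v = u
    would be low.\<close>
  have ut: "u t \<noteq> 0"
  proof
    assume "u t = 0"
    then have "u \<in> ?Z" using uhigh uV by (auto simp: low_vecs_def le_less)
    then have "mat_op ?M' u = u" by (rule M'low)
    then have "v = u" using i1[of v] by (simp add: u_def)
    then show False using \<open>u \<in> ?Z\<close> v by simp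
  qed
  have MP: "M * P \<in> carrier (SL_int n)" using MS P group.is_monoid[OF group_SL_int, of n, THEN monoid.m_closed, of M P] by simp
  have "unitriangular n (Suc t) ((M * P) * w i j * inv\<^bsub>GL_int n\<^esub> (M * P))" if ij: "i < j" "j < n" for i j
  proof -
    have wij: "w i j \<in> carrier (GL_int n)" using w ij unfolding steinberg_def by blast
    have "inv\<^bsub>GL_int n\<^esub> (M * P) = inv\<^bsub>GL_int n\<^esub> P * inv\<^bsub>GL_int n\<^esub> M"
      using inv_mult_group[OF MG PG] by simp
    moreover have "inv\<^bsub>GL_int n\<^esub> P \<in> carrier_mat n n" "P \<in> carrier_mat n n" "w i j \<in> carrier_mat n n"
      using PG wij by (auto intro: GL_carrier_mat)
    ultimately have eq: "(M * P) * w i j * inv\<^bsub>GL_int n\<^esub> (M * P) = M * w' i j * ?M'"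
      using Mm unfolding w'_def by (simp add: sq_assoc[of _ n _ _ n])
    define A where "A = M * w' i j * ?M'"
    have Am: "A \<in> carrier_mat n n" using Mm wm[OF ij] by (simp add: A_def)
    have Aop: "mat_op A x = mat_op M (mat_op (w' i j) (mat_op ?M' x))" for x
      unfolding A_def using Mm wm[OF ij] by (simp add: mat_op_mult[of _ n])
    have Alow: "mat_op A x = mat_op (w' i j) x" if "x \<in> ?Z" for x
      using that wZ[OF ij that] by (simp add: Aop M'low Mlow)
    have "A $$ (r, c) = (if r = c then 1 else 0)" if c: "c < Suc t" and r: "r < n" "c \<le> r" for r c
    proof (cases "c = t")
      case False
      then have c: "c < t" using c by simp
      have "(\<lambda>i. if i = c then 1 else 0) \<in> ?Z" using c tn by (auto simp: low_vecs_def vecs_def)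
      then have "A $$ (r, c) = w' i j $$ (r, c)"
        using Alow mat_op_unit[OF Am, of c r] mat_op_unit[OF wm[OF ij], of c r] c tn r by simp
      then show ?thesis using tri[OF ij, folded w'_def] c r by (auto simp: unitriangular_def)
    next
      case True
      define z where "z = mat_op (w' i j) v - v"
      have z: "z \<in> ?Z" using fx[OF ij] by (simp add: z_def)
      have "mat_op A u = mat_op M (v + z)" by (simp add: Aop u_def i1 z_def)
      then have Au: "mat_op A u = u + z" using Mlow[OF z] by (simp add: additive.add[OF additive_mat_op] u_def)
      \<comment> \<open>u is split into a low part and u_t times the t-th unit vector. In the rows r
        \<ge> t of A u = u + z this leaves u_r = u_t A_rt, and the nonzero u_t cancels.\<close>
      define u0 where "u0 = u - scal (u t) (\<lambda>i. if i = t then 1 else 0)"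
      have u0: "u0 \<in> ?Z" using uV uhigh tn by (auto simp: u0_def low_vecs_def vecs_def le_less)
      have Au0: "mat_op A u0 \<in> ?Z" using Alow[OF u0] wZ[OF ij u0] by simp
      have "u = u0 + scal (u t) (\<lambda>i. if i = t then 1 else 0)" by (simp add: u0_def)
      then have "mat_op A u = mat_op A (u0 + scal (u t) (\<lambda>i. if i = t then 1 else 0))" by (rule arg_cong)
      also have "\<dots> = mat_op A u0 + scal (u t) (mat_op A (\<lambda>i. if i = t then 1 else 0))"
        by (simp only: additive.add[OF additive_mat_op] mat_op_scal)
      finally have "mat_op A u r = mat_op A u0 r + u t * A $$ (r, t)"
        using mat_op_unit[OF Am tn r(1)] by simp
      moreover have "mat_op A u0 r = 0" "z r = 0" using Au0 z r True by (auto simp: low_vecs_def)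
      ultimately have "u r = u t * A $$ (r, t)" using Au by simp
      then show ?thesis using ut uhigh[of r] r True by (cases "r = t") auto
    qed
    then show ?thesis unfolding eq A_def[symmetric] unitriangular_def by blast
  qed
  then show ?case using MP by blast
qed


text \<open>If level \<open>k\<close> consists of the unitriangular matrices that agree with \<open>1\<close> below the \<open>k\<close>-th superdiagonal,
  then the commutator of an element of level \<open>k\<close> with one of level \<open>1\<close> has level \<open>k + 1\<close>.\<close>

lemma steinberg_level:
  assumes w: "steinberg n N w" and tri: "\<And>i j. i < j \<Longrightarrow> j < n \<Longrightarrow> unitriangular n n (w i j)"
    and k: "1 \<le> k" "k < n" and rc: "r < n" "c < n" "c < r + k"
  shows "(w 0 k [^]\<^bsub>GL_int n\<^esub> (N ^ (k - 1))) $$ (r, c) = (if r = c then 1 else 0)"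
  using k rc
proof (induction k arbitrary: r c rule: dec_induct)
  case base
  interpret group "GL_int n" by (rule group_GL_int)
  have w01: "w 0 1 \<in> carrier (GL_int n)" using w base unfolding steinberg_def by auto
  show ?case using tri[of 0 1] base nat_pow_eone[OF w01] by (simp add: unitriangular_def)
next
  case (step k)
  interpret group "GL_int n" by (rule group_GL_int)
  have k: "0 < k" "k < n" "k < Suc k" "Suc k < n" "0 < Suc k" using step by auto
  \<comment> \<open>A has level k and B has level 1, and A B = C (B A) makes C their commutator. By
    \<open>heisenberg_pow\<close> the exponent N^(k-1) of A becomes N^k in C.\<close>
  define A where "A = w 0 k [^]\<^bsub>GL_int n\<^esub> (N ^ (k - 1))"
  define B where "B = w k (Suc k)"
  define C where "C = w 0 (Suc k) [^]\<^bsub>GL_int n\<^esub> (N ^ k)"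
  have wc: "w 0 k \<in> carrier (GL_int n)" "w k (Suc k) \<in> carrier (GL_int n)" "w 0 (Suc k) \<in> carrier (GL_int n)"
    using w k unfolding steinberg_def by blast+
  have AB: "A * B = C * (B * A)"
  proof -
    have c1: "w 0 (Suc k) * w 0 k = w 0 k * w 0 (Suc k)" and c2: "w 0 (Suc k) * w k (Suc k) = w k (Suc k) * w 0 (Suc k)"
      using w[unfolded steinberg_def, THEN conjunct2, THEN conjunct1, rule_format, of 0 "Suc k" 0 k]
        w[unfolded steinberg_def, THEN conjunct2, THEN conjunct1, rule_format, of 0 "Suc k" k "Suc k"] k by auto
    have r: "w 0 k * w k (Suc k) = (w 0 (Suc k) [^]\<^bsub>GL_int n\<^esub> N) * (w k (Suc k) * w 0 k)"
      using w k unfolding steinberg_def by blast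
    have "(w 0 k [^]\<^bsub>GL_int n\<^esub> a) \<otimes>\<^bsub>GL_int n\<^esub> w k (Suc k) =
      (w 0 (Suc k) [^]\<^bsub>GL_int n\<^esub> (N * a)) \<otimes>\<^bsub>GL_int n\<^esub> (w k (Suc k) \<otimes>\<^bsub>GL_int n\<^esub> (w 0 k [^]\<^bsub>GL_int n\<^esub> a))" for a :: nat
      using wc c1 c2 r by (intro heisenberg_pow) simp_all
    from this[of "N ^ (k - 1)"] show ?thesis
      using k by (simp add: A_def B_def C_def power_eq_if)
  qed
  have c: "A \<in> carrier_mat n n" "B \<in> carrier_mat n n" "C \<in> carrier_mat n n"
    using wc unfolding A_def B_def C_def by (auto intro!: GL_carrier_mat)
  have A: "A $$ (r, c) = (if r = c then 1 else 0)" if "r < n" "c < n" "c < r + k" for r c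
    unfolding A_def using step.IH[of r c] that k by simp
  have B: "B $$ (r, c) = (if r = c then 1 else 0)" if "r < n" "c < n" "c \<le> r" for r c
    using tri[of k "Suc k"] that k unfolding B_def unitriangular_def by auto
  \<comment> \<open>On the k-th superdiagonal both products have the sum of the entries of A and B,
    below it the entry of B; so A B and B A agree up to there.\<close>
  have ent: "(A * B) $$ (r, c) = (B * A) $$ (r, c) \<and> (c \<le> r \<longrightarrow> (B * A) $$ (r, c) = (if r = c then 1 else 0))"
    if rc: "r < n" "c < n" "c \<le> r + k" for r c
  proof (cases "c = r + k")
    case True
    have "(A * B) $$ (r, c) = (\<Sum>l<n. A $$ (r, l) * B $$ (l, c))" using c rc by (intro index_mult_mat_sum) auto
    also have "\<dots> = (\<Sum>l\<in>{r, c}. A $$ (r, l) * B $$ (l, c))"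
    proof (intro sum.mono_neutral_right ballI)
      fix l assume l: "l \<in> {..<n} - {r, c}"
      show "A $$ (r, l) * B $$ (l, c) = 0"
        using A[of r l] B[of l c] l rc True by (cases "l < r + k") auto
    qed (use rc in auto)
    also have "\<dots> = B $$ (r, c) + A $$ (r, c)" using True k rc A[of r r] B[of c c] by simp
    finally have 1: "(A * B) $$ (r, c) = B $$ (r, c) + A $$ (r, c)" .
    have "(B * A) $$ (r, c) = (\<Sum>l<n. B $$ (r, l) * A $$ (l, c))" using c rc by (intro index_mult_mat_sum) auto
    also have "\<dots> = (\<Sum>l\<in>{r, c}. B $$ (r, l) * A $$ (l, c))"
    proof (intro sum.mono_neutral_right ballI)
      fix l assume l: "l \<in> {..<n} - {r, c}"
      show "B $$ (r, l) * A $$ (l, c) = 0"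
        using B[of r l] A[of l c] l rc True by (cases "l < r") auto
    qed (use rc in auto)
    also have "\<dots> = B $$ (r, c) + A $$ (r, c)" using True k rc A[of c c] B[of r r] by simp
    finally show ?thesis using 1 True k by simp
  next
    case False
    then have ck: "c < r + k" using rc by simp
    have "(A * B) $$ (r, c) = (\<Sum>l<n. A $$ (r, l) * B $$ (l, c))" using c rc by (intro index_mult_mat_sum) auto
    also have "\<dots> = (\<Sum>l\<in>{r}. A $$ (r, l) * B $$ (l, c))"
    proof (intro sum.mono_neutral_right ballI)
      fix l assume l: "l \<in> {..<n} - {r}"
      show "A $$ (r, l) * B $$ (l, c) = 0"
        using A[of r l] B[of l c] l rc ck by (cases "l < r + k") auto
    qed (use rc in auto)
    also have "\<dots> = B $$ (r, c)" using k rc A[of r r] by simp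
    finally have 1: "(A * B) $$ (r, c) = B $$ (r, c)" .
    have "(B * A) $$ (r, c) = (\<Sum>l<n. B $$ (r, l) * A $$ (l, c))" using c rc by (intro index_mult_mat_sum) auto
    also have "\<dots> = (\<Sum>l\<in>{c}. B $$ (r, l) * A $$ (l, c))"
    proof (intro sum.mono_neutral_right ballI)
      fix l assume l: "l \<in> {..<n} - {c}"
      show "B $$ (r, l) * A $$ (l, c) = 0"
        using B[of r l] A[of l c] l rc ck by (cases "l < r") auto
    qed (use rc in auto)
    also have "\<dots> = B $$ (r, c)" using k rc A[of c c] by simp
    finally show ?thesis using 1 B[OF rc(1,2)] by simp
  qed
  \<comment> \<open>A B = C (B A) is solved for row r of C, column by column, using that B A is
    unitriangular.\<close>
  have "C $$ (r, c) = (if r = c then 1 else 0)" if "r < n" "c < n" "c \<le> r + k" for r c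
    using that
  proof (induction c rule: less_induct)
    case (less c)
    have BA: "B * A \<in> carrier_mat n n" using c by simp
    have "(B * A) $$ (r, c) = (C * (B * A)) $$ (r, c)" using ent less.prems AB by simp
    also have "\<dots> = (\<Sum>l<n. C $$ (r, l) * (B * A) $$ (l, c))" using c BA less.prems by (intro index_mult_mat_sum) auto
    also have "\<dots> = C $$ (r, c) * (B * A) $$ (c, c) + (\<Sum>l\<in>{..<n} - {c}. C $$ (r, l) * (B * A) $$ (l, c))"
      using less.prems by (intro sum.remove) auto
    also have "(B * A) $$ (c, c) = 1" using ent[of c c] less.prems by simp
    also have "(\<Sum>l\<in>{..<n} - {c}. C $$ (r, l) * (B * A) $$ (l, c)) = (\<Sum>l\<in>{..<n} - {c}. if l = r \<and> r < c then (B * A) $$ (r, c) else 0)"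
    proof (intro sum.cong refl)
      fix l assume l: "l \<in> {..<n} - {c}"
      show "C $$ (r, l) * (B * A) $$ (l, c) = (if l = r \<and> r < c then (B * A) $$ (r, c) else 0)"
      proof (cases "l < c")
        case True
        then show ?thesis using less.IH[of l] less.prems l by auto
      next
        case False
        then show ?thesis using ent[of l c] less.prems l by auto
      qed
    qed
    also have "\<dots> = (if r < c then (B * A) $$ (r, c) else 0)"
      using less.prems by (auto simp: sum.delta' split: if_splits)
    finally show ?case using ent[of r c] less.prems by (auto split: if_splits)
  qed
  then show ?case using step.prems by (simp add: C_def)
qed

section \<open>Automorphisms in dimension at least three\<close>

text \<open>Moving y past x costs at most the central involution s, and two passages cancel
  it.\<close>

lemma (in group) even_pow_commute:
  assumes c: "s \<in> carrier G" "x \<in> carrier G" "y \<in> carrier G"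
    and s: "\<And>g. g \<in> carrier G \<Longrightarrow> s \<otimes> g = g \<otimes> s" "s \<otimes> s = \<one>"
    and xy: "x \<otimes> y = y \<otimes> x \<or> x \<otimes> y = s \<otimes> (y \<otimes> x)" and "even (p::nat)"
  shows "(x [^] p) \<otimes> y = y \<otimes> (x [^] p)"
proof -
  have 2: "(x \<otimes> x) \<otimes> y = y \<otimes> (x \<otimes> x)"
    using xy
  proof
    assume e: "x \<otimes> y = y \<otimes> x"
    have "(x \<otimes> x) \<otimes> y = x \<otimes> (y \<otimes> x)" using c e by (simp add: m_assoc)
    also have "\<dots> = (x \<otimes> y) \<otimes> x" using c by (simp add: m_assoc)
    also have "\<dots> = y \<otimes> (x \<otimes> x)" using c e by (simp add: m_assoc)
    finally show ?thesis .
  next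
    assume e: "x \<otimes> y = s \<otimes> (y \<otimes> x)"
    have "(x \<otimes> x) \<otimes> y = x \<otimes> (s \<otimes> (y \<otimes> x))" using c e by (simp add: m_assoc)
    also have "\<dots> = (x \<otimes> s) \<otimes> (y \<otimes> x)" using c by (simp add: m_assoc)
    also have "\<dots> = s \<otimes> ((x \<otimes> y) \<otimes> x)" using c s(1)[OF c(2)] by (simp add: m_assoc[symmetric])
    also have "\<dots> = (s \<otimes> s) \<otimes> (y \<otimes> (x \<otimes> x))" using c e by (simp add: m_assoc)
    finally show ?thesis using c s(2) by simp
  qed
  obtain q where q: "p = 2 * q" using \<open>even p\<close> by blast
  have "(x [^] (2 * q)) \<otimes> y = y \<otimes> (x [^] (2 * q))" for q :: nat
  proof (induction q)
    case (Suc q)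
    have xx: "x [^] (2 * Suc q) = (x [^] (2 * q)) \<otimes> (x \<otimes> x)" using c by (simp add: m_assoc)
    have "(x [^] (2 * Suc q)) \<otimes> y = (x [^] (2 * q)) \<otimes> ((x \<otimes> x) \<otimes> y)"
      unfolding xx using c by (intro m_assoc) auto
    also have "\<dots> = ((x [^] (2 * q)) \<otimes> y) \<otimes> (x \<otimes> x)"
      unfolding 2 using c by (intro m_assoc[symmetric]) auto
    also have "\<dots> = y \<otimes> (x [^] (2 * Suc q))"
      unfolding xx Suc using c by (intro m_assoc) auto
    finally show ?case .
  qed (use c in simp)
  then show ?thesis by (simp add: q)
qed

text \<open>The commutator d of a and b is c or s c and commutes with b, so the commutator of a and
  b^2 is d^2, which is c^2 in both cases.\<close>

lemma (in group) commutator_square: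
  assumes cr: "s \<in> carrier G" "a \<in> carrier G" "b \<in> carrier G" "c \<in> carrier G"
    and s: "\<And>g. g \<in> carrier G \<Longrightarrow> s \<otimes> g = g \<otimes> s" "s \<otimes> s = \<one>"
    and ab: "a \<otimes> b = c \<otimes> (b \<otimes> a) \<or> a \<otimes> b = s \<otimes> (c \<otimes> (b \<otimes> a))" and cb: "c \<otimes> b = b \<otimes> c"
  shows "a \<otimes> (b \<otimes> b) = (c \<otimes> c) \<otimes> ((b \<otimes> b) \<otimes> a)"
proof -
  have main: "a \<otimes> (b \<otimes> b) = (d \<otimes> d) \<otimes> ((b \<otimes> b) \<otimes> a)"
    if d: "d \<in> carrier G" "a \<otimes> b = d \<otimes> (b \<otimes> a)" "d \<otimes> b = b \<otimes> d" for d
  proof -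
    have "a \<otimes> (b \<otimes> b) = (a \<otimes> b) \<otimes> b" using cr by (simp add: m_assoc)
    also have "\<dots> = (d \<otimes> b) \<otimes> (a \<otimes> b)" using cr d(1) by (simp add: d(2) m_assoc)
    also have "\<dots> = d \<otimes> ((b \<otimes> d) \<otimes> (b \<otimes> a))" using cr d(1) by (simp add: d(2) m_assoc)
    also have "\<dots> = (d \<otimes> d) \<otimes> ((b \<otimes> b) \<otimes> a)" using cr d(1) by (simp add: d(3)[symmetric] m_assoc)
    finally show ?thesis .
  qed
  show ?thesis using ab
  proof
    assume "a \<otimes> b = c \<otimes> (b \<otimes> a)"
    then show ?thesis using main[of c] cr cb by simp
  next
    assume e: "a \<otimes> b = s \<otimes> (c \<otimes> (b \<otimes> a))"
    have "(s \<otimes> c) \<otimes> b = s \<otimes> (b \<otimes> c)" using cr cb by (simp add: m_assoc)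
    also have "\<dots> = b \<otimes> (s \<otimes> c)" using cr s(1)[OF cr(3)] by (simp add: m_assoc[symmetric])
    finally have "(s \<otimes> c) \<otimes> b = b \<otimes> (s \<otimes> c)" .
    then have "a \<otimes> (b \<otimes> b) = ((s \<otimes> c) \<otimes> (s \<otimes> c)) \<otimes> ((b \<otimes> b) \<otimes> a)"
      using main[of "s \<otimes> c"] e cr by (simp add: m_assoc)
    also have "(s \<otimes> c) \<otimes> (s \<otimes> c) = s \<otimes> ((c \<otimes> s) \<otimes> c)" using cr by (simp add: m_assoc)
    also have "\<dots> = (s \<otimes> s) \<otimes> (c \<otimes> c)" unfolding s(1)[OF cr(4), symmetric] using cr by (simp add: m_assoc)
    finally show ?thesis using cr s(2) by simp
  qed
qed

lemma addrow_mat_zero [simp]: "addrow_mat n 0 k l = (1\<^sub>m n :: int mat)"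
  by (rule eq_matI) auto

lemma addrow_mat_commute:
  assumes "i < n" "j < n" "k < n" "l < n" "i \<noteq> l" "j \<noteq> k" "i \<noteq> j" "k \<noteq> l"
  shows "addrow_mat n a i j * addrow_mat n b k l = addrow_mat n b k l * addrow_mat n (a::int) i j"
proof (cases "a = 0")
  case False
  then show ?thesis
    using commute_addrow_mat[OF addrow_mat_carrier assms(1,2,7) False, of b k l] assms by auto
qed simp

lemma addrow_mat_commutator:
  assumes "i < n" "j < n" "l < n" "i \<noteq> j" "j \<noteq> l" "i \<noteq> l"
  shows "addrow_mat n a i j * addrow_mat n b j l =
    addrow_mat n (a * b) i l * (addrow_mat n b j l * addrow_mat n (a::int) i j)"
  using assms by (intro eq_matI) (auto simp: index_addrow_mat_mult[where nc = n])

lemma addrow_mat_add: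
  assumes "k < n" "l < n" "k \<noteq> l"
  shows "addrow_mat n a k l * addrow_mat n b k l = addrow_mat n (a + b :: int) k l"
  using assms by (intro eq_matI) (auto simp: index_addrow_mat_mult[where nc = n])

context int_matrix_group
begin

lemma addrow_pow:
  assumes "k < n" "l < n" "k \<noteq> l"
  shows "addrow_mat n a k l [^]\<^bsub>\<Gamma>\<^esub> (m::nat) = addrow_mat n (int m * a) k l"
  by (induction m) (use assms in \<open>simp_all add: addrow_mat_add algebra_simps\<close>)

lemma nat_pow_GL: "A [^]\<^bsub>\<Gamma>\<^esub> (k::nat) = A [^]\<^bsub>GL_int n\<^esub> k"
  by (induction k) simp_all

text \<open>The image of an upper unitriangular group under a homomorphism lifts, up to signs, to a group
  generated by quasi-unipotent matrices, so a finite-index part of it is triangularised by some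
  \<open>P \<in> SL(n, \<int>)\<close>. The corner transvection is an \<open>(n - 1)\<close>-fold commutator in it.\<close>

lemma hom_transvection:
  assumes n3: "n \<ge> 3" and \<phi>: "\<phi> \<in> hom PG PG"
  shows "\<exists>P\<in>carrier \<Gamma>. \<exists>K>0. \<exists>c. proj P \<otimes>\<^bsub>PG\<^esub> \<phi> (proj (addrow_mat n (int K) 0 (n - 1))) \<otimes>\<^bsub>PG\<^esub> inv\<^bsub>PG\<^esub> (proj P)
    = proj (addrow_mat n c 0 (n - 1))"
proof -
  interpret GL: group "GL_int n" by (rule group_GL_int)
  interpret proj: group_hom \<Gamma> PG proj by (rule proj_group_hom)
  interpret \<phi>: group_hom PG PG \<phi> using \<phi> by (simp add: group_hom_def group_hom_axioms_def PG.is_group)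
  \<comment> \<open>A choice of matrix lifts of the images under \<open>\<phi>\<close>. It is
    multiplicative only up to sign, so the relations between the \<open>x i j\<close> hold up to s =
    -1.\<close>
  define f where "f A = inv_into (carrier \<Gamma>) proj (\<phi> (proj A))" for A
  have f: "f A \<in> carrier \<Gamma> \<and> proj (f A) = \<phi> (proj A)" if "A \<in> carrier \<Gamma>" for A
  proof -
    have "\<phi> (proj A) \<in> proj ` carrier \<Gamma>" using \<phi>.hom_closed[OF proj_carrier[OF that]] by (simp only: carrier_PG)
    then show ?thesis unfolding f_def using inv_into_into f_inv_into_f by metis
  qed
  define el where "el i j = (addrow_mat n 1 i j :: int mat)" for i j
  define x where "x i j = f (el i j)" for i j
  have elc: "el i j \<in> carrier \<Gamma>" if "i < n" "j < n" "i \<noteq> j" for i j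
    using that by (simp add: el_def)
  have xc: "x i j \<in> carrier \<Gamma>" if "i < n" "j < n" "i \<noteq> j" for i j
    using f elc that by (simp add: x_def)
  have xGL: "x i j \<in> carrier (GL_int n)" if "i < n" "j < n" "i \<noteq> j" for i j
    using xc[OF that] by (rule carrier_GL)
  have px: "proj (x i j [^]\<^bsub>\<Gamma>\<^esub> (a::nat)) = \<phi> (proj (addrow_mat n (int a) i j))" if "i < n" "j < n" "i \<noteq> j" for i j a
  proof -
    have "proj (x i j [^]\<^bsub>\<Gamma>\<^esub> a) = \<phi> (proj (el i j)) [^]\<^bsub>PG\<^esub> a"
      using proj.hom_nat_pow[OF xc[OF that]] f[OF elc[OF that]] by (simp add: x_def)
    also have "\<dots> = \<phi> (proj (el i j [^]\<^bsub>\<Gamma>\<^esub> a))"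
      using \<phi>.hom_nat_pow proj.hom_nat_pow elc[OF that] by simp
    finally show ?thesis using addrow_pow[OF that, of 1 a] by (simp add: el_def)
  qed
  define s where "s = (- 1\<^sub>m n :: int mat)"
  have s: "s \<in> carrier (GL_int n)"
    by (auto simp: s_def carrier_GL_int intro!: bexI[of _ "- 1\<^sub>m n"])
  have scomm: "s \<otimes>\<^bsub>GL_int n\<^esub> g = g \<otimes>\<^bsub>GL_int n\<^esub> s" if "g \<in> carrier (GL_int n)" for g
    using GL_carrier_mat[OF that] by (simp add: s_def)
  have ss: "s \<otimes>\<^bsub>GL_int n\<^esub> s = \<one>\<^bsub>GL_int n\<^esub>" by (simp add: s_def)
  have smul: "s * A = - A" if "A \<in> carrier_mat n n" for A using that by (simp add: s_def)
  have R1: "x i j * x k l = x k l * x i j \<or> x i j * x k l = s * (x k l * x i j)"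
    if "i < n" "j < n" "k < n" "l < n" "i \<noteq> l" "j \<noteq> k" "i \<noteq> j" "k \<noteq> l" for i j k l
  proof -
    have c: "x i j \<in> carrier \<Gamma>" "x k l \<in> carrier \<Gamma>" using that xc by auto
    have e: "el i j \<in> carrier \<Gamma>" "el k l \<in> carrier \<Gamma>" using that elc by auto
    have pe: "proj (x i j) = \<phi> (proj (el i j))" "proj (x k l) = \<phi> (proj (el k l))"
      using f e by (auto simp: x_def)
    have "proj (x i j * x k l) = \<phi> (proj (el i j * el k l))"
      using c e pe by (simp add: proj_mult[symmetric])
    also have "\<dots> = \<phi> (proj (el k l * el i j))"
      using addrow_mat_commute[OF that, of 1 1] by (simp add: el_def)
    also have "\<dots> = proj (x k l * x i j)"
      using c e pe by (simp add: proj_mult[symmetric])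
    finally have "x i j * x k l = x k l * x i j \<or> x i j * x k l = - (x k l * x i j)"
      using proj_eq_iff[of "x i j * x k l" "x k l * x i j"] m_closed[OF c] m_closed[OF c(2,1)] by simp
    then show ?thesis using smul[of "x k l * x i j"] c by simp
  qed
  have R2: "(x i j [^]\<^bsub>\<Gamma>\<^esub> a) * (x j l [^]\<^bsub>\<Gamma>\<^esub> b) = (x i l [^]\<^bsub>\<Gamma>\<^esub> (a * b)) * ((x j l [^]\<^bsub>\<Gamma>\<^esub> b) * (x i j [^]\<^bsub>\<Gamma>\<^esub> a)) \<or>
     (x i j [^]\<^bsub>\<Gamma>\<^esub> a) * (x j l [^]\<^bsub>\<Gamma>\<^esub> b) = s * ((x i l [^]\<^bsub>\<Gamma>\<^esub> (a * b)) * ((x j l [^]\<^bsub>\<Gamma>\<^esub> b) * (x i j [^]\<^bsub>\<Gamma>\<^esub> a)))"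
    if "i < n" "j < n" "l < n" "i \<noteq> j" "j \<noteq> l" "i \<noteq> l" for i j l and a b :: nat
  proof -
    define A B C where "A = x i j [^]\<^bsub>\<Gamma>\<^esub> a" and "B = x j l [^]\<^bsub>\<Gamma>\<^esub> b" and "C = x i l [^]\<^bsub>\<Gamma>\<^esub> (a * b)"
    have c: "A \<in> carrier \<Gamma>" "B \<in> carrier \<Gamma>" "C \<in> carrier \<Gamma>"
      using that xc by (auto simp: A_def B_def C_def)
    have BA: "B * A \<in> carrier \<Gamma>" "A * B \<in> carrier \<Gamma>" using m_closed c by (metis mult_eq)+
    have CBA: "C * (B * A) \<in> carrier \<Gamma>" using m_closed[OF c(3) BA(1)] by simp
    define A' B' C' where "A' = addrow_mat n (int a) i j" and "B' = addrow_mat n (int b) j l" and "C' = addrow_mat n (int (a * b)) i l"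
    have e: "A' \<in> carrier \<Gamma>" "B' \<in> carrier \<Gamma>" "C' \<in> carrier \<Gamma>"
      using that by (auto simp: A'_def B'_def C'_def)
    have e2: "B' * A' \<in> carrier \<Gamma>" using m_closed[OF e(2,1)] by simp
    have p: "proj A = \<phi> (proj A')" "proj B = \<phi> (proj B')" "proj C = \<phi> (proj C')"
      unfolding A_def B_def C_def A'_def B'_def C'_def using px that by blast+
    have "proj (A * B) = \<phi> (proj (A' * B'))" using c e p by (simp add: proj_mult[symmetric])
    also have "A' * B' = C' * (B' * A')"
      unfolding A'_def B'_def C'_def using addrow_mat_commutator[OF that, of "int a" "int b"] by simp
    also have "\<phi> (proj (C' * (B' * A'))) = proj (C * (B * A))" using c e e2 BA p by (simp add: proj_mult[symmetric])
    finally have "A * B = C * (B * A) \<or> A * B = - (C * (B * A))"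
      using proj_eq_iff[OF BA(2) CBA] by simp
    then show ?thesis using smul[OF carrier_mat[OF CBA]] unfolding A_def B_def C_def by simp
  qed
  \<comment> \<open>m is divisible by every positive j \<le> n^2, as
    \<open>heisenberg_unipotent\<close> demands, and even, so that signs vanish. N = 4 m because the
    commutator z treated below is a fourth power; N is twice \<open>N0\<close> so that
    \<open>commutator_square\<close> can produce N-th powers without sign.\<close>
  define m :: nat where "m = 2 * fact (n * n)"
  define N0 where "N0 = 2 * m"
  define N where "N = 2 * N0"
  have m0: "m > 0" "even m" by (auto simp: m_def)
  define w where "w i j = x i j [^]\<^bsub>GL_int n\<^esub> N" for i j
  have wGL: "w i j \<in> carrier (GL_int n)" if "i < n" "j < n" "i \<noteq> j" for i j
    using xGL[OF that] by (simp add: w_def)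
  have xpow: "x i j [^]\<^bsub>GL_int n\<^esub> (a::nat) \<in> carrier (GL_int n)" if "i < n" "j < n" "i \<noteq> j" for i j a
    using xGL[OF that] by simp
  have comm1: "(x i j [^]\<^bsub>GL_int n\<^esub> p) * (x k l [^]\<^bsub>GL_int n\<^esub> q) = (x k l [^]\<^bsub>GL_int n\<^esub> q) * (x i j [^]\<^bsub>GL_int n\<^esub> p)"
    if h: "i < n" "j < n" "k < n" "l < n" "i \<noteq> l" "j \<noteq> k" "i \<noteq> j" "k \<noteq> l" and "even p" for i j k l and p q :: nat
  proof -
    have "(x i j [^]\<^bsub>GL_int n\<^esub> p) \<otimes>\<^bsub>GL_int n\<^esub> x k l = x k l \<otimes>\<^bsub>GL_int n\<^esub> (x i j [^]\<^bsub>GL_int n\<^esub> p)"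
      using R1[OF h] h by (intro GL.even_pow_commute[OF s _ _ scomm ss _ \<open>even p\<close>] xGL) auto
    then have "(x k l [^]\<^bsub>GL_int n\<^esub> q) \<otimes>\<^bsub>GL_int n\<^esub> (x i j [^]\<^bsub>GL_int n\<^esub> p) = (x i j [^]\<^bsub>GL_int n\<^esub> p) \<otimes>\<^bsub>GL_int n\<^esub> (x k l [^]\<^bsub>GL_int n\<^esub> q)"
      using h by (intro GL.group_commutes_pow xGL xpow) auto
    then show ?thesis by simp
  qed
  have st: "steinberg n N w"
    unfolding steinberg_def
  proof (intro conjI allI impI)
    fix i j assume "i < j" "j < n"
    then show "w i j \<in> carrier (GL_int n)" by (intro wGL) auto
  next
    fix i j k l assume "i < j" "j < n" "k < l" "l < n" "j \<noteq> k" "i \<noteq> l"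
    then show "w i j * w k l = w k l * w i j"
      unfolding w_def by (intro comm1) (auto simp: N_def)
  next
    fix i j l assume ij: "i < j" "j < l" "l < n"
    define a b c where "a = x i j [^]\<^bsub>GL_int n\<^esub> N" and "b = x j l [^]\<^bsub>GL_int n\<^esub> N0" and "c = x i l [^]\<^bsub>GL_int n\<^esub> (N * N0)"
    have cr: "a \<in> carrier (GL_int n)" "b \<in> carrier (GL_int n)" "c \<in> carrier (GL_int n)"
      using ij unfolding a_def b_def c_def by (auto intro!: xpow)
    have "a \<otimes>\<^bsub>GL_int n\<^esub> (b \<otimes>\<^bsub>GL_int n\<^esub> b) = (c \<otimes>\<^bsub>GL_int n\<^esub> c) \<otimes>\<^bsub>GL_int n\<^esub> ((b \<otimes>\<^bsub>GL_int n\<^esub> b) \<otimes>\<^bsub>GL_int n\<^esub> a)"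
    proof (rule GL.commutator_square[OF s cr scomm ss])
      show "a \<otimes>\<^bsub>GL_int n\<^esub> b = c \<otimes>\<^bsub>GL_int n\<^esub> (b \<otimes>\<^bsub>GL_int n\<^esub> a) \<or> a \<otimes>\<^bsub>GL_int n\<^esub> b = s \<otimes>\<^bsub>GL_int n\<^esub> (c \<otimes>\<^bsub>GL_int n\<^esub> (b \<otimes>\<^bsub>GL_int n\<^esub> a))"
        using R2[of i j l N N0] ij unfolding a_def b_def c_def nat_pow_GL by simp
      have "c * b = b * c" unfolding b_def c_def using ij by (intro comm1) (auto simp: N_def)
      then show "c \<otimes>\<^bsub>GL_int n\<^esub> b = b \<otimes>\<^bsub>GL_int n\<^esub> c" by simp
    qed
    moreover have "b \<otimes>\<^bsub>GL_int n\<^esub> b = w j l"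
      unfolding b_def w_def N_def using xGL[of j l] ij by (subst GL.nat_pow_mult) (auto simp: mult_2)
    moreover have "c \<otimes>\<^bsub>GL_int n\<^esub> c = w i l [^]\<^bsub>GL_int n\<^esub> N"
    proof -
      have "c \<otimes>\<^bsub>GL_int n\<^esub> c = x i l [^]\<^bsub>GL_int n\<^esub> (N * N0 + N * N0)"
        unfolding c_def using xGL[of i l] ij by (intro GL.nat_pow_mult) auto
      also have "N * N0 + N * N0 = N * N" by (simp add: N_def)
      finally show ?thesis unfolding w_def using xGL[of i l] ij by (simp add: GL.nat_pow_pow)
    qed
    ultimately show "w i j * w j l = (w i l [^]\<^bsub>GL_int n\<^esub> N) * (w j l * w i j)"
      by (simp add: a_def w_def)
  qed
  have uni: "unipotent n (w i j)" if ij: "i < n" "j < n" "i \<noteq> j" for i j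
  proof -
    \<comment> \<open>A third index k exhibits the transvection at (i, j) as the commutator of those
      at (i, k) and (k, j), with which it commutes.\<close>
    have "card {i, j} < card {..<n}" using n3 by (metis card_2_iff card_lessThan ij(3) numeral_2_eq_2 numeral_3_eq_3 Suc_le_lessD)
    then have "\<not> {..<n} \<subseteq> {i, j}" using card_mono[of "{i, j}" "{..<n}"] by auto
    then obtain k where k: "k < n" "k \<noteq> i" "k \<noteq> j" by auto
    \<comment> \<open>The squares make z an even power of \<open>x i j\<close>, which commutes with
      R and Y exactly and not only up to sign.\<close>
    define R Y z where "R = x i k [^]\<^bsub>GL_int n\<^esub> (2::nat)" and "Y = x k j [^]\<^bsub>GL_int n\<^esub> (2::nat)" and "z = x i j [^]\<^bsub>GL_int n\<^esub> (2 * 2::nat)"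
    have cr: "R \<in> carrier (GL_int n)" "Y \<in> carrier (GL_int n)" "z \<in> carrier (GL_int n)"
      using ij k unfolding R_def Y_def z_def by (auto intro!: xpow)
    have zR: "z * R = R * z" unfolding z_def R_def using ij k by (intro comm1) auto
    have zY: "z * Y = Y * z" unfolding z_def Y_def using ij k by (intro comm1) auto
    have "R * Y = z * (Y * R) \<or> R * Y = s * (z * (Y * R))"
      using R2[of i k j 2 2] ij k unfolding R_def Y_def z_def nat_pow_GL by simp
    \<comment> \<open>The remaining sign is absorbed into Z; as m is even, Z and z have the same
      m-th power.\<close>
    then obtain Z where Z: "Z = z \<or> Z = s * z" "R * Y = Z * (Y * R)"
      using cr s by (metis GL_carrier_mat mult_carrier_mat_square sq_assoc)
    have ZGL: "Z \<in> carrier (GL_int n)" using Z(1) cr GL.m_closed[OF s cr(3)] by auto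
    have comm: "Z * C = C * Z" if C: "C \<in> carrier (GL_int n)" "z * C = C * z" for C
      using Z(1)
    proof
      assume "Z = s * z"
      note cm = GL_carrier_mat[OF C(1)] GL_carrier_mat[OF s] GL_carrier_mat[OF cr(3)]
      have "s * z * C = s * C * z" using C(2) cm by (simp add: sq_assoc[of _ n _ _ n])
      also have "\<dots> = C * (s * z)" using scomm[OF C(1)] cm by (simp add: sq_assoc[of _ n _ _ n])
      finally show ?thesis using \<open>Z = s * z\<close> by simp
    qed (use C in simp)
    have "(diff_op (mat_op Z) m ^^ (n * n)) v = 0" if "v \<in> vecs n" for v
    proof (rule heisenberg_unipotent[OF cr(1,2) ZGL Z(2) comm comm _ that])
      show "j dvd m" if "1 \<le> j" "j \<le> n * n" for j using that by (simp add: m_def dvd_fact)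
    qed (use cr zR zY in auto)
    moreover have "Z [^]\<^bsub>GL_int n\<^esub> m = w i j"
    proof -
      have "Z [^]\<^bsub>GL_int n\<^esub> m = z [^]\<^bsub>GL_int n\<^esub> m"
        using Z(1)
      proof
        assume e: "Z = s * z"
        obtain q where q: "m = 2 * q" using m0 by blast
        have "s [^]\<^bsub>GL_int n\<^esub> m = \<one>\<^bsub>GL_int n\<^esub>"
        proof -
          have "s [^]\<^bsub>GL_int n\<^esub> (2::nat) = \<one>\<^bsub>GL_int n\<^esub>" using ss s GL_carrier_mat[OF s] by (simp add: numeral_2_eq_2)
          then show ?thesis unfolding q using s by (simp del: one_GL_int flip: GL.nat_pow_pow)
        qed
        then show ?thesis
          using GL.pow_mult_distrib[OF scomm[OF cr(3)] s cr(3), of m] e GL_carrier_mat[OF GL.nat_pow_closed[OF cr(3), of m]]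
          by simp
      qed simp
      also have "\<dots> = w i j"
        unfolding z_def w_def N_def N0_def using xGL[OF ij] by (subst GL.nat_pow_pow) (auto simp: mult.assoc)
      finally show ?thesis .
    qed
    then have "diff_op (mat_op (w i j)) 1 = diff_op (mat_op Z) m"
      using mat_op_nat_pow[OF ZGL, of m] by (simp add: fun_eq_iff[of "diff_op _ _"] diff_op_def)
    ultimately show ?thesis unfolding unipotent_def by metis
  qed
  obtain P where P: "P \<in> carrier (SL_int n)" and
    tri: "\<And>i j. i < j \<Longrightarrow> j < n \<Longrightarrow> unitriangular n n (P * w i j * inv\<^bsub>GL_int n\<^esub> P)"
    using steinberg_triangular[OF st uni order_refl] by auto
  have PG: "P \<in> carrier (GL_int n)" using P by (rule SL_GL)
  have P\<Gamma>: "P \<in> carrier \<Gamma>" using P by (rule SL_carrier)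
  define w' where "w' i j = P * w i j * inv\<^bsub>GL_int n\<^esub> P" for i j
  define M where "M = w' 0 (n - 1) [^]\<^bsub>GL_int n\<^esub> (N ^ (n - 1 - 1))"
  \<comment> \<open>The total exponent of \<open>x 0 (n - 1)\<close>: N from \<open>w\<close>, and
    N^(n-2) from the level argument. A matrix of level n - 1 differs from 1 at most in the
    corner.\<close>
  define K where "K = N * N ^ (n - 1 - 1)"
  have xn: "x 0 (n - 1) \<in> carrier (GL_int n)" "w 0 (n - 1) \<in> carrier (GL_int n)"
    using xGL[of 0 "n - 1"] wGL[of 0 "n - 1"] n3 by auto
  have lev: "M $$ (r, c) = (if r = c then 1 else 0)" if "r < n" "c < n" "c < r + (n - 1)" for r c
    unfolding M_def
    by (rule steinberg_level) (use n3 that tri steinberg_conj[OF PG st] in \<open>auto simp: w'_def\<close>)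
  have Meq: "M = P * (x 0 (n - 1) [^]\<^bsub>GL_int n\<^esub> K) * inv\<^bsub>GL_int n\<^esub> P"
    unfolding M_def w'_def K_def using GL.conj_pow[OF PG xn(2)] GL.nat_pow_pow[OF xn(1)] by (simp add: w_def)
  have "x 0 (n - 1) [^]\<^bsub>GL_int n\<^esub> K \<in> carrier (GL_int n)" using xn by simp
  then have Mc: "M \<in> carrier_mat n n"
    unfolding Meq using PG by (intro mult_carrier_mat_square GL_carrier_mat) auto
  have Mel: "M = addrow_mat n (M $$ (0, n - 1)) 0 (n - 1)"
  proof (rule eq_matI)
    fix r c assume "r < dim_row (addrow_mat n (M $$ (0, n - 1)) 0 (n - 1))" "c < dim_col (addrow_mat n (M $$ (0, n - 1)) 0 (n - 1))"
    then have rc: "r < n" "c < n" by auto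
    then show "M $$ (r, c) = addrow_mat n (M $$ (0, n - 1)) 0 (n - 1) $$ (r, c)"
      using lev[OF rc] n3 by (cases "c < r + (n - 1)") auto
  qed (use Mc in auto)
  have xK: "x 0 (n - 1) [^]\<^bsub>\<Gamma>\<^esub> K \<in> carrier \<Gamma>" using xc[of 0 "n - 1"] n3 by simp
  have P': "inv\<^bsub>GL_int n\<^esub> P = inv\<^bsub>\<Gamma>\<^esub> P"
  proof (rule GL.inv_equality[OF _ PG])
    show "inv\<^bsub>\<Gamma>\<^esub> P \<otimes>\<^bsub>GL_int n\<^esub> P = \<one>\<^bsub>GL_int n\<^esub>" using l_inv[OF P\<Gamma>] by simp
    show "inv\<^bsub>\<Gamma>\<^esub> P \<in> carrier (GL_int n)" using P\<Gamma> by (intro carrier_GL) simp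
  qed
  have "proj M = proj P \<otimes>\<^bsub>PG\<^esub> proj (x 0 (n - 1) [^]\<^bsub>\<Gamma>\<^esub> K) \<otimes>\<^bsub>PG\<^esub> inv\<^bsub>PG\<^esub> (proj P)"
  proof -
    have "M = P \<otimes>\<^bsub>\<Gamma>\<^esub> (x 0 (n - 1) [^]\<^bsub>\<Gamma>\<^esub> K) \<otimes>\<^bsub>\<Gamma>\<^esub> inv\<^bsub>\<Gamma>\<^esub> P"
      unfolding Meq nat_pow_GL P' by simp
    then show ?thesis using P\<Gamma> xK by (simp del: mult_eq)
  qed
  then have "proj P \<otimes>\<^bsub>PG\<^esub> \<phi> (proj (addrow_mat n (int K) 0 (n - 1))) \<otimes>\<^bsub>PG\<^esub> inv\<^bsub>PG\<^esub> (proj P)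
    = proj (addrow_mat n (M $$ (0, n - 1)) 0 (n - 1))"
    using px[of 0 "n - 1" K] n3 Mel by simp
  moreover have "K > 0" using m0 by (simp add: K_def N_def N0_def)
  ultimately show ?thesis using P\<Gamma> by blast
qed

end

lemma (in group) iso_conj:
  assumes \<phi>: "\<phi> \<in> iso G G" and p: "p \<in> carrier G"
  shows "(\<lambda>x. p \<otimes> \<phi> x \<otimes> inv p) \<in> iso G G"
proof -
  have canc: "inv p \<otimes> (p \<otimes> z) = z" if "z \<in> carrier G" for z using p that by (simp add: m_assoc[symmetric])
  have "(\<lambda>x. p \<otimes> x \<otimes> inv p) \<in> iso G G"
    using conjugation_is_bij[OF p] p by (auto simp: iso_def m_assoc canc intro!: homI)
  from iso_set_trans[OF \<phi> this] show ?thesis by (simp add: comp_def)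
qed

section \<open>Centralisers of corner transvections\<close>

context int_matrix_group
begin

lemma GL_row_nonzero:
  assumes M: "M \<in> carrier (GL_int n)" and i: "i < n" and z: "\<And>c. c < n \<Longrightarrow> M $$ (i, c) = 0"
  shows False
proof -
  obtain B where B: "M \<in> carrier_mat n n" "B \<in> carrier_mat n n" "M * B = 1\<^sub>m n"
    using M by (auto simp: carrier_GL_int)
  have "(M * B) $$ (i, i) = (\<Sum>l<n. M $$ (i, l) * B $$ (l, i))"
    using B(1,2) i i by (rule index_mult_mat_sum)
  also have "\<dots> = 0" using z by (intro sum.neutral) simp
  finally show False using B(3) i by simp
qed

text \<open>Row l of such an M would vanish. Hence commuting with a transvection modulo the centre
  is the same as commuting with it as matrices.\<close>

lemma addrow_mat_not_anticommute:
  assumes M: "M \<in> carrier (GL_int n)" and kl: "k < n" "l < n" "k \<noteq> l"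
  shows "M * addrow_mat n a k l \<noteq> - (addrow_mat n a k l * M)"
proof
  assume e: "M * addrow_mat n a k l = - (addrow_mat n a k l * M)"
  have Mc: "M \<in> carrier_mat n n" using M by (rule GL_carrier_mat)
  have "addrow_mat n a k l * M \<in> carrier_mat n n" using Mc by simp
  then have ent: "(M * addrow_mat n a k l) $$ (i, c) = - (addrow_mat n a k l * M) $$ (i, c)" if "i < n" "c < n" for i c
    unfolding e using \<open>addrow_mat n a k l * M \<in> carrier_mat n n\<close> that by (auto dest!: carrier_matD)
  have ent': "(if c = l then a * M $$ (i, k) + M $$ (i, l) else M $$ (i, c)) = - M $$ (i, c)" if "i < n" "i \<noteq> k" "c < n" for i c
    using ent[of i c] that kl Mc by (simp add: index_addrow_mat_mult index_mult_addrow_mat)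
  have 1: "M $$ (l, c) = 0" if "c < n" "c \<noteq> l" for c
    using ent'[of l c] that kl by auto
  have "M $$ (l, l) = 0" using ent'[of l l] kl 1[of k] by auto
  then have "M $$ (l, c) = 0" if "c < n" for c using 1 that by (cases "c = l") auto
  then show False using GL_row_nonzero[OF M kl(2)] by blast
qed

lemma proj_commute_iff:
  assumes M: "M \<in> carrier \<Gamma>" and kl: "k < n" "l < n" "k \<noteq> l"
  shows "proj M \<otimes>\<^bsub>PG\<^esub> proj (addrow_mat n a k l) = proj (addrow_mat n a k l) \<otimes>\<^bsub>PG\<^esub> proj M \<longleftrightarrow>
    M * addrow_mat n a k l = addrow_mat n a k l * M"
  using proj_eq_iff[of "M * addrow_mat n a k l" "addrow_mat n a k l * M"] assms
    addrow_mat_not_anticommute[OF carrier_GL[OF M] kl, of a] m_closed[OF M addrow_carrier[OF kl, of a]]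
    m_closed[OF addrow_carrier[OF kl, of a] M]
  by (simp add: proj_mult)

definition corner :: "int \<Rightarrow> int mat set" where
  "corner a = proj (addrow_mat n a 0 (n - 1))"

lemma corner_bounds: "0 < n" "n - 1 < n" "0 \<noteq> n - 1" 
  using n2 by auto

lemma corner_carrier [simp]: "corner a \<in> carrier PG"
  unfolding corner_def using corner_bounds by simp

lemma corner_add: "corner a \<otimes>\<^bsub>PG\<^esub> corner b = corner (a + b)"
  unfolding corner_def using corner_bounds by (simp add: proj_mult addrow_mat_add)

lemma corner_zero [simp]: "corner 0 = \<one>\<^bsub>PG\<^esub>"
  using group_hom.hom_one[OF proj_group_hom] by (simp add: corner_def)

lemma corner_inj:
  assumes "corner a = corner b" shows "a = b"
proof -
  have "addrow_mat n a 0 (n - 1) = addrow_mat n b 0 (n - 1) \<or> addrow_mat n a 0 (n - 1) = - addrow_mat n b 0 (n - 1)"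
    using assms corner_bounds proj_eq_iff unfolding corner_def by simp
  then show ?thesis
  proof
    assume "addrow_mat n a 0 (n - 1) = addrow_mat n b 0 (n - 1)"
    from arg_cong[OF this, of "\<lambda>M. M $$ (0, n - 1)"] show ?thesis using corner_bounds by simp
  next
    assume "addrow_mat n a 0 (n - 1) = - addrow_mat n b 0 (n - 1)"
    from arg_cong[OF this, of "\<lambda>M. M $$ (0, 0)"] show ?thesis using corner_bounds by simp
  qed
qed

lemma corner_commute_iff:
  assumes g: "g \<in> carrier PG" and a: "a \<noteq> 0"
  shows "g \<otimes>\<^bsub>PG\<^esub> corner a = corner a \<otimes>\<^bsub>PG\<^esub> g \<longleftrightarrow> g \<otimes>\<^bsub>PG\<^esub> corner 1 = corner 1 \<otimes>\<^bsub>PG\<^esub> g"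
proof -
  obtain M where M: "M \<in> carrier \<Gamma>" "g = proj M" using g by (auto simp: carrier_PG)
  show ?thesis
    unfolding M(2) corner_def proj_commute_iff[OF M(1) corner_bounds]
    using commute_addrow_mat[OF carrier_mat[OF M(1)] corner_bounds a]
      commute_addrow_mat[OF carrier_mat[OF M(1)] corner_bounds, of 1] by simp
qed

text \<open>The transvections in the first row or in the last column centralise the corner.
  Commuting with all of them leaves only a multiple of 1 plus a corner entry, and the multiple is a
  sign.\<close>

lemma corner_bicommutant:
  assumes g: "g \<in> carrier PG"
    and com: "\<And>h. h \<in> carrier PG \<Longrightarrow> h \<otimes>\<^bsub>PG\<^esub> corner 1 = corner 1 \<otimes>\<^bsub>PG\<^esub> h \<Longrightarrow> g \<otimes>\<^bsub>PG\<^esub> h = h \<otimes>\<^bsub>PG\<^esub> g"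
  shows "\<exists>s. g = corner s"
proof -
  obtain M where M: "M \<in> carrier \<Gamma>" "g = proj M" using g by (auto simp: carrier_PG)
  have *: "M * addrow_mat n 1 k l = addrow_mat n 1 k l * M"
    if kl: "k < n" "l < n" "k \<noteq> l" and "k = 0 \<or> l = n - 1" for k l
  proof -
    have "addrow_mat n 1 k l * addrow_mat n 1 0 (n - 1) = addrow_mat n 1 0 (n - 1) * (addrow_mat n 1 k l :: int mat)"
      using kl that(4) corner_bounds by (intro addrow_mat_commute) auto
    then have "proj M \<otimes>\<^bsub>PG\<^esub> proj (addrow_mat n 1 k l) = proj (addrow_mat n 1 k l) \<otimes>\<^bsub>PG\<^esub> proj M"
      unfolding M(2)[symmetric] using kl corner_bounds by (intro com) (simp_all add: corner_def proj_mult)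
    then show ?thesis using proj_commute_iff[OF M(1) kl] by blast
  qed
  have row: "M $$ (j, c) = 0" if "0 < j" "j < n" "c < n" "c \<noteq> j" for j c
    using *[of 0 j] commute_addrow_mat[OF carrier_mat[OF M(1)], of 0 j 1] that by auto
  have dg: "M $$ (j, j) = M $$ (0, 0)" if "j < n" for j
    using *[of 0 j] commute_addrow_mat[OF carrier_mat[OF M(1)], of 0 j 1] that by (cases "j = 0") auto
  have col: "M $$ (0, i) = 0" if "0 < i" "i < n - 1" for i
    using *[of i "n - 1"] commute_addrow_mat[OF carrier_mat[OF M(1)], of i "n - 1" 1] that by auto
  define a b where "a = M $$ (0, 0)" and "b = M $$ (0, n - 1)"
  have a: "a = 1 \<or> a = -1"
  proof -
    obtain B where B: "B \<in> carrier_mat n n" "M * B = 1\<^sub>m n" using carrier_GL[OF M(1)] by (auto simp: carrier_GL_int)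
    have "(M * B) $$ (n - 1, n - 1) = a * B $$ (n - 1, n - 1)"
      using B(1) M(1) corner_bounds row[of "n - 1"] dg[of "n - 1"]
      by (subst index_mult_mat_sum[of _ n n _ n]) (auto simp: sum.remove[of _ "n - 1"] a_def)
    then have "a * B $$ (n - 1, n - 1) = 1" using B(2) corner_bounds by simp
    then show ?thesis using zmult_eq_1_iff by auto
  qed
  have ent: "M $$ (r, c) = a * addrow_mat n (a * b) 0 (n - 1) $$ (r, c)" if rc: "r < n" "c < n" for r c
  proof (cases "r = 0")
    case True
    have aa: "a * (a * b) = b" using a by auto
    consider "c = 0" | "0 < c" "c < n - 1" | "c = n - 1" using rc by linarith
    then show ?thesis using True col[of c] rc corner_bounds aa by cases (auto simp: a_def b_def)
  next
    case False
    then show ?thesis using row[of r c] dg[of r] rc by (cases "c = r") (auto simp: a_def)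
  qed
  have "M = addrow_mat n (a * b) 0 (n - 1) \<or> M = - addrow_mat n (a * b) 0 (n - 1)"
    using a
  proof
    assume "a = 1"
    then show ?thesis using ent carrier_mat[OF M(1)] by (intro disjI1 eq_matI) auto
  next
    assume "a = - 1"
    then show ?thesis using ent carrier_mat[OF M(1)] by (intro disjI2 eq_matI) auto
  qed
  then have "g = corner (a * b)"
    unfolding corner_def M(2) using proj_eq_iff[OF M(1)] corner_bounds by simp
  then show ?thesis by blast
qed

text \<open>The cyclic group of corner elements is the centre of the centraliser of each of its
  nontrivial elements.\<close>

lemma corner_image:
  assumes \<psi>: "\<psi> \<in> iso PG PG" and "\<psi> (corner a) = corner b" "a \<noteq> 0" "b \<noteq> 0"
  shows "\<exists>s. \<psi> (corner 1) = corner s"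
proof (rule corner_bicommutant)
  interpret \<psi>: group_hom PG PG \<psi> using \<psi> by (simp add: group_hom_def group_hom_axioms_def PG.is_group iso_def)
  have surj: "\<psi> ` carrier PG = carrier PG" and inj: "inj_on \<psi> (carrier PG)"
    using \<psi> by (auto simp: iso_def bij_betw_def)
  show "\<psi> (corner 1) \<in> carrier PG" by simp
  fix h assume h: "h \<in> carrier PG" "h \<otimes>\<^bsub>PG\<^esub> corner 1 = corner 1 \<otimes>\<^bsub>PG\<^esub> h"
  obtain h' where h': "h' \<in> carrier PG" "h = \<psi> h'" using h surj by (metis imageE)
  \<comment> \<open>\<open>corner 1\<close> and \<open>corner b\<close> have the same centraliser,
    so h pulls back along \<open>\<psi>\<close> to the centraliser of \<open>corner a\<close>, which
    is that of \<open>corner 1\<close>.\<close>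
  have "h \<otimes>\<^bsub>PG\<^esub> corner b = corner b \<otimes>\<^bsub>PG\<^esub> h" using corner_commute_iff[OF h(1) assms(4)] h by blast
  then have "\<psi> (h' \<otimes>\<^bsub>PG\<^esub> corner a) = \<psi> (corner a \<otimes>\<^bsub>PG\<^esub> h')" using h' assms(2) by simp
  then have "h' \<otimes>\<^bsub>PG\<^esub> corner a = corner a \<otimes>\<^bsub>PG\<^esub> h'" using inj_onD[OF inj] h' by simp
  then have "h' \<otimes>\<^bsub>PG\<^esub> corner 1 = corner 1 \<otimes>\<^bsub>PG\<^esub> h'" using corner_commute_iff[OF h'(1) assms(3)] by blast
  then have "\<psi> (h' \<otimes>\<^bsub>PG\<^esub> corner 1) = \<psi> (corner 1 \<otimes>\<^bsub>PG\<^esub> h')" by simp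
  then show "\<psi> (corner 1) \<otimes>\<^bsub>PG\<^esub> h = h \<otimes>\<^bsub>PG\<^esub> \<psi> (corner 1)" using h' by simp
qed

lemma corner_nat_pow: "corner a [^]\<^bsub>PG\<^esub> (k::nat) = corner (int k * a)"
  by (induction k) (simp_all add: corner_add algebra_simps)

lemma corner_hom:
  assumes "\<psi> \<in> hom PG PG" "\<psi> (corner 1) = corner s"
  shows "\<psi> (corner t) = corner (s * t)"
proof -
  interpret \<psi>: group_hom PG PG \<psi> using assms by (simp add: group_hom_def group_hom_axioms_def PG.is_group)
  have nat: "\<psi> (corner (int k)) = corner (s * int k)" for k
    using \<psi>.hom_nat_pow[of "corner 1" k] assms(2) by (simp add: corner_nat_pow mult.commute)
  show ?thesis
  proof (cases "t \<ge> 0")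
    case True
    then show ?thesis using nat[of "nat t"] by simp
  next
    case False
    have "\<psi> (corner t) \<otimes>\<^bsub>PG\<^esub> \<psi> (corner (int (nat (- t)))) = \<one>\<^bsub>PG\<^esub>"
      using False by (simp add: corner_add flip: \<psi>.hom_mult)
    then have "\<psi> (corner t) \<otimes>\<^bsub>PG\<^esub> corner (- (s * t)) = \<one>\<^bsub>PG\<^esub>" using nat[of "nat (- t)"] False by simp
    moreover have "corner (s * t) \<otimes>\<^bsub>PG\<^esub> corner (- (s * t)) = \<one>\<^bsub>PG\<^esub>" by (simp add: corner_add)
    ultimately show ?thesis using PG.r_cancel[of "\<psi> (corner t)" "corner (- (s * t))" "corner (s * t)"] by simp
  qed
qed

text \<open>T = diag(-1, -1, 1, ..., 1) has determinant 1. For n \<ge> 3 the last index is outside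
  the negative block, so conjugation negates the corner entry.\<close>

lemma sign_matrix:
  assumes n3: "n \<ge> 3"
  shows "\<exists>T\<in>carrier \<Gamma>. \<forall>a. T * addrow_mat n a 0 (n - 1) = addrow_mat n (- a) 0 (n - 1) * T"
proof -
  define T :: "int mat" where "T = mat n n (\<lambda>(i, j). if i = j then if i < 2 then -1 else 1 else 0)"
  have Tc: "T \<in> carrier_mat n n" by (simp add: T_def)
  have "det T = prod_list (diag_mat T)"
    by (rule det_upper_triangular[OF _ Tc]) (auto simp: T_def)
  also have "\<dots> = (\<Prod>i = 0..<n. T $$ (i, i))" using Tc by (simp add: prod_list_diag_prod)
  also have "\<dots> = T $$ (0, 0) * (T $$ (1, 1) * (\<Prod>i\<in>{0..<n} - {0} - {1}. T $$ (i, i)))"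
    using n3 by (simp add: prod.remove[of _ 0] prod.remove[of _ 1])
  also have "(\<Prod>i\<in>{0..<n} - {0} - {1}. T $$ (i, i)) = 1"
    by (rule prod.neutral) (auto simp: T_def)
  finally have "det T = 1" using n3 by (simp add: T_def)
  then have T: "T \<in> carrier \<Gamma>" using Tc by (intro SL_carrier) (simp add: carrier_SL_int)
  have "T * addrow_mat n a 0 (n - 1) = addrow_mat n (- a) 0 (n - 1) * T" for a
  proof (rule eq_matI)
    fix i j assume "i < dim_row (addrow_mat n (- a) 0 (n - 1) * T)" "j < dim_col (addrow_mat n (- a) 0 (n - 1) * T)"
    then have ij: "i < n" "j < n" using Tc by auto
    then show "(T * addrow_mat n a 0 (n - 1)) $$ (i, j) = (addrow_mat n (- a) 0 (n - 1) * T) $$ (i, j)"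
      using n3 index_mult_addrow_mat[OF Tc, of 0 i j a "n - 1"] index_addrow_mat_mult[OF Tc, of "n - 1" i j "- a" 0]
      by (auto simp: T_def)
  qed (use Tc in auto)
  then show ?thesis using T by blast
qed

lemma fixed_element_ge_3:
  assumes n3: "n \<ge> 3" and \<phi>: "\<phi> \<in> iso PG PG"
  shows "\<exists>g\<in>carrier PG. \<exists>e\<in>carrier PG. g \<otimes>\<^bsub>PG\<^esub> \<phi> e \<otimes>\<^bsub>PG\<^esub> inv\<^bsub>PG\<^esub> g = e \<and> (\<forall>k>0. e [^]\<^bsub>PG\<^esub> (k::nat) \<noteq> \<one>\<^bsub>PG\<^esub>)"
proof -
  have \<phi>h: "\<phi> \<in> hom PG PG" using \<phi> by (simp add: iso_def)
  obtain P K c where P: "P \<in> carrier \<Gamma>" "K > 0"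
    and Pc: "proj P \<otimes>\<^bsub>PG\<^esub> \<phi> (corner (int K)) \<otimes>\<^bsub>PG\<^esub> inv\<^bsub>PG\<^esub> (proj P) = corner c"
    using hom_transvection[OF n3 \<phi>h] unfolding corner_def by blast
  define p where "p = proj P"
  have p: "p \<in> carrier PG" using P by (simp add: p_def)
  define \<psi> where "\<psi> x = p \<otimes>\<^bsub>PG\<^esub> \<phi> x \<otimes>\<^bsub>PG\<^esub> inv\<^bsub>PG\<^esub> p" for x
  have \<psi>: "\<psi> \<in> iso PG PG"
    unfolding \<psi>_def using \<phi> p by (rule PG.iso_conj)
  have \<psi>h: "\<psi> \<in> hom PG PG" and bij: "bij_betw \<psi> (carrier PG) (carrier PG)" using \<psi> by (auto simp: iso_def)
  interpret \<psi>: group_hom PG PG \<psi> using \<psi>h by (simp add: group_hom_def group_hom_axioms_def PG.is_group)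
  have \<psi>K: "\<psi> (corner (int K)) = corner c" using Pc by (simp add: \<psi>_def p_def)
  have inj: "x = y" if "\<psi> x = \<psi> y" "x \<in> carrier PG" "y \<in> carrier PG" for x y
    using bij that by (auto simp: bij_betw_def inj_on_def)
  have c0: "c \<noteq> 0"
  proof
    assume "c = 0"
    then have "corner (int K) = corner 0" using \<psi>K inj[of "corner (int K)" "corner 0"] by simp
    then show False using corner_inj[of "int K" 0] P by simp
  qed
  obtain s where s: "\<psi> (corner 1) = corner s" using corner_image[OF \<psi> \<psi>K] c0 P by auto
  \<comment> \<open>The inverse automorphism satisfies the hypotheses of \<open>corner_image\<close>
    with the roles of c and K exchanged. Composing the two shows that s is a unit.\<close>
  define \<chi> where "\<chi> = inv_into (carrier PG) \<psi>"
  have \<chi>: "\<chi> \<in> iso PG PG" unfolding \<chi>_def by (rule PG.iso_set_sym[OF \<psi>])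
  have \<chi>c: "\<chi> (corner c) = corner (int K)"
    using \<psi>K bij by (metis \<chi>_def bij_betw_inv_into_left corner_carrier)
  obtain s' where s': "\<chi> (corner 1) = corner s'" using corner_image[OF \<chi> \<chi>c] c0 P by auto
  have "corner 1 = \<psi> (\<chi> (corner 1))"
    using bij by (metis \<chi>_def bij_betw_inv_into_right corner_carrier)
  also have "\<dots> = corner (s * s')" using corner_hom[OF \<psi>h s] by (simp add: s')
  finally have "s * s' = 1" using corner_inj by force
  then have s1: "s = 1 \<or> s = -1" using zmult_eq_1_iff by blast
  have ord: "\<forall>k>0. corner 1 [^]\<^bsub>PG\<^esub> (k::nat) \<noteq> \<one>\<^bsub>PG\<^esub>"
    using corner_inj[of _ 0] by (fastforce simp: corner_nat_pow)
  show ?thesis using s1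
  proof
    assume "s = 1"
    then show ?thesis using s p ord by (intro bexI[of _ p] bexI[of _ "corner 1"]) (auto simp: \<psi>_def)
  next
    assume "s = -1"
    obtain T where T: "T \<in> carrier \<Gamma>" "\<And>a. T * addrow_mat n a 0 (n - 1) = addrow_mat n (- a) 0 (n - 1) * T"
      using sign_matrix[OF n3] by blast
    have tc: "proj T \<otimes>\<^bsub>PG\<^esub> corner (- 1) = corner 1 \<otimes>\<^bsub>PG\<^esub> proj T"
      unfolding corner_def using T(1) T(2)[of "-1"] corner_bounds by (simp add: proj_mult)
    define g where "g = proj T \<otimes>\<^bsub>PG\<^esub> p"
    have pT: "proj T \<in> carrier PG" using T by simp
    have "g \<otimes>\<^bsub>PG\<^esub> \<phi> (corner 1) \<otimes>\<^bsub>PG\<^esub> inv\<^bsub>PG\<^esub> g = proj T \<otimes>\<^bsub>PG\<^esub> \<psi> (corner 1) \<otimes>\<^bsub>PG\<^esub> inv\<^bsub>PG\<^esub> (proj T)"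
      using p pT hom_in_carrier[OF \<phi>h, of "corner 1"] by (simp add: g_def \<psi>_def PG.inv_mult_group PG.m_assoc)
    also have "\<dots> = corner 1" using s \<open>s = -1\<close> tc pT by (simp add: PG.m_assoc)
    finally show ?thesis using p pT ord by (intro bexI[of _ g] bexI[of _ "corner 1"]) (auto simp: g_def)
  qed
qed

end

section \<open>Dimension two\<close>

text \<open>The relations are those of the tetrahedral group (order 12) or of S_3 (order 6), so all
  elements of the generated group can be listed.\<close>

lemma (in group) exponent_6:
  assumes s: "s \<in> carrier G" "s \<otimes> s = \<one>" and u: "u \<in> carrier G" "u \<otimes> (u \<otimes> u) = \<one>"
    and su: "(s \<otimes> u) \<otimes> ((s \<otimes> u) \<otimes> (s \<otimes> u)) = \<one> \<or> (s \<otimes> u) \<otimes> (s \<otimes> u) = \<one>"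
    and x: "x \<in> generate G {s, u}"
  shows "x [^] (6::nat) = \<one>"
proof -
  have six: "y [^] (6::nat) = y \<otimes> (y \<otimes> (y \<otimes> (y \<otimes> (y \<otimes> (y \<otimes> \<one>)))))" if "y \<in> carrier G" for y
    using that by (simp add: eval_nat_numeral m_assoc)
  have ss: "s \<otimes> (s \<otimes> z) = z" if "z \<in> carrier G" for z
    using s u that by (simp add: m_assoc[symmetric])
  have uuu: "u \<otimes> (u \<otimes> (u \<otimes> z)) = z" if "z \<in> carrier G" for z
  proof -
    have "u \<otimes> (u \<otimes> (u \<otimes> z)) = (u \<otimes> (u \<otimes> u)) \<otimes> z" using u(1) that by (simp add: m_assoc)
    then show ?thesis using u that by simp
  qed
  have inv: "inv s = s" "inv u = u \<otimes> u"
    using s u by (auto intro!: inv_equality simp: m_assoc)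
  \<comment> \<open>As s^-1 = s and u^-1 = u^2, a set that contains 1 and is closed under left
    multiplication by s and u contains the generated group.\<close>
  have clos: "x \<in> E"
    if one: "\<one> \<in> E" and E: "E \<subseteq> carrier G" and sE: "\<And>y. y \<in> E \<Longrightarrow> s \<otimes> y \<in> E" and uE: "\<And>y. y \<in> E \<Longrightarrow> u \<otimes> y \<in> E" for E
  proof -
    have "\<forall>y\<in>E. z \<otimes> y \<in> E" if "z \<in> generate G {s, u}" for z
      using that
    proof (induction rule: generate.induct)
      case one
      then show ?case using E by auto
    next
      case (incl h)
      then show ?case using sE uE by auto
    next
      case (inv h)
      then show ?case using sE uE E u(1) \<open>inv s = s\<close> \<open>inv u = u \<otimes> u\<close> by (auto simp: m_assoc subset_iff)
    next
      case (eng h1 h2)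
      have "h1 \<in> carrier G" "h2 \<in> carrier G" using eng(1,2) generate_in_carrier[of "{s, u}"] s u by auto
      then show ?case using eng E by (auto simp: m_assoc subset_iff)
    qed
    then have "x \<otimes> \<one> \<in> E" using x one by blast
    moreover have "x \<in> carrier G" using x generate_in_carrier[of "{s, u}"] s u by auto
    ultimately show ?thesis by simp
  qed
  from su show ?thesis
  proof
    assume "(s \<otimes> u) \<otimes> ((s \<otimes> u) \<otimes> (s \<otimes> u)) = \<one>"
    then have susu: "s \<otimes> (u \<otimes> (s \<otimes> (u \<otimes> (s \<otimes> u)))) = \<one>" using s(1) u(1) by (simp add: m_assoc)
    \<comment> \<open>p and q are the conjugates of s by u and u^2, and (s u)^3 = 1 becomes s p q =
      1. So 1, s, p, q multiply as in a Klein four-group, on which u acts cyclically.\<close>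
    define p where "p = u \<otimes> (s \<otimes> (u \<otimes> u))"
    define q where "q = u \<otimes> (u \<otimes> (s \<otimes> u))"
    have c: "p \<in> carrier G" "q \<in> carrier G" using s u by (auto simp: p_def q_def)
    have pp: "p \<otimes> p = \<one>" "q \<otimes> q = \<one>"
      using s u by (simp_all add: p_def q_def m_assoc ss uuu)
    have us: "u \<otimes> s = p \<otimes> u" "u \<otimes> p = q \<otimes> u" "u \<otimes> q = s \<otimes> u"
      using s u by (simp_all add: p_def q_def m_assoc uuu)
    have spq: "s \<otimes> (p \<otimes> q) = \<one>"
      using s u susu by (simp add: p_def q_def m_assoc uuu)
    have ppz: "p \<otimes> (p \<otimes> z) = z" "q \<otimes> (q \<otimes> z) = z" if "z \<in> carrier G" for z
      using pp c that by (simp_all add: m_assoc[symmetric])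
    have "s \<otimes> (s \<otimes> (p \<otimes> q)) = s" using spq s by simp
    then have pq: "p \<otimes> q = s" using s c by (simp add: ss)
    have sp: "s \<otimes> p = q"
    proof -
      have "s \<otimes> p = (s \<otimes> (p \<otimes> q)) \<otimes> q" using s c pp by (simp add: m_assoc)
      then show ?thesis using spq c by simp
    qed
    have ps: "p \<otimes> s = q" using ppz(1)[of q] pq c by simp
    have sq: "s \<otimes> q = p" using ss[of p] sp c by simp
    have qp: "q \<otimes> p = s" using sp s c pp by (metis m_assoc r_one)
    have qs: "q \<otimes> s = p" using ppz(2)[of p] qp c by simp
    have z: "u \<otimes> (s \<otimes> z) = p \<otimes> (u \<otimes> z)" "u \<otimes> (p \<otimes> z) = q \<otimes> (u \<otimes> z)" "u \<otimes> (q \<otimes> z) = s \<otimes> (u \<otimes> z)"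
      "s \<otimes> (p \<otimes> z) = q \<otimes> z" "p \<otimes> (s \<otimes> z) = q \<otimes> z" "s \<otimes> (q \<otimes> z) = p \<otimes> z" "q \<otimes> (s \<otimes> z) = p \<otimes> z"
      "p \<otimes> (q \<otimes> z) = s \<otimes> z" "q \<otimes> (p \<otimes> z) = s \<otimes> z"
      if "z \<in> carrier G" for z
      using us sp ps sq qs pq qp s(1) u(1) c that by (simp_all add: m_assoc[symmetric])
    define E where "E = (\<Union>w\<in>{\<one>, u, u \<otimes> u}. {w, s \<otimes> w, p \<otimes> w, q \<otimes> w})"
    have "x \<in> E"
    proof (rule clos)
      show "\<one> \<in> E" by (simp add: E_def)
      show "E \<subseteq> carrier G" using s u c by (auto simp: E_def)
      show "s \<otimes> y \<in> E" if "y \<in> E" for y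
        using that s u c by (auto simp: E_def ss z sp sq)
      show "u \<otimes> y \<in> E" if "y \<in> E" for y
        using that s u c by (auto simp: E_def z us)
    qed
    then show ?thesis
      unfolding E_def using s u c by (auto simp: six m_assoc ss uuu z ppz us sp ps sq qs pq qp pp)
  next
    assume "(s \<otimes> u) \<otimes> (s \<otimes> u) = \<one>"
    then have susu: "s \<otimes> (u \<otimes> (s \<otimes> u)) = \<one>" using s(1) u(1) by (simp add: m_assoc)
    then have "s \<otimes> (s \<otimes> (u \<otimes> (s \<otimes> u))) = s" using s by simp
    then have usu: "u \<otimes> (s \<otimes> u) = s" using s u by (simp add: ss)
    have us: "u \<otimes> s = s \<otimes> (u \<otimes> u)"
    proof -
      have "u \<otimes> s = (u \<otimes> (s \<otimes> u)) \<otimes> (u \<otimes> u)" using s u by (simp add: m_assoc)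
      then show ?thesis using usu by simp
    qed
    have usz: "u \<otimes> (s \<otimes> z) = s \<otimes> (u \<otimes> (u \<otimes> z))" if "z \<in> carrier G" for z
      using us s(1) u(1) that by (metis m_assoc m_closed)
    define E where "E = {\<one>, u, u \<otimes> u, s, s \<otimes> u, s \<otimes> (u \<otimes> u)}"
    have "x \<in> E"
    proof (rule clos)
      show "\<one> \<in> E" by (simp add: E_def)
      show "E \<subseteq> carrier G" using s u by (auto simp: E_def)
      show "s \<otimes> y \<in> E" if "y \<in> E" for y
        using that s u by (auto simp: E_def ss)
      show "u \<otimes> y \<in> E" if "y \<in> E" for y
        using that s u by (auto simp: E_def us usz uuu)
    qed
    then show ?thesis
      unfolding E_def using s u by (auto simp: six m_assoc ss uuu usz us)
  qed
qed

section \<open>Elements of finite order among two by two integer matrices\<close>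

definition mat2 :: "int \<Rightarrow> int \<Rightarrow> int \<Rightarrow> int \<Rightarrow> int mat" where
  "mat2 a b c d = mat 2 2 (\<lambda>(i, j). if i = 0 then if j = 0 then a else b else if j = 0 then c else d)"

lemma mat2_carrier [simp]: "mat2 a b c d \<in> carrier_mat 2 2"
  by (simp add: mat2_def)

lemma mat2_eq_iff [simp]: "mat2 a b c d = mat2 a' b' c' d' \<longleftrightarrow> a = a' \<and> b = b' \<and> c = c' \<and> d = d'"
proof
  assume e: "mat2 a b c d = mat2 a' b' c' d'"
  from arg_cong[OF e, of "\<lambda>M. M $$ (0, 0)"] arg_cong[OF e, of "\<lambda>M. M $$ (0, 1)"]
    arg_cong[OF e, of "\<lambda>M. M $$ (1, 0)"] arg_cong[OF e, of "\<lambda>M. M $$ (1, 1)"]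
  show "a = a' \<and> b = b' \<and> c = c' \<and> d = d'" by (simp add: mat2_def)
qed simp

lemma mat2_cases:
  assumes "A \<in> carrier_mat 2 2" obtains a b c d where "A = mat2 a b c d"
proof (rule that)
  show "A = mat2 (A $$ (0, 0)) (A $$ (0, 1)) (A $$ (1, 0)) (A $$ (1, 1))"
    using assms by (intro eq_matI) (auto simp: mat2_def less_2_cases_iff)
qed

lemma mat2_mult [simp]: "mat2 a b c d * mat2 a' b' c' d' =
  mat2 (a * a' + b * c') (a * b' + b * d') (c * a' + d * c') (c * b' + d * d')"
  by (intro eq_matI)
    (auto simp: mat2_def less_2_cases_iff index_mult_mat(1) scalar_prod_def numeral_2_eq_2)

lemma mat2_uminus [simp]: "- mat2 a b c d = mat2 (- a) (- b) (- c) (- d)"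
  by (intro eq_matI) (auto simp: mat2_def less_2_cases_iff)

lemma one_mat2: "1\<^sub>m 2 = mat2 1 0 0 1"
  by (intro eq_matI) (auto simp: mat2_def less_2_cases_iff)

lemma det_mat2 [simp]: "det (mat2 a b c d) = a * d - b * c"
proof -
  have "cofactor (mat2 a b c d) 0 0 = d" "cofactor (mat2 a b c d) 0 (Suc 0) = - c"
    by (simp_all add: cofactor_def mat_delete_def mat2_def det_single)
  then show ?thesis
    using laplace_expansion_row[of "mat2 a b c d" 2 0] by (simp add: lessThan_nat_numeral) (simp add: mat2_def)
qed

lemma addrow_mat2: "addrow_mat 2 a 0 1 = mat2 1 a 0 1" "addrow_mat 2 a 1 0 = mat2 1 0 a 1"
  by (auto intro!: eq_matI simp: mat2_def less_2_cases_iff)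

text \<open>By Cayley-Hamilton A^3 = (t^2 - \<delta>) A - t \<delta> with trace t and determinant
  \<delta>. If the coefficient of A were nonzero, A would be scalar, hence 1 or -1. So t^2 =
  \<delta>.\<close>

lemma order_3_trace:
  assumes det: "a * d - b * c = 1 \<or> a * d - b * c = (-1::int)"
    and cube: "mat2 a b c d * (mat2 a b c d * mat2 a b c d) = 1\<^sub>m 2 \<or> mat2 a b c d * (mat2 a b c d * mat2 a b c d) = - 1\<^sub>m 2"
    and ne: "mat2 a b c d \<noteq> 1\<^sub>m 2" "mat2 a b c d \<noteq> - 1\<^sub>m 2"
  shows "a * d - b * c = 1 \<and> (a + d = 1 \<or> a + d = -1)"
proof -
  define \<delta> t where "\<delta> = a * d - b * c" and "t = a + d"
  define r where "r = t * t - \<delta>"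
  have cb: "mat2 a b c d * (mat2 a b c d * mat2 a b c d) = mat2 (r * a - t * \<delta>) (r * b) (r * c) (r * d - t * \<delta>)"
    by (simp add: r_def t_def \<delta>_def algebra_simps)
  have "r = 0"
  proof (rule ccontr)
    assume r: "r \<noteq> 0"
    then have bc: "b = 0" "c = 0" using cube unfolding cb one_mat2 by auto
    have "r * a = r * d" using cube unfolding cb one_mat2 mat2_uminus mat2_eq_iff by linarith
    then have "a = d" using r by simp
    then have "a * a = 1 \<or> a * a = -1" using det bc by simp
    then have "a * a = 1" using zero_le_square[of a] by linarith
    then have "a = 1 \<or> a = -1" using zmult_eq_1_iff by auto
    then show False using ne bc \<open>a = d\<close> by (auto simp: one_mat2)
  qed
  then have tt: "t * t = \<delta>" by (simp add: r_def)
  then have "\<delta> = 1" using det zero_le_square[of t] by (auto simp: \<delta>_def)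
  then have "t = 1 \<or> t = -1" using tt zmult_eq_1_iff by auto
  then show ?thesis using \<open>\<delta> = 1\<close> by (simp add: \<delta>_def t_def)
qed

text \<open>By Cayley-Hamilton A^2 = t A - 1; a nonzero trace t would make A scalar.\<close>

lemma order_2_trace:
  assumes det: "a * d - b * c = (1::int)"
    and sq: "mat2 a b c d * mat2 a b c d = 1\<^sub>m 2 \<or> mat2 a b c d * mat2 a b c d = - 1\<^sub>m 2"
    and ne: "mat2 a b c d \<noteq> 1\<^sub>m 2" "mat2 a b c d \<noteq> - 1\<^sub>m 2"
  shows "d = - a"
proof -
  define t where "t = a + d"
  have e: "mat2 a b c d * mat2 a b c d = mat2 (t * a - 1) (t * b) (t * c) (t * d - 1)"
    using det by (simp add: t_def algebra_simps)
  have "t = 0"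
  proof (rule ccontr)
    assume t: "t \<noteq> 0"
    then have bc: "b = 0" "c = 0" using sq unfolding e one_mat2 by auto
    have "t * a = t * d" using sq unfolding e one_mat2 mat2_uminus mat2_eq_iff by linarith
    then have "a = d" using t by simp
    then have "a = 1 \<or> a = -1" using det bc zmult_eq_1_iff[of a a] by auto
    then show False using ne bc \<open>a = d\<close> by (auto simp: one_mat2)
  qed
  then show ?thesis by (simp add: t_def)
qed

text \<open>The companion matrix of x^2 - x + 1, a root of which is a primitive sixth root of unity:
  it has order 3 modulo sign.\<close>

abbreviation "U2 \<equiv> mat2 0 (-1) 1 1"

text \<open>Reduction theory of the binary quadratic form \<open>det (v, A v)\<close> of discriminant \<open>-3\<close>.\<close>

lemma order_3_conj:
  assumes "a * d - b * c = (1::int)" "a + d = 1"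
  shows "\<exists>p q r s. (p * s - q * r = 1 \<or> p * s - q * r = -1) \<and> mat2 a b c d * mat2 p q r s = mat2 p q r s * U2"
  using assms
proof (induction "nat \<bar>c\<bar>" arbitrary: a b c d rule: less_induct)
  case less
  have c0: "c \<noteq> 0"
  proof
    assume "c = 0"
    then have "a * d = 1" using less.prems by simp
    then have "a = d" "a = 1 \<or> a = -1" by (auto simp: zmult_eq_1_iff)
    then show False using less.prems(2) by presburger
  qed
  show ?case
  proof (cases "\<bar>c\<bar> = 1")
    case True
    \<comment> \<open>The columns of the conjugator are the first basis vector and its image under
      A; they form a basis because c is a unit.\<close>
    have "mat2 a b c d * mat2 1 a 0 c = mat2 1 a 0 c * U2"
    proof -
      have d: "d = 1 - a" using less.prems by simp
      have "b * c = a * (1 - a) - 1" using less.prems(1) unfolding d by simp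
      then show ?thesis unfolding d by (simp add: algebra_simps)
    qed
    then show ?thesis using True by (intro exI[of _ 1] exI[of _ a] exI[of _ 0] exI[of _ c]) auto
  next
    case False
    \<comment> \<open>The rounded quotient for which the shear by k brings 2 a' - 1 between -|c| and
      |c|; k carries the sign of c.\<close>
    define Q where "Q = (2 * a - 1 + \<bar>c\<bar>) div (2 * \<bar>c\<bar>)"
    define k where "k = - Q * sgn c"
    define a' b' d' where "a' = a + k * c" and "b' = b + k * d - k * a - k * k * c" and "d' = d - k * c"
    have kc: "k * c = - (\<bar>c\<bar> * Q)" by (simp add: k_def abs_sgn[of c] mult.assoc mult.commute)
    define R where "R = (2 * a - 1 + \<bar>c\<bar>) mod (2 * \<bar>c\<bar>)"
    have "2 * a - 1 + \<bar>c\<bar> = 2 * (\<bar>c\<bar> * Q) + R"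
      unfolding Q_def R_def by (simp only: mult.assoc[symmetric] mult_div_mod_eq)
    moreover have "0 \<le> R" "R < 2 * \<bar>c\<bar>" using c0 by (simp_all add: R_def)
    moreover have "a' = a - \<bar>c\<bar> * Q" by (simp add: a'_def kc)
    ultimately have "2 * a' - 1 = R - \<bar>c\<bar>" "0 \<le> R" "R < 2 * \<bar>c\<bar>" by auto
    then have small: "\<bar>2 * a' - 1\<bar> \<le> \<bar>c\<bar>" by linarith
    have det': "a' * d' - b' * c = 1" "a' + d' = 1"
      using less.prems by (simp_all add: a'_def b'_def d'_def algebra_simps)
    \<comment> \<open>The discriminant: (2 a' - 1)^2 + 4 b' c = -3. Together with |c| \<ge> 2 it
      forces |b'| < |c|.\<close>
    have "4 * (b' * c) = - 3 - (2 * a' - 1) * (2 * a' - 1)"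
    proof -
      have d': "d' = 1 - a'" using det' by simp
      show ?thesis using det'(1) unfolding d' by (simp add: algebra_simps)
    qed
    moreover have "(2 * a' - 1) * (2 * a' - 1) \<le> \<bar>c\<bar> * \<bar>c\<bar>"
      unfolding abs_mult_self_eq[of "2 * a' - 1", symmetric] using small by (intro mult_mono) auto
    moreover have "0 \<le> (2 * a' - 1) * (2 * a' - 1)" by simp
    moreover have "2 * 2 \<le> \<bar>c\<bar> * \<bar>c\<bar>" using False c0 by (intro mult_mono) linarith+
    ultimately have "\<bar>b' * c\<bar> < \<bar>c\<bar> * \<bar>c\<bar>" by linarith
    then have "\<bar>b'\<bar> * \<bar>c\<bar> < \<bar>c\<bar> * \<bar>c\<bar>" unfolding abs_mult .
    then have lt: "\<bar>b'\<bar> < \<bar>c\<bar>" by (rule mult_right_less_imp_less) simp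
    \<comment> \<open>Interchanging the basis vectors puts b' in the place of c, which makes the
      induction descend.\<close>
    have "d' * a' - c * b' = 1" "d' + a' = 1" using det' by (simp_all add: mult.commute add.commute)
    moreover have "nat \<bar>b'\<bar> < nat \<bar>c\<bar>" using lt by simp
    ultimately obtain p q r s where
      h: "p * s - q * r = 1 \<or> p * s - q * r = -1" "mat2 d' c b' a' * mat2 p q r s = mat2 p q r s * U2"
      using less.hyps by blast
    have "mat2 a b c d * (mat2 (- k) 1 1 0 * mat2 p q r s) = (mat2 a b c d * mat2 (- k) 1 1 0) * mat2 p q r s"
      by (intro sq_assoc[symmetric, of _ 2 _ _ 2]) auto
    also have "mat2 a b c d * mat2 (- k) 1 1 0 = mat2 (- k) 1 1 0 * mat2 d' c b' a'"
      by (simp add: a'_def b'_def d'_def algebra_simps)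
    also have "\<dots> * mat2 p q r s = mat2 (- k) 1 1 0 * (mat2 p q r s * U2)"
      unfolding h(2)[symmetric] by (intro sq_assoc[of _ 2 _ _ 2]) auto
    also have "\<dots> = (mat2 (- k) 1 1 0 * mat2 p q r s) * U2"
      by (intro sq_assoc[symmetric, of _ 2 _ _ 2]) auto
    finally have "mat2 a b c d * mat2 (r - k * p) (s - k * q) p q = mat2 (r - k * p) (s - k * q) p q * U2"
      by (simp add: algebra_simps)
    moreover have "(r - k * p) * q - (s - k * q) * p = 1 \<or> (r - k * p) * q - (s - k * q) * p = -1"
      using h(1) by (auto simp: algebra_simps)
    ultimately show ?thesis by blast
  qed
qed

lemma (in group) conj_eq_iff:
  assumes "y \<in> carrier G" "x \<in> carrier G" "z \<in> carrier G"
  shows "inv y \<otimes> x \<otimes> y = z \<longleftrightarrow> x \<otimes> y = y \<otimes> z"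
proof
  assume "inv y \<otimes> x \<otimes> y = z"
  then have "y \<otimes> z = y \<otimes> (inv y \<otimes> (x \<otimes> y))" using assms by (simp add: m_assoc)
  also have "\<dots> = x \<otimes> y" using assms by (simp add: m_assoc[symmetric])
  finally show "x \<otimes> y = y \<otimes> z" by simp
next
  assume "x \<otimes> y = y \<otimes> z"
  then have "inv y \<otimes> (x \<otimes> y) = z" using assms by (simp add: m_assoc[symmetric])
  then show "inv y \<otimes> x \<otimes> y = z" using assms by (simp add: m_assoc)
qed

text \<open>A and -A are the same projective element, and one of them has trace 1.\<close>

lemma order_3_conj_U2:
  assumes A: "A \<in> carrier (GL_int 2)" and cube: "A * (A * A) = 1\<^sub>m 2 \<or> A * (A * A) = - 1\<^sub>m 2"
    and ne: "A \<noteq> 1\<^sub>m 2" "A \<noteq> - 1\<^sub>m 2"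
  shows "\<exists>h\<in>carrier (GL_int 2). A * h = h * U2 \<or> A * h = - (h * U2)"
proof -
  obtain a b c d where Ae: "A = mat2 a b c d" using A mat2_cases[of A] unfolding GL_int_iff_det by blast
  have "a * d - b * c = 1 \<and> (a + d = 1 \<or> a + d = -1)"
    using A cube ne unfolding Ae by (intro order_3_trace) (auto simp only: GL_int_iff_det det_mat2)
  then have det: "a * d - b * c = 1" and tr: "a + d = 1 \<or> a + d = -1" by auto
  from tr show ?thesis
  proof
    assume "a + d = 1"
    then obtain p q r s where "p * s - q * r = 1 \<or> p * s - q * r = -1" "mat2 a b c d * mat2 p q r s = mat2 p q r s * U2"
      using order_3_conj[OF det] by blast
    then show ?thesis unfolding Ae by (intro bexI[of _ "mat2 p q r s"] disjI1) (simp_all add: GL_int_iff_det)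
  next
    assume "a + d = -1"
    then obtain p q r s where h: "p * s - q * r = 1 \<or> p * s - q * r = -1"
      "mat2 (-a) (-b) (-c) (-d) * mat2 p q r s = mat2 p q r s * U2"
      using order_3_conj[of "-a" "-d" "-b" "-c"] det by auto
    have "mat2 a b c d * mat2 p q r s = - (mat2 (-a) (-b) (-c) (-d) * mat2 p q r s)" by simp
    then have "mat2 a b c d * mat2 p q r s = - (mat2 p q r s * U2)" unfolding h(2) .
    then show ?thesis unfolding Ae using h(1) by (intro bexI[of _ "mat2 p q r s"] disjI2) (simp_all add: GL_int_iff_det)
  qed
qed

text \<open>This is the norm form of the Eisenstein integers and these are their six units. The
  identity 4 (a^2 - a b + b^2) = (2 a - b)^2 + 3 b^2 bounds b.\<close>

lemma norm_form_eq_1: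
  assumes "a * a - a * b + b * b = (1::int)"
  shows "(a, b) \<in> {(1, 0), (-1, 0), (0, 1), (0, -1), (1, 1), (-1, -1)}"
proof -
  have "(2 * a - b) * (2 * a - b) + 3 * (b * b) = 4" using assms by (simp add: algebra_simps)
  moreover have "0 \<le> (2 * a - b) * (2 * a - b)" by simp
  ultimately have bb: "b * b \<le> 1" by linarith
  have "\<bar>b\<bar> \<le> 1"
  proof (rule ccontr)
    assume "\<not> ?thesis"
    then have "2 * 2 \<le> \<bar>b\<bar> * \<bar>b\<bar>" by (intro mult_mono) auto
    then show False using bb by simp
  qed
  then consider "b = 0" | "b = 1" | "b = -1" by linarith
  then show ?thesis
  proof cases
    case 1
    then show ?thesis using assms zmult_eq_1_iff[of a a] by auto
  next
    case 2
    then have "a * (a - 1) = 0" using assms by (simp add: algebra_simps)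
    then show ?thesis using 2 by auto
  next
    case 3
    then have "a * (a + 1) = 0" using assms by (simp add: algebra_simps)
    then show ?thesis using 3 by auto
  qed
qed

text \<open>Modulo sign k inverts \<open>U2\<close>. The equation without sign has only the zero
  solution; for the other one the determinant is minus the Eisenstein norm form, and the six units
  give three matrices up to sign.\<close>

lemma solve_K:
  assumes k: "k \<in> carrier (GL_int 2)" and e: "k * U2 = U2 * (U2 * k) \<or> k * U2 = - (U2 * (U2 * k))"
  shows "\<exists>m\<in>{mat2 0 1 1 0, mat2 1 0 (-1) (-1), mat2 1 1 0 (-1)}. k = m \<or> k = - m"
proof -
  obtain a b c d where ke: "k = mat2 a b c d" using k mat2_cases[of k] unfolding GL_int_iff_det by blast
  have det: "a * d - b * c = 1 \<or> a * d - b * c = -1" using k by (simp add: ke GL_int_iff_det)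
  from e show ?thesis
  proof
    assume "k * U2 = U2 * (U2 * k)"
    then have "b = - c - a" "b - a = - d - b" "d = a" "d - c = b" by (simp_all add: ke)
    then have "a = 0" "b = 0" by linarith+
    then show ?thesis using det by simp
  next
    assume "k * U2 = - (U2 * (U2 * k))"
    then have "b = c + a \<and> d = - a" 
      unfolding ke mat2_mult mat2_uminus mat2_eq_iff mult_zero_left mult_zero_right mult_1_left mult_1_right add_0_left add_0_right
      by (elim conjE) (intro conjI; linarith)
    then have c: "c = b - a" "d = - a" by auto
    have "4 * (a * a - a * b + b * b) = (2 * a - b) * (2 * a - b) + 3 * (b * b)" by (simp add: algebra_simps)
    also have "\<dots> \<ge> 0" by (intro add_nonneg_nonneg mult_nonneg_nonneg zero_le_square) simp
    finally have "0 \<le> a * a - a * b + b * b" unfolding zero_le_mult_iff by (elim disjE conjE) simp_all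
    moreover have "a * d - b * c = - (a * a - a * b + b * b)" unfolding c by (simp add: algebra_simps)
    ultimately have "a * a - a * b + b * b = 1" using det by linarith
    from norm_form_eq_1[OF this]
    have "(a = 1 \<and> b = 0) \<or> (a = -1 \<and> b = 0) \<or> (a = 0 \<and> b = 1) \<or> (a = 0 \<and> b = -1) \<or> (a = 1 \<and> b = 1) \<or> (a = -1 \<and> b = -1)"
      by simp
    then show ?thesis unfolding ke c by (elim disjE conjE) simp_all
  qed
qed

text \<open>In both cases the determinant is (a - b) (a + b) up to sign, so both factors are units.
  The four solutions up to sign form the centraliser of an involution in PGL(2, \<int>).\<close>

lemma solve_D:
  assumes d: "d \<in> carrier (GL_int 2)" and e: "d * mat2 0 1 1 0 = mat2 0 1 1 0 * d \<or> d * mat2 0 1 1 0 = - (mat2 0 1 1 0 * d)"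
  shows "\<exists>m\<in>{mat2 1 0 0 1, mat2 0 1 1 0, mat2 1 0 0 (-1), mat2 0 1 (-1) 0}. d = m \<or> d = - m"
proof -
  obtain a b c d' where de: "d = mat2 a b c d'" using d mat2_cases[of d] unfolding GL_int_iff_det by blast
  have det: "a * d' - b * c = 1 \<or> a * d' - b * c = -1" using d by (simp add: de GL_int_iff_det)
  have sq: "(a - b) * (a + b) = 1 \<or> (a - b) * (a + b) = -1"
    and cases: "(c = b \<and> d' = a) \<or> (c = - b \<and> d' = - a)"
  proof -
    show cases: "(c = b \<and> d' = a) \<or> (c = - b \<and> d' = - a)" using e by (auto simp: de)
    then show "(a - b) * (a + b) = 1 \<or> (a - b) * (a + b) = -1" using det by (auto simp: algebra_simps)
  qed
  have "\<bar>a - b\<bar> * \<bar>a + b\<bar> = 1" unfolding abs_mult[symmetric] using sq by (elim disjE) simp_all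
  then have "a - b = 1 \<or> a - b = -1" "a + b = 1 \<or> a + b = -1"
    using zmult_eq_1_iff[of "\<bar>a - b\<bar>" "\<bar>a + b\<bar>"] by linarith+
  then have "(a = 1 \<and> b = 0) \<or> (a = -1 \<and> b = 0) \<or> (a = 0 \<and> b = 1) \<or> (a = 0 \<and> b = -1)" by presburger
  then show ?thesis using cases unfolding de by (elim disjE conjE) simp_all
qed

section \<open>Automorphisms of PGL(2, \<int>)\<close>

context int_matrix_group
begin

lemma proj_one: "proj (1\<^sub>m n) = \<one>\<^bsub>PG\<^esub>"
  using group_hom.hom_one[OF proj_group_hom] by simp

lemma proj_eq_one_iff: "A \<in> carrier \<Gamma> \<Longrightarrow> proj A = \<one>\<^bsub>PG\<^esub> \<longleftrightarrow> A = 1\<^sub>m n \<or> A = - 1\<^sub>m n"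
  using proj_eq_iff[of A "1\<^sub>m n"] one_closed proj_one by simp

lemma proj_nat_pow: "A \<in> carrier \<Gamma> \<Longrightarrow> proj A [^]\<^bsub>PG\<^esub> (k::nat) = proj (A [^]\<^bsub>\<Gamma>\<^esub> k)"
  using group_hom.hom_nat_pow[OF proj_group_hom] by simp

text \<open>After conjugation the automorphism fixes u of order 3, then also k, an involution
  inverting u. The involution d commutes with k, so its image lies in the centraliser of k and must
  be d or d k.\<close>

lemma fixed_element_PGL2:
  assumes n: "n = 2" and GL: "\<Gamma> = GL_int n" and \<phi>: "\<phi> \<in> iso PG PG"
  shows "\<exists>g\<in>carrier PG. \<exists>e\<in>carrier PG. g \<otimes>\<^bsub>PG\<^esub> \<phi> e \<otimes>\<^bsub>PG\<^esub> inv\<^bsub>PG\<^esub> g = e \<and> (\<forall>k>0. e [^]\<^bsub>PG\<^esub> (k::nat) \<noteq> \<one>\<^bsub>PG\<^esub>)"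
proof -
  have mem: "mat2 a b c d \<in> carrier \<Gamma>" if "a * d - b * c = 1 \<or> a * d - b * c = -1" for a b c d
    using that unfolding GL n GL_int_iff_det by simp
  note [simp] = mem
  define u k d where "u = proj U2" and "k = proj (mat2 0 1 1 0)" and "d = proj (mat2 1 0 0 (-1))"
  have c [simp]: "u \<in> carrier PG" "k \<in> carrier PG" "d \<in> carrier PG" by (simp_all add: u_def k_def d_def)
  have one2: "proj (mat2 1 0 0 1) = \<one>\<^bsub>PG\<^esub>" "proj (mat2 (-1) 0 0 (-1)) = \<one>\<^bsub>PG\<^esub>"
    using proj_eq_one_iff[of "mat2 1 0 0 1"] proj_eq_one_iff[of "mat2 (-1) 0 0 (-1)"] by (simp_all add: n one_mat2)
  have inj: "x = y" if "\<chi> \<in> iso PG PG" "\<chi> x = \<chi> y" "x \<in> carrier PG" "y \<in> carrier PG" for \<chi> x y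
    using that by (auto simp: iso_def bij_betw_def inj_on_def)
  have uuu: "u \<otimes>\<^bsub>PG\<^esub> (u \<otimes>\<^bsub>PG\<^esub> u) = \<one>\<^bsub>PG\<^esub>"
    by (simp add: u_def proj_mult one2)
  have u1: "u \<noteq> \<one>\<^bsub>PG\<^esub>" by (simp add: u_def proj_eq_one_iff n one_mat2)
  obtain A where A: "A \<in> carrier \<Gamma>" "\<phi> u = proj A"
    using lift_ex[of "\<phi> u"] \<phi> c hom_in_carrier[of \<phi> PG PG u] by (auto simp: iso_def)
  have \<phi>h: "\<phi> \<in> hom PG PG" using \<phi> by (simp add: iso_def)
  interpret \<phi>: group_hom PG PG \<phi> using \<phi>h by (simp add: group_hom_def group_hom_axioms_def PG.is_group)
  have AA: "A * A \<in> carrier \<Gamma>" "A * (A * A) \<in> carrier \<Gamma>" using m_closed A(1) by (metis mult_eq)+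
  have "proj (A * (A * A)) = \<one>\<^bsub>PG\<^esub>"
  proof -
    have "proj (A * (A * A)) = \<phi> (u \<otimes>\<^bsub>PG\<^esub> (u \<otimes>\<^bsub>PG\<^esub> u))" using A AA by (simp add: proj_mult[symmetric])
    then show ?thesis by (simp add: uuu)
  qed
  then have cube: "A * (A * A) = 1\<^sub>m 2 \<or> A * (A * A) = - 1\<^sub>m 2"
    using AA by (simp add: proj_eq_one_iff n)
  have "proj A \<noteq> \<one>\<^bsub>PG\<^esub>" using inj[OF \<phi>, of u "\<one>\<^bsub>PG\<^esub>"] u1 A by auto
  then have "A \<noteq> 1\<^sub>m 2" "A \<noteq> - 1\<^sub>m 2" using A by (auto simp: proj_eq_one_iff n)
  then obtain h where h: "h \<in> carrier (GL_int 2)" "A * h = h * U2 \<or> A * h = - (h * U2)"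
    using order_3_conj_U2[OF _ cube] A unfolding GL n by blast
  have h\<Gamma>: "h \<in> carrier \<Gamma>" using h by (simp add: GL n)
  have "proj A \<otimes>\<^bsub>PG\<^esub> proj h = proj h \<otimes>\<^bsub>PG\<^esub> u"
  proof -
    have hh: "A * h \<in> carrier \<Gamma>" "h * U2 \<in> carrier \<Gamma>" using m_closed[OF A(1) h\<Gamma>] m_closed[OF h\<Gamma>, of U2] by simp_all
    then have "proj (A * h) = proj (h * U2)" using proj_eq_iff[OF hh] h(2) by simp
    then show ?thesis using A h\<Gamma> by (simp add: proj_mult u_def)
  qed
  define y1 where "y1 = inv\<^bsub>PG\<^esub> (proj h)"
  have y1 [simp]: "y1 \<in> carrier PG" using h\<Gamma> by (simp add: y1_def)
  define \<psi> where "\<psi> x = y1 \<otimes>\<^bsub>PG\<^esub> \<phi> x \<otimes>\<^bsub>PG\<^esub> inv\<^bsub>PG\<^esub> y1" for x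
  have \<psi>: "\<psi> \<in> iso PG PG" unfolding \<psi>_def by (rule PG.iso_conj[OF \<phi> y1])
  have \<psi>u: "\<psi> u = u"
    using PG.conj_eq_iff[of "proj h" "proj A" u] \<open>proj A \<otimes>\<^bsub>PG\<^esub> proj h = proj h \<otimes>\<^bsub>PG\<^esub> u\<close> A h\<Gamma> c by (simp add: \<psi>_def y1_def)
  interpret \<psi>: group_hom PG PG \<psi> using \<psi> by (simp add: group_hom_def group_hom_axioms_def PG.is_group iso_def)
  obtain B where B: "B \<in> carrier \<Gamma>" "\<psi> k = proj B" using lift_ex[of "\<psi> k"] by auto
  have ku: "k \<otimes>\<^bsub>PG\<^esub> u = u \<otimes>\<^bsub>PG\<^esub> (u \<otimes>\<^bsub>PG\<^esub> k)"
    by (simp add: k_def u_def proj_mult) (subst proj_eq_iff, simp_all)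
  have "proj B \<otimes>\<^bsub>PG\<^esub> u = u \<otimes>\<^bsub>PG\<^esub> (u \<otimes>\<^bsub>PG\<^esub> proj B)"
    using arg_cong[OF ku, of \<psi>] B by (simp add: \<psi>u)
  then have Brel: "B * U2 = U2 * (U2 * B) \<or> B * U2 = - (U2 * (U2 * B))"
  proof -
    have m: "B * U2 \<in> carrier \<Gamma>" "U2 * B \<in> carrier \<Gamma>" "U2 * (U2 * B) \<in> carrier \<Gamma>"
      using m_closed[OF B(1), of U2] m_closed[of U2 B] m_closed[of U2 "U2 * B"] B by simp_all
    assume "proj B \<otimes>\<^bsub>PG\<^esub> u = u \<otimes>\<^bsub>PG\<^esub> (u \<otimes>\<^bsub>PG\<^esub> proj B)"
    then have "proj (B * U2) = proj (U2 * (U2 * B))" using B m by (simp add: u_def proj_mult)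
    then show ?thesis using proj_eq_iff[OF m(1,3)] by simp
  qed
  have "B \<in> carrier (GL_int 2)" using B by (simp add: GL n)
  from solve_K[OF this Brel] obtain m where m: "m \<in> {mat2 0 1 1 0, mat2 1 0 (-1) (-1), mat2 1 1 0 (-1)}" "B = m \<or> B = - m" by blast
  have "m \<in> carrier \<Gamma>" using m(1) by auto
  then have Bm: "proj B = proj m" using proj_eq_iff[OF B(1)] m(2) by simp
  have "\<exists>y\<in>carrier PG. y \<otimes>\<^bsub>PG\<^esub> proj m = k \<otimes>\<^bsub>PG\<^esub> y \<and> y \<otimes>\<^bsub>PG\<^esub> u = u \<otimes>\<^bsub>PG\<^esub> y"
  proof -
    \<comment> \<open>The three candidates are conjugate under powers of u, and such a conjugation
      keeps u fixed.\<close>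
    consider "m = mat2 0 1 1 0" | "m = mat2 1 0 (-1) (-1)" | "m = mat2 1 1 0 (-1)" using m(1) by auto
    then show ?thesis
    proof cases
      case 1
      then show ?thesis by (intro bexI[of _ "\<one>\<^bsub>PG\<^esub>"]) (simp_all flip: k_def)
    next
      case 2
      then show ?thesis by (intro bexI[of _ u]) (simp_all add: u_def k_def proj_mult)
    next
      case 3
      have "proj (U2 * U2) \<otimes>\<^bsub>PG\<^esub> proj m = k \<otimes>\<^bsub>PG\<^esub> proj (U2 * U2)"
        unfolding k_def 3 by (simp add: proj_mult) (subst proj_eq_iff, simp_all)
      then show ?thesis by (intro bexI[of _ "proj (U2 * U2)"]) (simp_all add: u_def proj_mult)
    qed
  qed
  then obtain y2 where y2: "y2 \<in> carrier PG" "y2 \<otimes>\<^bsub>PG\<^esub> proj m = k \<otimes>\<^bsub>PG\<^esub> y2" "y2 \<otimes>\<^bsub>PG\<^esub> u = u \<otimes>\<^bsub>PG\<^esub> y2" by blast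
  define \<chi> where "\<chi> x = y2 \<otimes>\<^bsub>PG\<^esub> \<psi> x \<otimes>\<^bsub>PG\<^esub> inv\<^bsub>PG\<^esub> y2" for x
  have \<chi>: "\<chi> \<in> iso PG PG" unfolding \<chi>_def by (rule PG.iso_conj[OF \<psi> y2(1)])
  interpret \<chi>: group_hom PG PG \<chi> using \<chi> by (simp add: group_hom_def group_hom_axioms_def PG.is_group iso_def)
  have \<chi>u: "\<chi> u = u" using y2 by (simp add: \<chi>_def \<psi>u PG.m_assoc)
  have \<chi>k: "\<chi> k = k" using y2 by (simp add: \<chi>_def B Bm PG.m_assoc)
  define y where "y = y2 \<otimes>\<^bsub>PG\<^esub> y1"
  have y: "y \<in> carrier PG" using y2 by (simp add: y_def)
  have \<chi>\<phi>: "\<chi> x = y \<otimes>\<^bsub>PG\<^esub> \<phi> x \<otimes>\<^bsub>PG\<^esub> inv\<^bsub>PG\<^esub> y" if "x \<in> carrier PG" for x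
    using that y2 by (simp add: \<chi>_def \<psi>_def y_def PG.inv_mult_group PG.m_assoc)
  obtain D where D: "D \<in> carrier \<Gamma>" "\<chi> d = proj D" using lift_ex[of "\<chi> d"] by auto
  have dk: "d \<otimes>\<^bsub>PG\<^esub> k = k \<otimes>\<^bsub>PG\<^esub> d"
    by (simp add: k_def d_def proj_mult) (subst proj_eq_iff, simp_all)
  have "proj D \<otimes>\<^bsub>PG\<^esub> k = k \<otimes>\<^bsub>PG\<^esub> proj D" using arg_cong[OF dk, of \<chi>] D by (simp add: \<chi>k)
  then have Drel: "D * mat2 0 1 1 0 = mat2 0 1 1 0 * D \<or> D * mat2 0 1 1 0 = - (mat2 0 1 1 0 * D)"
  proof -
    have m: "D * mat2 0 1 1 0 \<in> carrier \<Gamma>" "mat2 0 1 1 0 * D \<in> carrier \<Gamma>"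
      using m_closed[OF D(1), of "mat2 0 1 1 0"] m_closed[of "mat2 0 1 1 0" D] D by simp_all
    assume "proj D \<otimes>\<^bsub>PG\<^esub> k = k \<otimes>\<^bsub>PG\<^esub> proj D"
    then have "proj (D * mat2 0 1 1 0) = proj (mat2 0 1 1 0 * D)" using D m by (simp add: k_def proj_mult)
    then show ?thesis using proj_eq_iff[OF m] by simp
  qed
  have "D \<in> carrier (GL_int 2)" using D by (simp add: GL n)
  from solve_D[OF this Drel] obtain z where
    z: "z \<in> {mat2 1 0 0 1, mat2 0 1 1 0, mat2 1 0 0 (-1), mat2 0 1 (-1) 0}" "D = z \<or> D = - z" by blast
  have z\<Gamma>: "z \<in> carrier \<Gamma>" using z(1) by auto
  then have Dz: "\<chi> d = proj z" using D proj_eq_iff[OF D(1)] z(2) by simp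
  have "z \<noteq> mat2 1 0 0 1"
  proof
    assume "z = mat2 1 0 0 1"
    then have "d = \<one>\<^bsub>PG\<^esub>" using inj[OF \<chi>, of d "\<one>\<^bsub>PG\<^esub>"] Dz one2 by simp
    then show False by (simp add: d_def proj_eq_one_iff n one_mat2)
  qed
  moreover have "z \<noteq> mat2 0 1 1 0"
  proof
    assume "z = mat2 0 1 1 0"
    then have "d = k" using inj[OF \<chi>, of d k] Dz \<chi>k by (simp add: k_def)
    then show False by (simp add: d_def k_def proj_eq_iff)
  qed
  ultimately consider "\<chi> d = d" | "\<chi> d = d \<otimes>\<^bsub>PG\<^esub> k"
    using z(1) Dz by (auto simp: d_def k_def proj_mult)
  then show ?thesis
  proof cases
    case 1
    \<comment> \<open>u, d and k are now all fixed, hence so is this product, which is parabolic and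
      so of infinite order.\<close>
    define e where "e = u \<otimes>\<^bsub>PG\<^esub> (d \<otimes>\<^bsub>PG\<^esub> k)"
    have e: "e = proj (mat2 1 0 (-1) 1)" by (simp add: e_def u_def d_def k_def proj_mult)
    have "\<chi> e = e" using 1 by (simp add: e_def \<chi>u \<chi>k)
    moreover have "mat2 1 0 (-1) 1 [^]\<^bsub>\<Gamma>\<^esub> j = mat2 1 0 (- int j) 1" for j :: nat
      by (induction j) (simp_all add: n one_mat2)
    then have "e [^]\<^bsub>PG\<^esub> j \<noteq> \<one>\<^bsub>PG\<^esub>" if "j > 0" for j :: nat
      using that by (simp add: e proj_nat_pow proj_eq_one_iff) (simp add: n one_mat2)
    moreover have "e \<in> carrier PG" by (simp add: e_def)
    ultimately show ?thesis using \<chi>\<phi>[of e] y by (intro bexI[of _ y] bexI[of _ e]) auto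
  next
    case 2
    \<comment> \<open>Here \<open>\<chi>\<close> interchanges x and x', so x x' goes to x' x, which
      is conjugate to it by x.\<close>
    define x x' where "x = u \<otimes>\<^bsub>PG\<^esub> d" and "x' = u \<otimes>\<^bsub>PG\<^esub> (d \<otimes>\<^bsub>PG\<^esub> k)"
    define e where "e = x \<otimes>\<^bsub>PG\<^esub> x'"
    have xc [simp]: "x \<in> carrier PG" "x' \<in> carrier PG" "e \<in> carrier PG" by (simp_all add: x_def x'_def e_def)
    have kk: "k \<otimes>\<^bsub>PG\<^esub> k = \<one>\<^bsub>PG\<^esub>" by (simp add: k_def proj_mult one2)
    have "\<chi> x = x'" "\<chi> x' = x" using 2 by (simp_all add: x_def x'_def \<chi>u \<chi>k PG.m_assoc kk)
    then have "\<chi> e = x' \<otimes>\<^bsub>PG\<^esub> x" by (simp add: e_def)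
    then have "x \<otimes>\<^bsub>PG\<^esub> \<chi> e \<otimes>\<^bsub>PG\<^esub> inv\<^bsub>PG\<^esub> x = e" by (simp add: e_def PG.m_assoc)
    then have fx: "(x \<otimes>\<^bsub>PG\<^esub> y) \<otimes>\<^bsub>PG\<^esub> \<phi> e \<otimes>\<^bsub>PG\<^esub> inv\<^bsub>PG\<^esub> (x \<otimes>\<^bsub>PG\<^esub> y) = e"
      using y \<chi>\<phi>[of e] by (simp add: PG.inv_mult_group PG.m_assoc)
    have "e = proj (mat2 (-1) 1 2 (-1))" by (simp add: e_def x_def x'_def u_def d_def k_def proj_mult)
    also have "\<dots> = proj (mat2 1 (-1) (-2) 1)" by (subst proj_eq_iff) simp_all
    finally have e: "e = proj (mat2 1 (-1) (-2) 1)" .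
    \<comment> \<open>The eigenvalues are 1 + sqrt 2 and 1 - sqrt 2, and p + q sqrt 2 is the
      corresponding power of 1 + sqrt 2.\<close>
    have "\<exists>p q. mat2 1 (-1) (-2) 1 [^]\<^bsub>\<Gamma>\<^esub> Suc j = mat2 p (- q) (- 2 * q) p \<and> p > 0 \<and> q > 0" for j :: nat
    proof (induction j)
      case 0
      show ?case by (intro exI[of _ 1]) (simp add: n one_mat2)
    next
      case (Suc j)
      then obtain p q where "mat2 1 (-1) (-2) 1 [^]\<^bsub>\<Gamma>\<^esub> Suc j = mat2 p (- q) (- 2 * q) p" "p > 0" "q > 0" by blast
      then show ?case by (intro exI[of _ "p + 2 * q"] exI[of _ "p + q"]) (simp add: algebra_simps)
    qed
    then have "mat2 1 (-1) (-2) 1 [^]\<^bsub>\<Gamma>\<^esub> j \<notin> {1\<^sub>m n, - 1\<^sub>m n}" if j0: "j > 0" for j :: nat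
    proof -
      obtain i where i: "j = Suc i" using j0 by (cases j) auto
      obtain p q where "mat2 1 (-1) (-2) 1 [^]\<^bsub>\<Gamma>\<^esub> Suc i = mat2 p (- q) (- 2 * q) p" "q > 0"
        using \<open>\<And>j. \<exists>p q. mat2 1 (-1) (-2) 1 [^]\<^bsub>\<Gamma>\<^esub> Suc j = mat2 p (- q) (- 2 * q) p \<and> p > 0 \<and> q > 0\<close> by blast
      then show ?thesis unfolding i n one_mat2 by simp
    qed
    then have "e [^]\<^bsub>PG\<^esub> j \<noteq> \<one>\<^bsub>PG\<^esub>" if "j > 0" for j :: nat
      using that by (simp add: e proj_nat_pow proj_eq_one_iff)
    then show ?thesis using fx y by (intro bexI[of _ "x \<otimes>\<^bsub>PG\<^esub> y"] bexI[of _ e]) auto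
  qed
qed


section \<open>Automorphisms of PSL(2, \<int>)\<close>

text \<open>With S the generator of order 2, S U2 and S U2^2 are the upper and lower elementary
  matrices. They suffice, because a two by two sign diagonal of determinant 1 is central.\<close>

lemma generate_PSL2:
  assumes n: "n = 2" and SL: "\<Gamma> = SL_int n"
  shows "carrier PG = generate PG {proj (mat2 0 1 (-1) 0), proj U2}"
proof -
  have mem [simp]: "mat2 a b c d \<in> carrier \<Gamma>" if "a * d - b * c = 1" for a b c d
    using that unfolding SL n carrier_SL_int by simp
  have sub: "{proj (mat2 0 1 (-1) 0), proj U2} \<subseteq> carrier PG" by simp
  define H where "H = generate PG {proj (mat2 0 1 (-1) 0), proj U2}"
  interpret H: subgroup H PG unfolding H_def by (rule PG.generate_is_subgroup[OF sub])
  have gen: "proj (mat2 0 1 (-1) 0) \<in> H" "proj U2 \<in> H" by (auto simp: H_def intro: generate.incl)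
  have T: "proj (mat2 1 1 0 1) \<in> H"
    using H.m_closed[OF gen] by (simp add: proj_mult)
  have L: "proj (mat2 1 0 1 1) \<in> H"
    using H.m_closed[OF gen(1) H.m_closed[OF gen(2,2)]] by (simp add: proj_mult)
  have one: "proj (mat2 1 0 0 1) \<in> H" using H.one_closed proj_one by (simp add: n one_mat2)
  have "proj (mat2 1 (int m) 0 1) \<in> H \<and> proj (mat2 1 0 (int m) 1) \<in> H" for m
  proof (induction m)
    case (Suc m)
    then show ?case using H.m_closed[OF _ T, of "proj (mat2 1 (int m) 0 1)"] H.m_closed[OF _ L, of "proj (mat2 1 0 (int m) 1)"]
      by (simp add: proj_mult add.commute)
  qed (simp add: one)
  moreover have "inv\<^bsub>PG\<^esub> (proj (mat2 1 a 0 1)) = proj (mat2 1 (- a) 0 1)" "inv\<^bsub>PG\<^esub> (proj (mat2 1 0 a 1)) = proj (mat2 1 0 (- a) 1)" for a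
    by (rule PG.inv_equality; use proj_one in \<open>simp add: proj_mult n one_mat2\<close>)+
  ultimately have "proj (mat2 1 (- int m) 0 1) \<in> H \<and> proj (mat2 1 0 (- int m) 1) \<in> H" for m
    by (metis H.m_inv_closed)
  with \<open>\<And>m. proj (mat2 1 (int m) 0 1) \<in> H \<and> proj (mat2 1 0 (int m) 1) \<in> H\<close>
  have el: "proj (mat2 1 a 0 1) \<in> H \<and> proj (mat2 1 0 a 1) \<in> H" for a
    by (cases a rule: int_cases2) auto
  have ro: "proj M \<in> H" if "M \<in> row_ops n j" for M j
    using that
  proof (induction rule: row_ops.induct)
    case one
    then show ?case using H.one_closed proj_one by simp
  next
    case (step M k l a)
    have M: "M \<in> carrier \<Gamma>" using step row_ops_carrier' by blast
    have "(k = 0 \<and> l = 1) \<or> (k = 1 \<and> l = 0)" using step n by auto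
    then have "proj (addrow_mat n a k l) \<in> H" using el addrow_mat2 by (auto simp: n)
    then show ?case using H.m_closed[OF _ step.IH, of "proj (addrow_mat n a k l)"] M step by (simp add: proj_mult)
  qed
  have "x \<in> H" if x: "x \<in> carrier PG" for x
  proof -
    obtain M where M: "M \<in> carrier \<Gamma>" "x = proj M" using lift_ex[OF x] by blast
    obtain R where R: "R \<in> row_ops n 0" "R * M \<in> sign_diagonals n"
      using row_ops_diagonalise[OF carrier_GL[OF M(1)]] by blast
    have RG: "R \<in> carrier \<Gamma>" using R row_ops_carrier' by blast
    have RM: "R * M \<in> carrier \<Gamma>" using m_closed[OF RG M(1)] by simp
    obtain a b c d where abcd: "R * M = mat2 a b c d" using mat2_cases[of "R * M"] carrier_mat[OF RM] unfolding n by blast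
    have "a \<in> {1, -1}" "d \<in> {1, -1}" "b = 0" "c = 0"
      using R(2) unfolding abcd sign_diagonals_def n
      by (simp_all add: numeral_2_eq_2 All_less_Suc) (simp_all add: mat2_def)
    moreover have "a * d - b * c = 1" using RM unfolding abcd SL n carrier_SL_int by simp
    ultimately have "R * M = 1\<^sub>m n \<or> R * M = - 1\<^sub>m n" unfolding abcd n one_mat2 by auto
    then have "proj R \<otimes>\<^bsub>PG\<^esub> proj M = \<one>\<^bsub>PG\<^esub>" using RG M RM by (simp add: proj_mult proj_eq_one_iff)
    then have "proj M = inv\<^bsub>PG\<^esub> (proj R)" using RG M PG.inv_equality[of "proj M" "proj R"] PG.inv_comm by (metis proj_carrier)
    then show ?thesis using ro[OF R(1)] M by simp
  qed
  then show ?thesis using H.subset unfolding H_def by auto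
qed

text \<open>Modulo \<open>q = t\<^sup>2 - 1\<close>, where \<open>t\<close> is the trace of \<open>BA\<close>, the matrix \<open>(BA)\<^sup>3\<close> is scalar, so the image
  of the group becomes a quotient of the tetrahedral group (of \<open>S\<^sub>3\<close> if \<open>t = 0\<close>), where the sixth
  power of the parabolic element is trivial.\<close>

lemma PSL2_generators_trace:
  assumes n: "n = 2" and SL: "\<Gamma> = SL_int n" and A: "A \<in> carrier \<Gamma>" and B: "B \<in> carrier \<Gamma>"
    and A3: "proj A \<otimes>\<^bsub>PG\<^esub> (proj A \<otimes>\<^bsub>PG\<^esub> proj A) = \<one>\<^bsub>PG\<^esub>" and B2: "proj B \<otimes>\<^bsub>PG\<^esub> proj B = \<one>\<^bsub>PG\<^esub>"
    and gen: "carrier PG = generate PG {proj B, proj A}" and BA: "B * A = mat2 a b c d"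
  shows "a + d = 2 \<or> a + d = -2"
proof -
  have mem [simp]: "mat2 a b c d \<in> carrier \<Gamma>" if "a * d - b * c = 1" for a b c d
    using that unfolding SL n carrier_SL_int by simp
  have elem: "\<exists>a b c d. M = mat2 a b c d \<and> a * d - b * c = 1" if M: "M \<in> carrier \<Gamma>" for M
  proof -
    obtain a b c d where "M = mat2 a b c d" using mat2_cases[of M] carrier_mat[OF M] unfolding n by blast
    then show ?thesis using M unfolding SL n carrier_SL_int by auto
  qed
  \<comment> \<open>For trace 0 the square of B A is exactly -1, and the modulus 0 is taken;
    \<open>N\<close> is then the centre.\<close>
  define q where "q = (if a + d = 0 then 0 else (a + d) * (a + d) - 1)"
  define sc where "sc a b c d \<longleftrightarrow> q dvd b \<and> q dvd c \<and> q dvd a - d" for a b c d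
  \<comment> \<open>The matrices of determinant 1 that are scalar modulo q.\<close>
  define N where "N = {M. \<exists>a b c d. M = mat2 a b c d \<and> a * d - b * c = 1 \<and> sc a b c d}"
  have Niff: "mat2 a b c d \<in> N \<longleftrightarrow> a * d - b * c = 1 \<and> sc a b c d" for a b c d by (auto simp: N_def)
  have invM: "inv\<^bsub>\<Gamma>\<^esub> (mat2 a b c d) = mat2 d (- b) (- c) a" if "a * d - b * c = 1" for a b c d
    using that by (intro inv_equality) (auto simp: n one_mat2 algebra_simps)
  have N: "N \<lhd> \<Gamma>"
  proof (rule normal_invI)
    show "subgroup N \<Gamma>"
    proof (rule subgroupI)
      show "N \<subseteq> carrier \<Gamma>" by (auto simp: N_def)
      have "mat2 1 0 0 1 \<in> N" by (simp add: Niff sc_def)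
      then show "N \<noteq> {}" by blast
      fix x y assume "x \<in> N" "y \<in> N"
      then obtain a b c d a' b' c' d' where x: "x = mat2 a b c d" "a * d - b * c = 1" "sc a b c d"
        and y: "y = mat2 a' b' c' d'" "a' * d' - b' * c' = 1" "sc a' b' c' d'" by (auto simp: N_def)
      show "inv\<^bsub>\<Gamma>\<^esub> x \<in> N" using x by (simp add: invM Niff sc_def algebra_simps dvd_diff_commute)
      have "(a * a' + b * c') - (c * b' + d * d') = (a - d) * a' + d * (a' - d') + b * c' - c * b'" by (simp add: algebra_simps)
      moreover have "q dvd (a - d) * a' + d * (a' - d') + b * c' - c * b'" using x y by (simp add: sc_def)
      ultimately have dg: "q dvd (a * a' + b * c') - (c * b' + d * d')" by (simp only:)
      have "(a * a' + b * c') * (c * b' + d * d') - (a * b' + b * d') * (c * a' + d * c') = (a * d - b * c) * (a' * d' - b' * c')"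
        by (simp add: algebra_simps)
      then have "(a * a' + b * c') * (c * b' + d * d') - (a * b' + b * d') * (c * a' + d * c') = 1" using x y by simp
      then show "x \<otimes>\<^bsub>\<Gamma>\<^esub> y \<in> N" using x y dg by (simp add: Niff sc_def)
    qed
    fix x h assume "x \<in> carrier \<Gamma>" and "h \<in> N"
    then obtain a b c d x1 x2 x3 x4 where h: "h = mat2 a b c d" "a * d - b * c = 1" "sc a b c d"
      and x: "x = mat2 x1 x2 x3 x4" "x1 * x4 - x2 * x3 = 1" using elem[of x] by (auto simp: N_def)
    define b' c' where "b' = x1 * x1 * b - x2 * x2 * c - x1 * x2 * (a - d)" and "c' = x3 * x4 * (a - d) - x3 * x3 * b + x4 * x4 * c"
    define e where "e = x1 * x4 * (a - d) + x2 * x3 * (a - d) - 2 * x1 * x3 * b + 2 * x2 * x4 * c"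
    have "x \<otimes>\<^bsub>\<Gamma>\<^esub> h \<otimes>\<^bsub>\<Gamma>\<^esub> inv\<^bsub>\<Gamma>\<^esub> x \<in> carrier \<Gamma>" using h x by (intro m_closed inv_closed) simp_all
    moreover have eq: "x \<otimes>\<^bsub>\<Gamma>\<^esub> h \<otimes>\<^bsub>\<Gamma>\<^esub> inv\<^bsub>\<Gamma>\<^esub> x =
      mat2 ((x1 * a + x2 * c) * x4 - (x1 * b + x2 * d) * x3) b' c' ((x3 * b + x4 * d) * x1 - (x3 * a + x4 * c) * x2)"
      unfolding h(1) x(1) invM[OF x(2)] by (simp add: b'_def c'_def algebra_simps)
    ultimately have det: "((x1 * a + x2 * c) * x4 - (x1 * b + x2 * d) * x3) * ((x3 * b + x4 * d) * x1 - (x3 * a + x4 * c) * x2) - b' * c' = 1"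
      unfolding eq SL n carrier_SL_int by simp
    have "(x1 * a + x2 * c) * x4 - (x1 * b + x2 * d) * x3 - ((x3 * b + x4 * d) * x1 - (x3 * a + x4 * c) * x2) = e"
      by (simp add: e_def algebra_simps)
    moreover have "q dvd b'" "q dvd c'" "q dvd e" using h(3) by (simp_all add: sc_def b'_def c'_def e_def)
    ultimately show "x \<otimes>\<^bsub>\<Gamma>\<^esub> h \<otimes>\<^bsub>\<Gamma>\<^esub> inv\<^bsub>\<Gamma>\<^esub> x \<in> N" unfolding eq Niff using det by (simp add: sc_def)
  qed
  interpret N: normal N \<Gamma> by (rule N)
  have cN: "centre \<subseteq> N"
    by (auto simp: centre_iff n one_mat2 Niff sc_def)
  obtain \<alpha> where \<alpha>: "\<alpha> \<in> hom PG (\<Gamma> Mod N)" "\<And>M. M \<in> carrier \<Gamma> \<Longrightarrow> \<alpha> (proj M) = N #>\<^bsub>\<Gamma>\<^esub> M"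
    using quotient_hom[OF N cN] by blast
  interpret H: group "\<Gamma> Mod N" by (rule N.factorgroup_is_group)
  interpret \<alpha>: group_hom PG "\<Gamma> Mod N" \<alpha>
    using \<alpha>(1) by (simp add: group_hom_def group_hom_axioms_def PG.is_group H.is_group)
  have ker: "\<alpha> (proj M) = \<one>\<^bsub>\<Gamma> Mod N\<^esub> \<longleftrightarrow> M \<in> N" if M: "M \<in> carrier \<Gamma>" for M
  proof -
    have "\<alpha> (proj M) = \<one>\<^bsub>\<Gamma> Mod N\<^esub> \<longleftrightarrow> N #>\<^bsub>\<Gamma>\<^esub> M = N" by (simp add: \<alpha>(2)[OF M] FactGroup_def)
    also have "\<dots> \<longleftrightarrow> M \<in> N" using coset_join1[OF _ M N.is_subgroup] coset_join2[OF M N.is_subgroup] by blast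
    finally show ?thesis .
  qed
  define s u where "s = \<alpha> (proj B)" and "u = \<alpha> (proj A)"
  have c: "proj A \<in> carrier PG" "proj B \<in> carrier PG" using A B by simp_all
  have BAc: "mat2 a b c d \<in> carrier \<Gamma>" using m_closed[OF B A] by (simp add: BA)
  then have det: "a * d - b * c = 1" unfolding SL n carrier_SL_int by simp
  have su: "s \<otimes>\<^bsub>\<Gamma> Mod N\<^esub> u = \<alpha> (proj (mat2 a b c d))"
    unfolding s_def u_def \<alpha>.hom_mult[OF c(2,1), symmetric] proj_mult[OF B A] BA ..
  have rel: "(s \<otimes>\<^bsub>\<Gamma> Mod N\<^esub> u) \<otimes>\<^bsub>\<Gamma> Mod N\<^esub> ((s \<otimes>\<^bsub>\<Gamma> Mod N\<^esub> u) \<otimes>\<^bsub>\<Gamma> Mod N\<^esub> (s \<otimes>\<^bsub>\<Gamma> Mod N\<^esub> u)) = \<one>\<^bsub>\<Gamma> Mod N\<^esub> \<or>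
    (s \<otimes>\<^bsub>\<Gamma> Mod N\<^esub> u) \<otimes>\<^bsub>\<Gamma> Mod N\<^esub> (s \<otimes>\<^bsub>\<Gamma> Mod N\<^esub> u) = \<one>\<^bsub>\<Gamma> Mod N\<^esub>"
  proof -
    define C where "C = mat2 a b c d"
    have CC: "C * C \<in> carrier \<Gamma>" "C * (C * C) \<in> carrier \<Gamma>" "C \<in> carrier \<Gamma>"
      using BAc m_closed unfolding C_def by (metis mult_eq)+
    have 2: "(s \<otimes>\<^bsub>\<Gamma> Mod N\<^esub> u) \<otimes>\<^bsub>\<Gamma> Mod N\<^esub> (s \<otimes>\<^bsub>\<Gamma> Mod N\<^esub> u) = \<alpha> (proj (C * C))"
      unfolding su C_def[symmetric] \<alpha>.hom_mult[OF proj_carrier[OF CC(3)] proj_carrier[OF CC(3)], symmetric]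
        proj_mult[OF CC(3,3)] ..
    have 3: "(s \<otimes>\<^bsub>\<Gamma> Mod N\<^esub> u) \<otimes>\<^bsub>\<Gamma> Mod N\<^esub> ((s \<otimes>\<^bsub>\<Gamma> Mod N\<^esub> u) \<otimes>\<^bsub>\<Gamma> Mod N\<^esub> (s \<otimes>\<^bsub>\<Gamma> Mod N\<^esub> u)) = \<alpha> (proj (C * (C * C)))"
      unfolding 2 unfolding su C_def[symmetric] \<alpha>.hom_mult[OF proj_carrier[OF CC(3)] proj_carrier[OF CC(1)], symmetric]
        proj_mult[OF CC(3,1)] ..
    show ?thesis
    proof (cases "a + d = 0")
      case True
      then have d: "d = - a" by simp
      have "C * C = mat2 (-1) 0 0 (-1)" using det unfolding C_def d by (simp add: algebra_simps)
      then have "C * C \<in> N" by (simp add: Niff sc_def)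
      then show ?thesis unfolding 2 using ker[OF CC(1)] by simp
    next
      case False
      then have q: "q = (a + d) * (a + d) - 1" by (simp add: q_def)
      \<comment> \<open>By Cayley-Hamilton C^3 = (t^2 - 1) C - t with t = a + d, a scalar modulo
        q.\<close>
      have ent: "C * (C * C) = mat2 (q * a - (a + d)) (q * b) (q * c) (q * d - (a + d))"
      proof -
        define t where "t = a + d"
        have E: "a * a + b * c = t * a - 1" "b * c + d * d = t * d - 1" using det by (simp_all add: t_def algebra_simps)
        have "a * (t * a - 1) + b * (t * c) = t * (a * a + b * c) - a"
          "a * (t * b) + b * (t * d - 1) = (t * t - 1) * b"
          "c * (t * a - 1) + d * (t * c) = (t * t - 1) * c"
          "c * (t * b) + d * (t * d - 1) = t * (b * c + d * d) - d"
          by (simp_all add: t_def algebra_simps)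
        then have "mat2 a b c d * mat2 (t * a - 1) (t * b) (t * c) (t * d - 1) = mat2 (q * a - t) (q * b) (q * c) (q * d - t)"
          unfolding mat2_mult mat2_eq_iff E q t_def[symmetric] by (simp add: algebra_simps)
        moreover have "C * C = mat2 (t * a - 1) (t * b) (t * c) (t * d - 1)"
          using E unfolding C_def by (simp add: t_def algebra_simps)
        ultimately show ?thesis unfolding C_def t_def by simp
      qed
      have "q * a - (a + d) - (q * d - (a + d)) = q * (a - d)" by (simp add: algebra_simps)
      then have "sc (q * a - (a + d)) (q * b) (q * c) (q * d - (a + d))" by (simp add: sc_def)
      moreover have "(q * a - (a + d)) * (q * d - (a + d)) - (q * b) * (q * c) = 1"
        using CC(2) unfolding ent SL n carrier_SL_int by simp
      ultimately have "C * (C * C) \<in> N" unfolding ent Niff by simp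
      then show ?thesis unfolding 3 using ker[OF CC(2)] by simp
    qed
  qed
  have "\<alpha> (proj (mat2 1 1 0 1)) \<in> \<alpha> ` generate PG {proj B, proj A}"
    unfolding gen[symmetric] by (intro imageI) simp
  then have "\<alpha> (proj (mat2 1 1 0 1)) \<in> generate (\<Gamma> Mod N) {s, u}"
    using \<alpha>.generate_img[of "{proj B, proj A}"] c by (simp add: s_def u_def)
  then have "\<alpha> (proj (mat2 1 1 0 1)) [^]\<^bsub>\<Gamma> Mod N\<^esub> (6::nat) = \<one>\<^bsub>\<Gamma> Mod N\<^esub>"
  proof (rule H.exponent_6[rotated 5])
    show "s \<in> carrier (\<Gamma> Mod N)" "u \<in> carrier (\<Gamma> Mod N)" using c by (simp_all add: s_def u_def)
    show "s \<otimes>\<^bsub>\<Gamma> Mod N\<^esub> s = \<one>\<^bsub>\<Gamma> Mod N\<^esub>" 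
      unfolding s_def \<alpha>.hom_mult[OF c(2,2), symmetric] B2 by (rule \<alpha>.hom_one)
    show "u \<otimes>\<^bsub>\<Gamma> Mod N\<^esub> (u \<otimes>\<^bsub>\<Gamma> Mod N\<^esub> u) = \<one>\<^bsub>\<Gamma> Mod N\<^esub>" 
      unfolding u_def \<alpha>.hom_mult[OF c(1,1), symmetric] \<alpha>.hom_mult[OF c(1) PG.m_closed[OF c(1,1)], symmetric] A3
      by (rule \<alpha>.hom_one)
  qed (rule rel)
  moreover have "mat2 1 1 0 1 [^]\<^bsub>\<Gamma>\<^esub> j = mat2 1 (int j) 0 1" for j :: nat
    by (induction j) (simp_all add: n one_mat2)
  then have "\<alpha> (proj (mat2 1 1 0 1)) [^]\<^bsub>\<Gamma> Mod N\<^esub> (6::nat) = \<alpha> (proj (mat2 1 6 0 1))"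
    by (simp add: proj_nat_pow flip: \<alpha>.hom_nat_pow)
  ultimately have "mat2 1 6 0 1 \<in> N" using ker[of "mat2 1 6 0 1"] by simp
  \<comment> \<open>The off-diagonal entry 6 of a matrix that is scalar modulo q. Traces 0, 1 and -1
    give q = 0, which does not divide 6; all others have 0 < t^2 - 1 \<le> 6.\<close>
  then have q6: "q dvd 6" by (simp add: Niff sc_def)
  then have t0: "a + d \<noteq> 0" by (auto simp: q_def)
  then have "(a + d) * (a + d) - 1 \<le> 6" using zdvd_imp_le[OF q6] by (simp add: q_def)
  then have "\<bar>a + d\<bar> * \<bar>a + d\<bar> < 3 * 3" by simp
  then have "\<bar>a + d\<bar> < 3" using mult_mono[of 3 "\<bar>a + d\<bar>" 3 "\<bar>a + d\<bar>"] by linarith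
  moreover have "\<bar>a + d\<bar> \<noteq> 1"
  proof
    assume "\<bar>a + d\<bar> = 1"
    then have "(a + d) * (a + d) = 1" by (metis abs_mult_self_eq mult_1)
    then show False using q6 t0 by (simp add: q_def)
  qed
  ultimately show ?thesis using t0 by linarith
qed

end

text \<open>Invariance of the trace under conjugation, with the inverse of the conjugator replaced
  by its nonzero determinant.\<close>

lemma conj_trace:
  fixes a b c d p q r s x y z w :: int
  assumes det: "p * s - q * r \<noteq> 0" and e: "mat2 a b c d * mat2 p q r s = mat2 p q r s * mat2 x y z w"
  shows "a + d = x + w"
proof -
  have e1: "a * p + b * r = p * x + q * z" and e2: "a * q + b * s = p * y + q * w"
    and e3: "c * p + d * r = r * x + s * z" and e4: "c * q + d * s = r * y + s * w"
    using e by simp_all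
  have "(a + d) * (p * s - q * r) = (a * p + b * r) * s - (a * q + b * s) * r + (c * q + d * s) * p - (c * p + d * r) * q"
    by (simp add: algebra_simps)
  also have "\<dots> = (x + w) * (p * s - q * r)" unfolding e1 e2 e3 e4 by (simp add: algebra_simps)
  finally show ?thesis using det by simp
qed

text \<open>The matrix with rows (a, b) and (c, -a) has determinant 1, and its product with
  \<open>U2\<close> has trace b - a - c. Eliminating c and completing the square makes (2 - b) (3 b
  - 2) a square, so b is 1 or 2.\<close>

lemma solve_S:
  assumes "a * a + b * c = (-1::int)" "b - a - c = 2"
  shows "(a, b, c) \<in> {(0, 1, -1), (1, 1, -2), (1, 2, -1)}"
proof -
  have c: "c = b - a - 2" using assms by simp
  have "a * a - a * b + (b - 1) * (b - 1) = 0" using assms(1) unfolding c by (simp add: algebra_simps)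
  then have "(2 * a - b) * (2 * a - b) = (2 - b) * (3 * b - 2)" by (simp add: algebra_simps)
  then have "0 \<le> (2 - b) * (3 * b - 2)" by (metis zero_le_square)
  then have "b = 1 \<or> b = 2" unfolding zero_le_mult_iff by presburger
  then show ?thesis
  proof
    assume b: "b = 1"
    then have "a * (a - 1) = 0" using \<open>a * a - a * b + (b - 1) * (b - 1) = 0\<close> by (simp add: algebra_simps)
    then show ?thesis using b c by auto
  next
    assume b: "b = 2"
    then have "(a - 1) * (a - 1) = 0" using \<open>a * a - a * b + (b - 1) * (b - 1) = 0\<close> by (simp add: algebra_simps)
    then show ?thesis using b c by auto
  qed
qed

lemma pm_mult_right:
  fixes M N V :: "int mat"
  assumes "M = N \<or> M = - N" "N \<in> carrier_mat n n" "V \<in> carrier_mat n n"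
  shows "M * V = N * V \<or> M * V = - (N * V)"
  using assms by (elim disjE) simp_all

lemma pm_mult_left:
  fixes M N V :: "int mat"
  assumes "M = N \<or> M = - N" "N \<in> carrier_mat n n" "V \<in> carrier_mat n n"
  shows "V * M = V * N \<or> V * M = - (V * N)"
  using assms by (elim disjE) simp_all

text \<open>Projective conjugation relations with the same conjugator can be multiplied, the signs
  being multiplied too.\<close>

lemma pm_conj_mult:
  fixes A B g U V :: "int mat"
  assumes c: "A \<in> carrier_mat 2 2" "B \<in> carrier_mat 2 2" "g \<in> carrier_mat 2 2" "U \<in> carrier_mat 2 2" "V \<in> carrier_mat 2 2"
    and "A * g = g * U \<or> A * g = - (g * U)" "B * g = g * V \<or> B * g = - (g * V)"
  shows "A * B * g = g * (U * V) \<or> A * B * g = - (g * (U * V))"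
proof -
  have gUV: "g * U \<in> carrier_mat 2 2" "g * V \<in> carrier_mat 2 2" using c by simp_all
  have "A * (B * g) = A * (g * V) \<or> A * (B * g) = - (A * (g * V))"
    using assms(7) gUV(2) c(1) by (rule pm_mult_left)
  moreover have "A * g * V = g * U * V \<or> A * g * V = - (g * U * V)"
    using assms(6) gUV(1) c(5) by (rule pm_mult_right)
  moreover have "A * B * g = A * (B * g)" "A * g * V = A * (g * V)" "g * U * V = g * (U * V)"
    using c by (simp_all add: sq_assoc[of _ 2 _ _ 2])
  ultimately show ?thesis by auto
qed

context int_matrix_group
begin

text \<open>A single g in GL(2, \<int>) conjugates the images of both generators back to them, up to
  sign. Only the determinant of g decides which fixed element is available inside SL(2,
  \<int>).\<close>

lemma fixed_element_PSL2:
  assumes n: "n = 2" and SL: "\<Gamma> = SL_int n" and \<phi>: "\<phi> \<in> iso PG PG"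
  shows "\<exists>g\<in>carrier PG. \<exists>e\<in>carrier PG. g \<otimes>\<^bsub>PG\<^esub> \<phi> e \<otimes>\<^bsub>PG\<^esub> inv\<^bsub>PG\<^esub> g = e \<and> (\<forall>k>0. e [^]\<^bsub>PG\<^esub> (k::nat) \<noteq> \<one>\<^bsub>PG\<^esub>)"
proof -
  have mem [simp]: "mat2 a b c d \<in> carrier \<Gamma>" if "a * d - b * c = 1" for a b c d
    using that unfolding SL n carrier_SL_int by simp
  define S2 where "S2 = mat2 0 1 (-1) 0"
  have S2 [simp]: "S2 \<in> carrier \<Gamma>" by (simp add: S2_def)
  have one2: "proj (mat2 1 0 0 1) = \<one>\<^bsub>PG\<^esub>" "proj (mat2 (-1) 0 0 (-1)) = \<one>\<^bsub>PG\<^esub>"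
    using proj_eq_one_iff[of "mat2 1 0 0 1"] proj_eq_one_iff[of "mat2 (-1) 0 0 (-1)"] by (simp_all add: n one_mat2)
  have \<phi>h: "\<phi> \<in> hom PG PG" and bij: "bij_betw \<phi> (carrier PG) (carrier PG)" using \<phi> by (auto simp: iso_def)
  interpret \<phi>: group_hom PG PG \<phi> using \<phi>h by (simp add: group_hom_def group_hom_axioms_def PG.is_group)
  have \<phi>1: "\<phi> x \<noteq> \<one>\<^bsub>PG\<^esub>" if "x \<noteq> \<one>\<^bsub>PG\<^esub>" "x \<in> carrier PG" for x
    using bij that \<phi>.hom_one PG.one_closed by (metis bij_betw_def inj_onD)
  obtain A where A: "A \<in> carrier \<Gamma>" "\<phi> (proj U2) = proj A" using lift_ex[of "\<phi> (proj U2)"] by auto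
  obtain B where B: "B \<in> carrier \<Gamma>" "\<phi> (proj S2) = proj B" using lift_ex[of "\<phi> (proj S2)"] by auto
  have AA: "A * A \<in> carrier \<Gamma>" "A * (A * A) \<in> carrier \<Gamma>" "B * B \<in> carrier \<Gamma>" "B * A \<in> carrier \<Gamma>"
    using m_closed A(1) B(1) by (metis mult_eq)+
  have A3: "proj A \<otimes>\<^bsub>PG\<^esub> (proj A \<otimes>\<^bsub>PG\<^esub> proj A) = \<one>\<^bsub>PG\<^esub>"
  proof -
    have "proj A \<otimes>\<^bsub>PG\<^esub> (proj A \<otimes>\<^bsub>PG\<^esub> proj A) = \<phi> (proj U2 \<otimes>\<^bsub>PG\<^esub> (proj U2 \<otimes>\<^bsub>PG\<^esub> proj U2))" using A by simp
    also have "proj U2 \<otimes>\<^bsub>PG\<^esub> (proj U2 \<otimes>\<^bsub>PG\<^esub> proj U2) = \<one>\<^bsub>PG\<^esub>" by (simp add: proj_mult one2)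
    finally show ?thesis by simp
  qed
  then have cube: "A * (A * A) = 1\<^sub>m 2 \<or> A * (A * A) = - 1\<^sub>m 2"
    using A AA proj_eq_one_iff[OF AA(2)] by (simp add: proj_mult n)
  have B2: "proj B \<otimes>\<^bsub>PG\<^esub> proj B = \<one>\<^bsub>PG\<^esub>"
  proof -
    have "proj B \<otimes>\<^bsub>PG\<^esub> proj B = \<phi> (proj S2 \<otimes>\<^bsub>PG\<^esub> proj S2)" using B by simp
    also have "proj S2 \<otimes>\<^bsub>PG\<^esub> proj S2 = \<one>\<^bsub>PG\<^esub>" by (simp add: proj_mult one2 S2_def)
    finally show ?thesis by simp
  qed
  then have sq: "B * B = 1\<^sub>m 2 \<or> B * B = - 1\<^sub>m 2"
    using B AA proj_eq_one_iff[OF AA(3)] by (simp add: proj_mult n)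
  have "proj U2 \<noteq> \<one>\<^bsub>PG\<^esub>" "proj S2 \<noteq> \<one>\<^bsub>PG\<^esub>" by (simp_all add: proj_eq_one_iff S2_def n one_mat2)
  then have "proj A \<noteq> \<one>\<^bsub>PG\<^esub>" "proj B \<noteq> \<one>\<^bsub>PG\<^esub>" 
    using \<phi>1[of "proj U2"] \<phi>1[of "proj S2"] A B by simp_all
  then have ne: "A \<noteq> 1\<^sub>m 2" "A \<noteq> - 1\<^sub>m 2" "B \<noteq> 1\<^sub>m 2" "B \<noteq> - 1\<^sub>m 2" using A B by (auto simp: proj_eq_one_iff n)
  have gen: "carrier PG = generate PG {proj B, proj A}"
  proof -
    have "carrier PG = \<phi> ` carrier PG" using bij by (simp add: bij_betw_def)
    also have "\<dots> = \<phi> ` generate PG {proj S2, proj U2}" unfolding S2_def using generate_PSL2[OF n SL] by simp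
    also have "\<dots> = generate PG (\<phi> ` {proj S2, proj U2})" by (intro \<phi>.generate_img[symmetric]) simp
    finally show ?thesis using A B by simp
  qed
  obtain h where h: "h \<in> carrier (GL_int 2)" "A * h = h * U2 \<or> A * h = - (h * U2)"
    using order_3_conj_U2[OF _ cube ne(1,2)] carrier_GL[OF A(1)] unfolding n by blast
  obtain p q r s where hh: "h = mat2 p q r s" using h(1) mat2_cases[of h] unfolding GL_int_iff_det by blast
  have hdet: "p * s - q * r = 1 \<or> p * s - q * r = -1" using h(1) by (simp add: hh GL_int_iff_det)
  interpret GL: group "GL_int 2" by (rule group_GL_int)
  define hi where "hi = inv\<^bsub>GL_int 2\<^esub> h"
  have hi: "hi \<in> carrier_mat 2 2" "h * hi = 1\<^sub>m 2" "hi * h = 1\<^sub>m 2"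
    using h(1) GL.r_inv[OF h(1)] GL.l_inv[OF h(1)] by (auto simp: hi_def intro: GL_carrier_mat)
  have cm: "A \<in> carrier_mat 2 2" "B \<in> carrier_mat 2 2" "h \<in> carrier_mat 2 2"
    using carrier_mat[OF A(1)] carrier_mat[OF B(1)] h(1) unfolding n by (auto intro: GL_carrier_mat)
  \<comment> \<open>B in the basis in which A becomes \<open>U2\<close> up to sign.\<close>
  define B' where "B' = hi * B * h"
  have B'c: "B' \<in> carrier_mat 2 2" using hi cm by (simp add: B'_def)
  have Bh: "B * h = h * B'"
  proof -
    have "h * B' = (h * hi) * (B * h)" unfolding B'_def using hi(1) cm by (simp add: sq_assoc[of _ 2 _ _ 2])
    then show ?thesis using hi(2) cm by simp
  qed
  obtain a b c d where B': "B' = mat2 a b c d" using mat2_cases[OF B'c] by blast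
  have BBh: "h * (B' * B') = (B * B) * h"
  proof -
    have "h * (B' * B') = (h * B') * B'" using B'c cm by (intro sq_assoc[symmetric])
    also have "\<dots> = (B * h) * B'" by (simp only: Bh)
    also have "\<dots> = B * (h * B')" using B'c cm by (intro sq_assoc)
    also have "\<dots> = B * (B * h)" by (simp only: Bh)
    also have "\<dots> = B * B * h" using cm by (intro sq_assoc[symmetric])
    finally show ?thesis .
  qed
  have canc: "M = N" if "h * M = h * N" "M \<in> carrier_mat 2 2" "N \<in> carrier_mat 2 2" for M N
  proof -
    have "hi * h * M = hi * (h * M)" using that hi(1) cm by (intro sq_assoc)
    also have "\<dots> = hi * (h * N)" by (simp only: that(1))
    also have "\<dots> = hi * h * N" using that hi(1) cm by (intro sq_assoc[symmetric])
    finally show ?thesis using hi(3) that by simp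
  qed
  have B'sq: "B' * B' = 1\<^sub>m 2 \<or> B' * B' = - 1\<^sub>m 2"
    using sq
  proof
    assume "B * B = 1\<^sub>m 2"
    then have "h * (B' * B') = h * 1\<^sub>m 2" using BBh cm by simp
    then show ?thesis using canc[of "B' * B'" "1\<^sub>m 2"] B'c by simp
  next
    assume "B * B = - 1\<^sub>m 2"
    then have "h * (B' * B') = h * (- 1\<^sub>m 2)" using BBh cm by simp
    then show ?thesis using canc[of "B' * B'" "- 1\<^sub>m 2"] B'c by simp
  qed
  have Bhhi: "B = h * B' * hi"
  proof -
    have "h * B' * hi = B * (h * hi)" unfolding Bh[symmetric] using cm hi by (simp add: sq_assoc[of _ 2 _ _ 2])
    then show ?thesis using hi cm by simp
  qed
  have B'ne: "B' \<noteq> 1\<^sub>m 2" "B' \<noteq> - 1\<^sub>m 2"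
    using ne(3,4) Bhhi hi cm by auto
  have detB': "a * d - b * c = 1"
  proof -
    have "det (B * h) = det (h * B')" using Bh by simp
    then have "det B * det h = det h * det B'" using cm B'c by (simp add: det_mult[of _ 2])
    moreover have "det B = 1" using B(1) unfolding SL carrier_SL_int by simp
    moreover have "det h \<noteq> 0" using hdet by (auto simp: hh)
    ultimately show ?thesis by (simp add: B')
  qed
  have da: "d = - a" using order_2_trace[OF detB'] B'sq B'ne unfolding B' by blast
  obtain a1 b1 c1 d1 where BA: "B * A = mat2 a1 b1 c1 d1"
    using mat2_cases[of "B * A"] cm by (metis mult_carrier_mat)
  have tr: "a1 + d1 = 2 \<or> a1 + d1 = -2" by (rule PSL2_generators_trace[OF n SL A(1) B(1) A3 B2 gen BA])
  have BAh: "B * A * h = h * (B' * U2) \<or> B * A * h = - (h * (B' * U2))"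
    using Bh h(2) cm B'c by (intro pm_conj_mult) auto
  \<comment> \<open>The trace of B' U2 is b + d - c with d = -a; up to sign it is the trace of B
    A.\<close>
  have tr': "b - a - c = 2 \<or> b - a - c = -2"
    using BAh
  proof
    assume e: "B * A * h = h * (B' * U2)"
    have "a1 + d1 = b + (d - c)"
      by (rule conj_trace[where p = p and q = q and r = r and s = s and y = "b - a" and z = d])
        (use hdet e in \<open>auto simp: BA hh B' simp del: mat2_eq_iff\<close>)
    then show ?thesis using tr da by auto
  next
    assume e: "B * A * h = - (h * (B' * U2))"
    have "a1 + d1 = - b + - (d - c)"
      by (rule conj_trace[where p = p and q = q and r = r and s = s and y = "- (b - a)" and z = "- d"])
        (use hdet e in \<open>auto simp: BA hh B' algebra_simps\<close>)
    then show ?thesis using tr da by auto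
  qed
  \<comment> \<open>Up to sign the solutions are the conjugates of \<open>S2\<close> by powers of
    \<open>U2\<close>; these commute with \<open>U2\<close>, so correcting by them does not disturb
    A.\<close>
  have "\<exists>i\<in>{mat2 1 0 0 1, U2, U2 * U2}. B' * i = i * S2 \<or> B' * i = - (i * S2)"
    using tr'
  proof
    assume "b - a - c = 2"
    moreover have "a * a + b * c = -1" using detB' da by simp
    ultimately have "(a, b, c) \<in> {(0, 1, -1), (1, 1, -2), (1, 2, -1)}" by (rule solve_S[rotated])
    then have "(a = 0 \<and> b = 1 \<and> c = -1) \<or> (a = 1 \<and> b = 1 \<and> c = -2) \<or> (a = 1 \<and> b = 2 \<and> c = -1)" by simp
    then show ?thesis unfolding B' da S2_def by (elim disjE conjE) simp_all
  next
    assume "b - a - c = -2"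
    then have "(- b) - (- a) - (- c) = 2" by simp
    moreover have "(- a) * (- a) + (- b) * (- c) = -1" using detB' da by simp
    ultimately have "(- a, - b, - c) \<in> {(0, 1, -1), (1, 1, -2), (1, 2, -1)}" by (rule solve_S[rotated])
    then have "(a = 0 \<and> b = -1 \<and> c = 1) \<or> (a = -1 \<and> b = -1 \<and> c = 2) \<or> (a = -1 \<and> b = -2 \<and> c = 1)" by auto
    then show ?thesis unfolding B' da S2_def by (elim disjE conjE) simp_all
  qed
  then obtain i where i: "i \<in> {mat2 1 0 0 1, U2, U2 * U2}" "B' * i = i * S2 \<or> B' * i = - (i * S2)" by blast
  have ic: "i \<in> carrier_mat 2 2" "det i = 1" "U2 * i = i * U2" using i(1) by auto
  define g where "g = h * i"
  have gc: "g \<in> carrier_mat 2 2" using cm ic by (simp add: g_def)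
  have S2c: "S2 \<in> carrier_mat 2 2" by (simp add: S2_def)
  have gA: "A * g = g * U2 \<or> A * g = - (g * U2)"
  proof -
    have e1: "A * h * i = A * g" unfolding g_def using cm ic by (intro sq_assoc)
    have "h * U2 * i = h * (U2 * i)" using cm ic by (intro sq_assoc) simp_all
    also have "\<dots> = h * (i * U2)" by (simp only: ic(3))
    also have "\<dots> = g * U2" unfolding g_def using cm ic by (intro sq_assoc[symmetric, of _ 2 _ _ 2]) simp_all
    finally have e2: "h * U2 * i = g * U2" .
    have "A * h * i = h * U2 * i \<or> A * h * i = - (h * U2 * i)"
      using h(2) by (rule pm_mult_right) (use cm ic in simp_all)
    then show ?thesis unfolding e1 e2 .
  qed
  have gB: "B * g = g * S2 \<or> B * g = - (g * S2)"
  proof -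
    have "B * g = B * h * i" unfolding g_def using cm ic by (intro sq_assoc[symmetric])
    also have "\<dots> = h * B' * i" by (simp only: Bh)
    also have "\<dots> = h * (B' * i)" using cm ic B'c by (intro sq_assoc)
    finally have e1: "h * (B' * i) = B * g" ..
    have e2: "h * (i * S2) = g * S2" unfolding g_def using cm ic S2c by (intro sq_assoc[symmetric])
    have "h * (B' * i) = h * (i * S2) \<or> h * (B' * i) = - (h * (i * S2))"
      using i(2) by (rule pm_mult_left) (use cm ic S2c in simp_all)
    then show ?thesis unfolding e1 e2 .
  qed
  have "det g = det h * det i" unfolding g_def using cm ic by (simp add: det_mult[of _ 2])
  then have detg: "det g = 1 \<or> det g = -1" using ic h(1) by (auto simp: GL_int_iff_det)
  have fixed: "inv\<^bsub>PG\<^esub> (proj k) \<otimes>\<^bsub>PG\<^esub> \<phi> (proj V) \<otimes>\<^bsub>PG\<^esub> inv\<^bsub>PG\<^esub> (inv\<^bsub>PG\<^esub> (proj k)) = proj V"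
    if "k \<in> carrier \<Gamma>" "V \<in> carrier \<Gamma>" "W \<in> carrier \<Gamma>" "\<phi> (proj V) = proj W" "W * k = k * V \<or> W * k = - (k * V)" for k V W
  proof -
    have m: "W * k \<in> carrier \<Gamma>" "k * V \<in> carrier \<Gamma>" using m_closed that by (metis mult_eq)+
    have "proj W \<otimes>\<^bsub>PG\<^esub> proj k = proj k \<otimes>\<^bsub>PG\<^esub> proj V"
      using that(5) proj_eq_iff[OF m] that by (simp add: proj_mult)
    then show ?thesis using PG.conj_eq_iff[of "proj k" "proj W" "proj V"] that by simp
  qed
  from detg show ?thesis
  proof
    assume "det g = 1"
    then have g\<Gamma>: "g \<in> carrier \<Gamma>" using gc unfolding SL n carrier_SL_int by simp
    have "B * A * g = g * (S2 * U2) \<or> B * A * g = - (g * (S2 * U2))"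
      using gA gB cm gc S2c by (intro pm_conj_mult) auto
    moreover have SU: "S2 * U2 = mat2 1 1 0 1" by (simp add: S2_def)
    moreover have "\<phi> (proj (S2 * U2)) = proj (B * A)"
    proof -
      have "\<phi> (proj S2 \<otimes>\<^bsub>PG\<^esub> proj U2) = proj (B * A)" using A B by (simp add: proj_mult[symmetric])
      then show ?thesis by (simp add: proj_mult)
    qed
    ultimately have fx: "inv\<^bsub>PG\<^esub> (proj g) \<otimes>\<^bsub>PG\<^esub> \<phi> (proj (mat2 1 1 0 1)) \<otimes>\<^bsub>PG\<^esub> inv\<^bsub>PG\<^esub> (inv\<^bsub>PG\<^esub> (proj g)) = proj (mat2 1 1 0 1)"
      using fixed[OF g\<Gamma> _ AA(4), of "mat2 1 1 0 1"] by simp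
    have "mat2 1 1 0 1 [^]\<^bsub>\<Gamma>\<^esub> j = mat2 1 (int j) 0 1" for j :: nat
      by (induction j) (simp_all add: n one_mat2)
    then have "proj (mat2 1 1 0 1) [^]\<^bsub>PG\<^esub> j \<noteq> \<one>\<^bsub>PG\<^esub>" if "j > 0" for j :: nat
      using that by (simp add: proj_nat_pow proj_eq_one_iff) (simp add: n one_mat2)
    then show ?thesis using fx g\<Gamma> by (intro bexI[of _ "inv\<^bsub>PG\<^esub> (proj g)"] bexI[of _ "proj (mat2 1 1 0 1)"]) auto
  next
    assume dg: "det g = -1"
    \<comment> \<open>\<open>mat2 2 1 1 1\<close> is the square of \<open>mat2 1 1 1 0\<close>,
      whose inverse is \<open>mat2 0 1 1 (-1)\<close>. The latter has determinant -1 and commutes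
      with the square, so k has determinant 1 and conjugates it as g does.\<close>
    define k where "k = g * mat2 0 1 1 (-1)"
    have kc: "k \<in> carrier_mat 2 2" using gc by (simp add: k_def)
    have "det k = 1" unfolding k_def using gc dg by (simp add: det_mult[of _ 2])
    then have k\<Gamma>: "k \<in> carrier \<Gamma>" using kc unfolding SL n carrier_SL_int by simp
    \<comment> \<open>A lift of the image of S U S U^2, the product of an upper and a lower
      elementary matrix, which is \<open>mat2 2 1 1 1\<close>.\<close>
    define W where "W = (B * A) * ((B * A) * A)"
    have WG: "W \<in> carrier \<Gamma>" "(B * A) * A \<in> carrier \<Gamma>" unfolding W_def using m_closed A(1) AA by (metis mult_eq)+
    have "B * A * g = g * (S2 * U2) \<or> B * A * g = - (g * (S2 * U2))"
      using gA gB cm gc S2c by (intro pm_conj_mult) auto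
    then have "W * g = g * ((S2 * U2) * ((S2 * U2) * U2)) \<or> W * g = - (g * ((S2 * U2) * ((S2 * U2) * U2)))"
      unfolding W_def by (intro pm_conj_mult gA gB) (use cm gc S2c in simp_all)
    moreover have F2: "(S2 * U2) * ((S2 * U2) * U2) = mat2 2 1 1 1" by (simp add: S2_def)
    ultimately have Wg: "W * g = g * mat2 2 1 1 1 \<or> W * g = - (g * mat2 2 1 1 1)" by simp
    have "W * k = k * mat2 2 1 1 1 \<or> W * k = - (k * mat2 2 1 1 1)"
    proof -
      have Wc: "W \<in> carrier_mat 2 2" using carrier_mat[OF WG(1)] n by simp
      have 1: "W * k = (W * g) * mat2 0 1 1 (-1)" unfolding k_def using Wc gc by (simp add: sq_assoc[of _ 2 _ _ 2])
      have 2: "g * mat2 2 1 1 1 * mat2 0 1 1 (-1) = g * mat2 1 1 1 0"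
        using gc by (simp add: sq_assoc[of _ 2 _ _ 2])
      have 3: "k * mat2 2 1 1 1 = g * mat2 1 1 1 0"
        unfolding k_def using gc by (simp add: sq_assoc[of _ 2 _ _ 2])
      have "W * g * mat2 0 1 1 (-1) = g * mat2 2 1 1 1 * mat2 0 1 1 (-1) \<or>
          W * g * mat2 0 1 1 (-1) = - (g * mat2 2 1 1 1 * mat2 0 1 1 (-1))"
        using Wg by (rule pm_mult_right[where n = 2]) (use gc in simp_all)
      then show ?thesis unfolding 1 2 3 .
    qed
    moreover have "\<phi> (proj (mat2 2 1 1 1)) = proj W"
    proof -
      have SU: "S2 * U2 \<in> carrier \<Gamma>" "(S2 * U2) * U2 \<in> carrier \<Gamma>" by (simp_all add: S2_def)
      have "\<phi> (proj (S2 * U2)) = proj (B * A)" using A B by (simp flip: proj_mult)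
      moreover from this have "\<phi> (proj ((S2 * U2) * U2)) = proj ((B * A) * A)" using SU A AA by (simp flip: proj_mult)
      ultimately have "\<phi> (proj ((S2 * U2) * ((S2 * U2) * U2))) = proj W"
        unfolding W_def using SU A AA WG by (simp flip: proj_mult)
      then show ?thesis unfolding F2 .
    qed
    ultimately have fx: "inv\<^bsub>PG\<^esub> (proj k) \<otimes>\<^bsub>PG\<^esub> \<phi> (proj (mat2 2 1 1 1)) \<otimes>\<^bsub>PG\<^esub> inv\<^bsub>PG\<^esub> (inv\<^bsub>PG\<^esub> (proj k)) = proj (mat2 2 1 1 1)"
      by (intro fixed[OF k\<Gamma> _ WG(1)]) simp_all
    \<comment> \<open>The first row stays positive, so the off-diagonal entry y excludes 1 and
      -1.\<close>
    have pw: "\<exists>x y z w. mat2 2 1 1 1 [^]\<^bsub>\<Gamma>\<^esub> Suc j = mat2 x y z w \<and> x > 0 \<and> y > 0" for j :: nat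
    proof (induction j)
      case 0
      show ?case by (intro exI[of _ 2] exI[of _ 1]) (simp add: n one_mat2)
    next
      case (Suc j)
      then obtain x y z w where *: "mat2 2 1 1 1 [^]\<^bsub>\<Gamma>\<^esub> Suc j = mat2 x y z w" "x > 0" "y > 0" by blast
      have "mat2 2 1 1 1 [^]\<^bsub>\<Gamma>\<^esub> Suc (Suc j) = mat2 (2 * x + y) (x + y) (2 * z + w) (z + w)"
        using *(1) by (simp add: algebra_simps)
      moreover have "2 * x + y > 0" "x + y > 0" using * by simp_all
      ultimately show ?case by blast
    qed
    have "proj (mat2 2 1 1 1) [^]\<^bsub>PG\<^esub> j \<noteq> \<one>\<^bsub>PG\<^esub>" if j0: "j > 0" for j :: nat
    proof -
      obtain i where i: "j = Suc i" using j0 by (cases j) auto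
      obtain x y z w where e: "mat2 2 1 1 1 [^]\<^bsub>\<Gamma>\<^esub> j = mat2 x y z w" and "y > 0" using pw[of i] unfolding i by blast
      then have "mat2 2 1 1 1 [^]\<^bsub>\<Gamma>\<^esub> j \<notin> {1\<^sub>m n, - 1\<^sub>m n}" unfolding e n one_mat2 by simp
      then show ?thesis by (simp add: proj_nat_pow proj_eq_one_iff)
    qed
    then show ?thesis using fx k\<Gamma> by (intro bexI[of _ "inv\<^bsub>PG\<^esub> (proj k)"] bexI[of _ "proj (mat2 2 1 1 1)"]) auto
  qed
qed

theorem R_infinity: "R_infinity_property PG" "R_infinity_property \<Gamma>"
proof -
  have "\<exists>g\<in>carrier PG. \<exists>e\<in>carrier PG. g \<otimes>\<^bsub>PG\<^esub> \<phi> e \<otimes>\<^bsub>PG\<^esub> inv\<^bsub>PG\<^esub> g = e \<and> (\<forall>k>0. e [^]\<^bsub>PG\<^esub> (k::nat) \<noteq> \<one>\<^bsub>PG\<^esub>)"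
    if "\<phi> \<in> iso PG PG" for \<phi>
  proof (cases "n = 2")
    case True
    then show ?thesis using \<Gamma> fixed_element_PGL2[OF True _ that] fixed_element_PSL2[OF True _ that] by blast
  next
    case False
    then show ?thesis using n2 fixed_element_ge_3[OF _ that] by simp
  qed
  then show "R_infinity_property PG" "R_infinity_property \<Gamma>" using R_infinity_PG by blast+
qed

end

theorem theorem3p1:
  fixes n :: nat
  assumes "n \<ge> 2"
  shows "R_infinity_property (SL_int n) \<and> R_infinity_property (PSL_int n) \<and>
    R_infinity_property (GL_int n) \<and> R_infinity_property (PGL_int n)"
proof -
  interpret SL: int_matrix_group n "SL_int n" by unfold_locales (use assms in auto)
  interpret GL: int_matrix_group n "GL_int n" by unfold_locales (use assms in auto)
  show ?thesis
    using SL.R_infinity GL.R_infinity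
    by (simp add: PSL_int_def PGL_int_def SL.PG_def SL.centre_def GL.PG_def GL.centre_def)
qed

end
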